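(* Let $d\in\mathbb N$, $r>0$, $1\le n_1\le n_2$, $\varepsilon\in(0,1]$, $p\in[1,2]$, $\alpha,\beta\in(0,1)$ with $\alpha+\beta\le1/2$, and suppose $n_1\varepsilon^2\ge C\log\{1/(\alpha\beta)\}$ for a suitable absolute constant $C>0$. (i) There exist a non-interactive $\varepsilon$-LDP mechanism and a test $\phi$, both constructed without knowledge of the smoothness $s$, such that $\mathbb P(\phi=1)\le\alpha$ whenever $f_X=f_Y$, and for every $s>0$ there is a constant $C_{r,s,d}>0$ depending only on $r,s,d$ such that $\mathbb P(\phi=0)\le\beta$ for all $f_X,f_Y\in\mathcal F_{s,r,d}$ with $$\|f_X-f_Y\|_p\ge C_{r,s,d}\Big(\frac{\log(n_1\varepsilon^2)[\log\{\log(n_1\varepsilon^2)/(\alpha\beta)\}]^2}{n_1\varepsilon^2}\Big)^{2s/(4s+3d)}.$$ (ii) There exist a sequentially interactive $\varepsilon$-LDP mechanism and a test $\phi$, both constructed without knowledge of $s$, such that $\mathbb P(\phi=1)\le\alpha$ whenever $f_X=f_Y$, and for every $s>0$ there is $C'_{r,s,d}>0$ such that $\mathbb P(\phi=0)\le\beta$ for all $f_X,f_Y\in\mathcal F_{s,r,d}$ with $$\|f_X-f_Y\|_p\ge C'_{r,s,d}\Big(\frac{\log(n_1\varepsilon^2)[\log(n_2/\beta)\log\{\log(n_1\varepsilon^2)/(\alpha\beta)\}]^2}{n_1\varepsilon^2}\Big)^{2s/(4s+2d)}.$$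
   Context: Data: $X_1,\dots,X_{n_1}$ i.i.d. with density $f_X$ and $Y_1,\dots,Y_{n_2}$ i.i.d. with density $f_Y$ on $[0,1]^d$, independent; the test is a function of the privatized outputs. Trigonometric basis: $\varphi_0\equiv1$, $\varphi_{2j-1}(x)=\sqrt2\sin(2\pi jx)$, $\varphi_{2j}(x)=\sqrt2\cos(2\pi jx)$, $\varphi_{\mathbf l}(\mathbf x)=\prod_{j=1}^d\varphi_{l_j}(x_j)$ for $\mathbf l\in\mathbb N_0^d$. $\mathcal S_{s,r,d}=\{f=1+\sum_{\mathbf l\ne\mathbf 0}\theta_{\mathbf l}\varphi_{\mathbf l}:\sum_{\mathbf l}\|\mathbf l\|_2^{2s}\theta_{\mathbf l}^2\le r^2\}$ and $\mathcal F_{s,r,d}$ its subset of probability densities. Mechanisms: two-sample sequentially interactive mechanisms release $Z_i\sim Q_{X,i}(\cdot\mid X_i,Z_{1:i-1},W_{1:i-1})$, $W_i\sim Q_{Y,i}(\cdot\mid Y_i,Z_{1:i-1},W_{1:i-1})$ for $i\le n_1$ and $W_j\sim Q_{Y,j}(\cdot\mid Y_j,Z_{1:n_1},W_{1:j-1})$ for $j>n_1$; $\varepsilon$-LDP means each conditional satisfies $Q(S\mid x,\text{past})\le e^{\varepsilon}Q(S\mid x',\text{past})$ for all $S,x,x'$ and past; non-interactive means each depends only on its own raw datum. *)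

theory Defs
  imports "HOL-Probability.Probability"
begin

text \<open>Points of [0,1]^d are represented as extensional functions nat => real on {..<d}.\<close>

definition lebd :: "nat \<Rightarrow> (nat \<Rightarrow> real) measure" where
  "lebd d = PiM {..<d} (\<lambda>_. lborel)"

definition cube :: "nat \<Rightarrow> (nat \<Rightarrow> real) set" where
  "cube d = PiE {..<d} (\<lambda>_. {0..1})"

definition MI :: "nat \<Rightarrow> (nat \<Rightarrow> nat) set" where
  "MI d = PiE {..<d} (\<lambda>_. UNIV)"

definition MI0 :: "nat \<Rightarrow> nat \<Rightarrow> nat" where
  "MI0 d = restrict (\<lambda>_. 0) {..<d}"

definition trig1 :: "nat \<Rightarrow> real \<Rightarrow> real" where
  "trig1 l t = (if l = 0 then 1
     else if odd l then sqrt 2 * sin (2 * pi * real ((l + 1) div 2) * t)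
     else sqrt 2 * cos (2 * pi * real (l div 2) * t))"

definition trig :: "nat \<Rightarrow> (nat \<Rightarrow> nat) \<Rightarrow> (nat \<Rightarrow> real) \<Rightarrow> real" where
  "trig d l x = (\<Prod>j<d. trig1 (l j) (x j))"

definition mi_norm_pow :: "nat \<Rightarrow> real \<Rightarrow> (nat \<Rightarrow> nat) \<Rightarrow> real" where
  "mi_norm_pow d s l = (\<Sum>j<d. real (l j) ^ 2) powr s"

text \<open>Sobolev-type class S_{s,r,d}: f = 1 + sum_{l<>0} theta_l phi_l (as an unordered
  series converging in L2([0,1]^d)), with sum_l ||l||^(2s) theta_l^2 <= r^2.\<close>
definition sobolev_class :: "nat \<Rightarrow> real \<Rightarrow> real \<Rightarrow> ((nat \<Rightarrow> real) \<Rightarrow> real) set" where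
  "sobolev_class d s r = {f. (\<lambda>x. indicator (cube d) x * f x) \<in> borel_measurable (lebd d) \<and>
     (\<exists>\<theta> :: (nat \<Rightarrow> nat) \<Rightarrow> real. \<theta> (MI0 d) = 0 \<and>
        (\<lambda>l. mi_norm_pow d s l * (\<theta> l)\<^sup>2) summable_on MI d \<and>
        (\<Sum>\<^sub>\<infinity>l\<in>MI d. mi_norm_pow d s l * (\<theta> l)\<^sup>2) \<le> r\<^sup>2 \<and>
        (\<forall>e>0. \<exists>F. finite F \<and> F \<subseteq> MI d \<and>
           (\<forall>G. finite G \<and> F \<subseteq> G \<and> G \<subseteq> MI d \<longrightarrow>
              (\<integral>\<^sup>+x. indicator (cube d) x *
                  ennreal ((f x - 1 - (\<Sum>l\<in>G. \<theta> l * trig d l x))\<^sup>2) \<partial>lebd d) < ennreal e)))}"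

definition is_density :: "nat \<Rightarrow> ((nat \<Rightarrow> real) \<Rightarrow> real) \<Rightarrow> bool" where
  "is_density d f \<longleftrightarrow> (\<lambda>x. indicator (cube d) x * f x) \<in> borel_measurable (lebd d) \<and>
     (\<forall>x\<in>cube d. 0 \<le> f x) \<and>
     (\<integral>\<^sup>+x. indicator (cube d) x * ennreal (f x) \<partial>lebd d) = 1"

definition dens_class :: "nat \<Rightarrow> real \<Rightarrow> real \<Rightarrow> ((nat \<Rightarrow> real) \<Rightarrow> real) set" where
  "dens_class d s r = {f \<in> sobolev_class d s r. is_density d f}"

definition Lp_dist :: "nat \<Rightarrow> real \<Rightarrow> ((nat \<Rightarrow> real) \<Rightarrow> real) \<Rightarrow> ((nat \<Rightarrow> real) \<Rightarrow> real) \<Rightarrow> real" where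
  "Lp_dist d p f g = (\<integral>x. indicator (cube d) x * \<bar>f x - g x\<bar> powr p \<partial>lebd d) powr (1 / p)"

definition dens :: "nat \<Rightarrow> ((nat \<Rightarrow> real) \<Rightarrow> real) \<Rightarrow> (nat \<Rightarrow> real) measure" where
  "dens d f = density (lebd d) (\<lambda>x. indicator (cube d) x * ennreal (f x))"

text \<open>Privatised outputs live in a measurable space MZ over the type nat => real (chosen by
  the mechanism designer). A history is a pair (zs, ws) of extensional tuples of outputs.\<close>
type_synonym out = "nat \<Rightarrow> real"
type_synonym hist = "(nat \<Rightarrow> out) \<times> (nat \<Rightarrow> out)"
type_synonym kern = "nat \<Rightarrow> (nat \<Rightarrow> real) \<Rightarrow> (nat \<Rightarrow> out) \<Rightarrow> (nat \<Rightarrow> out) \<Rightarrow> out measure"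

definition histM :: "out measure \<Rightarrow> nat \<Rightarrow> nat \<Rightarrow> hist measure" where
  "histM MZ a b = PiM {..<a} (\<lambda>_. MZ) \<Otimes>\<^sub>M PiM {..<b} (\<lambda>_. MZ)"

primrec transcript :: "out measure \<Rightarrow> nat \<Rightarrow> kern \<Rightarrow> kern \<Rightarrow> (nat \<Rightarrow> nat \<Rightarrow> real) \<Rightarrow>
    (nat \<Rightarrow> nat \<Rightarrow> real) \<Rightarrow> nat \<Rightarrow> hist measure" where
  "transcript MZ n1 QX QY xs ys 0 = return (histM MZ 0 0) (\<lambda>_. undefined, \<lambda>_. undefined)"
| "transcript MZ n1 QX QY xs ys (Suc k) =
     transcript MZ n1 QX QY xs ys k \<bind> (\<lambda>(zs, ws).
       if k < n1 then
         QX k (xs k) zs ws \<bind> (\<lambda>z. QY k (ys k) zs ws \<bind> (\<lambda>w.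
           return (histM MZ (Suc k) (Suc k)) (zs(k := z), ws(k := w))))
       else
         QY k (ys k) zs ws \<bind> (\<lambda>w. return (histM MZ n1 (Suc k)) (zs, ws(k := w))))"

definition out_law :: "nat \<Rightarrow> out measure \<Rightarrow> nat \<Rightarrow> nat \<Rightarrow> kern \<Rightarrow> kern \<Rightarrow>
    ((nat \<Rightarrow> real) \<Rightarrow> real) \<Rightarrow> ((nat \<Rightarrow> real) \<Rightarrow> real) \<Rightarrow> hist measure" where
  "out_law d MZ n1 n2 QX QY fX fY =
     (PiM {..<n1} (\<lambda>_. dens d fX) \<Otimes>\<^sub>M PiM {..<n2} (\<lambda>_. dens d fY)) \<bind>
       (\<lambda>(xs, ys). transcript MZ n1 QX QY xs ys n2)"

definition reject_prob where
  "reject_prob d MZ n1 n2 QX QY (\<phi> :: hist \<Rightarrow> bool) fX fY =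
     measure (out_law d MZ n1 n2 QX QY fX fY) {t \<in> space (out_law d MZ n1 n2 QX QY fX fY). \<phi> t}"

definition accept_prob where
  "accept_prob d MZ n1 n2 QX QY (\<phi> :: hist \<Rightarrow> bool) fX fY =
     measure (out_law d MZ n1 n2 QX QY fX fY) {t \<in> space (out_law d MZ n1 n2 QX QY fX fY). \<not> \<phi> t}"

definition LDP_mech :: "nat \<Rightarrow> out measure \<Rightarrow> nat \<Rightarrow> nat \<Rightarrow> real \<Rightarrow> kern \<Rightarrow> kern \<Rightarrow> bool" where
  "LDP_mech d MZ n1 n2 \<epsilon> QX QY \<longleftrightarrow>
     (\<forall>i x zs ws. prob_space (QX i x zs ws) \<and> sets (QX i x zs ws) = sets MZ \<and>
                  prob_space (QY i x zs ws) \<and> sets (QY i x zs ws) = sets MZ) \<and>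
     (\<forall>i<n1. (\<lambda>(x, h). QX i x (fst h) (snd h))
                \<in> measurable (lebd d \<Otimes>\<^sub>M histM MZ i i) (prob_algebra MZ)) \<and>
     (\<forall>i<n2. (\<lambda>(x, h). QY i x (fst h) (snd h))
                \<in> measurable (lebd d \<Otimes>\<^sub>M histM MZ (min i n1) i) (prob_algebra MZ)) \<and>
     (\<forall>i<n1. \<forall>x\<in>cube d. \<forall>x'\<in>cube d. \<forall>zs ws. \<forall>A\<in>sets MZ.
        measure (QX i x zs ws) A \<le> exp \<epsilon> * measure (QX i x' zs ws) A) \<and>
     (\<forall>i<n2. \<forall>y\<in>cube d. \<forall>y'\<in>cube d. \<forall>zs ws. \<forall>A\<in>sets MZ.
        measure (QY i y zs ws) A \<le> exp \<epsilon> * measure (QY i y' zs ws) A)"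

definition non_interactive :: "kern \<Rightarrow> kern \<Rightarrow> bool" where
  "non_interactive QX QY \<longleftrightarrow>
     (\<exists>qX qY. \<forall>i x zs ws. QX i x zs ws = qX i x \<and> QY i x zs ws = qY i x)"

definition test_ok :: "out measure \<Rightarrow> nat \<Rightarrow> nat \<Rightarrow> (hist \<Rightarrow> bool) \<Rightarrow> bool" where
  "test_ok MZ n1 n2 \<phi> \<longleftrightarrow> \<phi> \<in> measurable (histM MZ n1 n2) (count_space UNIV)"

end

theory Submission
  imports Defs
begin

text \<open>
  Each user answers one bounded query \<open>g\<close> by randomised response, so that every difference of the
  answers of a pair of users \<open>(X\<^sub>i, Y\<^sub>i)\<close> has mean proportional to \<open>\<epsilon> \<integral> g (f\<^sub>X - f\<^sub>Y)\<close>, and the tests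
  only use these differences. The users are distributed over dyadic scales \<open>M = 2\<^sup>j\<close>, at which the
  \<open>k = M\<^sup>d\<close> lowest frequencies are examined, and at each scale over independent groups that vote;
  a group only needs a constant error probability, which Chebyshev's inequality gives, and
  Hoeffding's inequality for the votes turns it into an exponentially small one.

  Without interaction, a group assigns to each of the \<open>k\<close> basis functions its own users, and the sum
  of the estimated squared coefficients detects a squared \<open>L\<^sup>2\<close> distance of order
  \<open>k\<^bsup>3/2\<^esup> / (n\<^sub>1 \<epsilon>\<^sup>2)\<close>. With interaction, the first user publishes random signs that do not
  depend on the data, and everybody in a group queries the same random trigonometric polynomial
  with these signs as coefficients, clipped at \<open>\<tau> \<approx> k\<^bsup>1/2\<^esup>\<close> up to logarithms. By the
  Paley-Zygmund argument its inner product with \<open>f\<^sub>X - f\<^sub>Y\<close> is, with constant probability, as large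
  as the norm of the projection, which improves the order to \<open>k / (n\<^sub>1 \<epsilon>\<^sup>2)\<close>. Balancing with
  the bias \<open>M\<^bsup>-2s\<^esup>\<close> gives the two rates, and \<open>L\<^sup>p \<le> L\<^sup>2\<close> covers all \<open>p \<le> 2\<close>.
\<close>

section \<open>Laws on finite sets\<close>

text \<open>All users share one output space and the coin must be somebody's output. Hence everybody
  releases a vector in \<open>signs K\<close>: coordinate \<open>0\<close> carries the randomised
  response, the others are noise, and the uniform vector of user \<open>0\<close> is read as the
  coin. Without interaction \<open>K = 1\<close> and the queries ignore the coin. The output space
  being finite and the output law affine in the query, the monadic transcript collapses to an
  explicit product, and integrating out the data replaces each query by its mean. Given the coin, a
  test that ignores user \<open>0\<close> sees independent bounded variables. As \<open>s\<close> is
  unknown, all scales are tested at once, so a single error must be of order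
  \<open>\<alpha> / ln N\<close>. Voting achieves this at the price of a factor \<open>L0\<close> in
  the number of users, and sharing the users between about \<open>ln N\<close> scales costs the
  other logarithm. That \<open>n1\<close> is large enough for the scale in question comes for free:
  distances within the class are bounded by a multiple of \<open>r\<close>, so the separation
  hypothesis is void for smaller samples.\<close>

definition dmeas :: "'a set \<Rightarrow> ('a \<Rightarrow> real) \<Rightarrow> 'a measure" where
  "dmeas S p = point_measure S (\<lambda>x. ennreal (p x))"

definition prob_on :: "'a set \<Rightarrow> ('a \<Rightarrow> real) \<Rightarrow> bool" where
  "prob_on S p \<longleftrightarrow> finite S \<and> (\<forall>x\<in>S. 0 \<le> p x) \<and> sum p S = 1"

lemma space_dmeas [simp]: "space (dmeas S p) = S"
  by (simp add: dmeas_def space_point_measure)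

lemma sets_dmeas [simp]: "sets (dmeas S p) = Pow S"
  by (simp add: dmeas_def sets_point_measure)

lemma emeasure_dmeas:
  "prob_on S p \<Longrightarrow> A \<subseteq> S \<Longrightarrow> emeasure (dmeas S p) A = ennreal (sum p A)"
  unfolding dmeas_def prob_on_def
  by (subst emeasure_point_measure_finite) (auto intro!: sum_ennreal)

lemma measure_dmeas:
  assumes "prob_on S p" "A \<subseteq> S"
  shows "measure (dmeas S p) A = sum p A"
  using emeasure_dmeas[OF assms] assms
  by (auto simp: Sigma_Algebra.measure_def prob_on_def intro!: enn2real_ennreal sum_nonneg)

lemma prob_space_dmeas: "prob_on S p \<Longrightarrow> prob_space (dmeas S p)"
  by (intro prob_spaceI) (simp add: emeasure_dmeas, simp add: prob_on_def)

lemma prob_on_nonempty: "prob_on S p \<Longrightarrow> S \<noteq> {}"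
  by (auto simp: prob_on_def)

lemma dmeas_cong: "(\<And>x. x \<in> S \<Longrightarrow> p x = q x) \<Longrightarrow> dmeas S p = dmeas S q"
  unfolding dmeas_def point_measure_def
  by (intro density_cong) (auto simp: AE_count_space)

lemma prob_on_cong: "(\<And>x. x \<in> S \<Longrightarrow> p x = q x) \<Longrightarrow> prob_on S p = prob_on S q"
  unfolding prob_on_def by (auto cong: sum.cong)

lemma nn_integral_dmeas:
  "finite S \<Longrightarrow> (\<integral>\<^sup>+x. f x \<partial>dmeas S p) = (\<Sum>x\<in>S. ennreal (p x) * f x)"
  by (simp add: dmeas_def nn_integral_point_measure_finite)

lemma prob_on_bind:
  assumes "prob_on S p" "finite T" "\<And>x. x \<in> S \<Longrightarrow> prob_on T (q x)"
  shows "prob_on T (\<lambda>y. \<Sum>x\<in>S. p x * q x y)"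
proof -
  have "(\<Sum>y\<in>T. \<Sum>x\<in>S. p x * q x y) = (\<Sum>x\<in>S. p x * (\<Sum>y\<in>T. q x y))"
    by (subst sum.swap) (simp add: sum_distrib_left)
  also have "\<dots> = 1" using assms by (simp add: prob_on_def)
  finally show ?thesis using assms by (auto simp: prob_on_def intro!: sum_nonneg)
qed

text \<open>Every function on a finite discrete space is measurable, so a family of finite laws is
  automatically a kernel and the Giry bind is the finite mixture.\<close>

lemma bind_dmeas:
  assumes S: "prob_on S p" and T: "finite T" and q: "\<And>x. x \<in> S \<Longrightarrow> prob_on T (q x)"
    and f: "\<And>x. x \<in> S \<Longrightarrow> f x = dmeas T (q x)"
  shows "dmeas S p \<bind> f = dmeas T (\<lambda>y. \<Sum>x\<in>S. p x * q x y)"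
proof (rule measure_eqI)
  have fm: "f \<in> measurable (dmeas S p) (subprob_algebra (count_space T))"
    unfolding dmeas_def measurable_point_measure_eq1
    using f q by (auto simp: space_subprob_algebra prob_space_dmeas prob_space_imp_subprob_space)
  have ne: "space (dmeas S p) \<noteq> {}" using prob_on_nonempty[OF S] by simp
  show "sets (dmeas S p \<bind> f) = sets (dmeas T (\<lambda>y. \<Sum>x\<in>S. p x * q x y))"
    by (subst sets_bind[of _ _ "count_space T"]) (use f ne in auto)
  fix A assume "A \<in> sets (dmeas S p \<bind> f)"
  hence A: "A \<subseteq> T"
    by (subst (asm) sets_bind[of _ _ "count_space T"]) (use f ne in auto)
  have "emeasure (dmeas S p \<bind> f) A = (\<integral>\<^sup>+x. emeasure (f x) A \<partial>dmeas S p)"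
    by (rule emeasure_bind[OF ne fm]) (use A in auto)
  also have "\<dots> = (\<Sum>x\<in>S. ennreal (p x) * ennreal (sum (q x) A))"
    using S A q f by (subst nn_integral_dmeas) (auto simp: prob_on_def emeasure_dmeas)
  also have "\<dots> = (\<Sum>x\<in>S. ennreal (p x * sum (q x) A))"
    using S A q by (intro sum.cong refl ennreal_mult[symmetric])
      (auto simp: prob_on_def subset_iff intro!: sum_nonneg)
  also have "\<dots> = ennreal (\<Sum>x\<in>S. p x * sum (q x) A)"
    using S A q by (intro sum_ennreal) (auto simp: prob_on_def subset_iff intro!: sum_nonneg mult_nonneg_nonneg)
  also have "(\<Sum>x\<in>S. p x * sum (q x) A) = (\<Sum>y\<in>A. \<Sum>x\<in>S. p x * q x y)"
    unfolding sum_distrib_left by (rule sum.swap)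
  also have "ennreal \<dots> = emeasure (dmeas T (\<lambda>y. \<Sum>x\<in>S. p x * q x y)) A"
    by (rule emeasure_dmeas[symmetric, OF prob_on_bind[OF S T q] A])
  finally show "emeasure (dmeas S p \<bind> f) A = \<dots>" .
qed

lemma prob_on_delta: "finite T \<Longrightarrow> y \<in> T \<Longrightarrow> prob_on T (\<lambda>y'. if y' = y then 1 else 0)"
  by (simp add: prob_on_def)

lemma return_eq_dmeas:
  assumes "finite T" "y \<in> T"
  shows "return (count_space T) y = dmeas T (\<lambda>y'. if y' = y then 1 else 0)"
proof (rule measure_eqI)
  fix A assume "A \<in> sets (return (count_space T) y)"
  hence "A \<subseteq> T" by simp
  thus "emeasure (return (count_space T) y) A = emeasure (dmeas T (\<lambda>y'. if y' = y then 1 else 0)) A"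
    using assms finite_subset[of A T]
    by (simp add: emeasure_dmeas[OF prob_on_delta] indicator_def)
qed simp

section \<open>Sign vectors and the randomised response\<close>

definition signs :: "nat \<Rightarrow> out set" where
  "signs K = PiE {..<K} (\<lambda>_. {-1, 1})"

text \<open>The uniform law on \<open>signs K\<close> reweighted by
  \<open>1 + a * \<omega> 0\<close>: coordinate \<open>0\<close> gets mean \<open>a\<close>, the
  remaining coordinates stay fair and independent of it. With \<open>a = 0\<close> the law is
  uniform, so the same formula also produces the coin.\<close>

definition tilt :: "nat \<Rightarrow> real \<Rightarrow> out \<Rightarrow> real" where
  "tilt K a \<omega> = (1 + a * \<omega> 0) / 2 ^ K"

lemma finite_signs [simp]: "finite (signs K)"
  unfolding signs_def by (intro finite_PiE) auto

lemma card_signs: "card (signs K) = 2 ^ K"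
  unfolding signs_def by (subst card_PiE) (auto simp: numeral_2_eq_2)

lemma signs_cases: "w \<in> signs K \<Longrightarrow> i < K \<Longrightarrow> w i = -1 \<or> w i = 1"
  unfolding signs_def using PiE_mem[of w "{..<K}" "\<lambda>_. {-1, 1}" i] by simp

lemma signs_sq: "w \<in> signs K \<Longrightarrow> i < K \<Longrightarrow> w i * w i = 1"
  using signs_cases[of w K i] by auto

lemma signs_abs: "w \<in> signs K \<Longrightarrow> i < K \<Longrightarrow> \<bar>w i\<bar> = 1"
  using signs_cases[of w K i] by auto

lemma signs_flip:
  assumes "w \<in> signs K" "i < K"
  shows "w(i := - w i) \<in> signs K"
proof -
  have "- w i \<in> {-1, 1}"
    using signs_cases[OF assms] by auto
  hence "w(i := - w i) \<in> PiE (insert i {..<K}) (\<lambda>_. {-1, 1})"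
    using assms(1) unfolding signs_def by (rule PiE_fun_upd)
  also have "insert i {..<K} = {..<K}" using assms by (intro insert_absorb) simp
  finally show ?thesis unfolding signs_def .
qed

text \<open>Flipping coordinate \<open>i\<close> permutes the sign vectors and negates every
  summand, so the sum equals its own negative. This takes the place of independence in the moment
  computations.\<close>

lemma sum_signs_flip:
  fixes g :: "out \<Rightarrow> real"
  assumes i: "i < K" and g: "\<And>w. g (w(i := - w i)) = g w"
  shows "(\<Sum>w\<in>signs K. g w * w i) = 0"
proof -
  let ?f = "\<lambda>w::out. w(i := - w i)"
  have "bij_betw ?f (signs K) (signs K)"
    by (rule bij_betw_byWitness[where f' = ?f]) (use signs_flip i in auto)
  hence "(\<Sum>w\<in>signs K. g w * w i) = (\<Sum>w\<in>signs K. g (?f w) * ?f w i)"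
    by (rule sum.reindex_bij_betw[symmetric])
  also have "\<dots> = - (\<Sum>w\<in>signs K. g w * w i)" unfolding g by (simp add: sum_negf)
  finally show ?thesis by simp
qed

lemma sum_signs_coord: "i < K \<Longrightarrow> (\<Sum>w\<in>signs K. w i) = 0"
  using sum_signs_flip[of i K "\<lambda>_. 1"] by simp

lemma tilt_nonneg: "0 < K \<Longrightarrow> \<bar>a\<bar> \<le> 1 \<Longrightarrow> \<omega> \<in> signs K \<Longrightarrow> 0 \<le> tilt K a \<omega>"
  using signs_cases[of \<omega> K 0] by (auto simp: tilt_def)

lemma sum_tilt: "0 < K \<Longrightarrow> (\<Sum>\<omega>\<in>signs K. tilt K a \<omega>) = 1"
  unfolding tilt_def
  by (simp add: sum_divide_distrib[symmetric] sum.distrib sum_distrib_left[symmetric] sum_signs_coord card_signs)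

lemma sum_tilt_0: "0 < K \<Longrightarrow> (\<Sum>\<omega>\<in>signs K. tilt K a \<omega> * \<omega> 0) = a"
proof -
  assume K: "0 < K"
  have "(\<Sum>\<omega>\<in>signs K. tilt K a \<omega> * \<omega> 0) = (\<Sum>\<omega>\<in>signs K. (\<omega> 0 + a) / 2 ^ K)"
    by (intro sum.cong) (auto simp: tilt_def dest!: signs_cases[OF _ K])
  also have "\<dots> = a"
    using K by (simp add: sum_divide_distrib[symmetric] sum.distrib sum_signs_coord card_signs)
  finally show ?thesis .
qed

lemma prob_on_tilt: "0 < K \<Longrightarrow> \<bar>a\<bar> \<le> 1 \<Longrightarrow> prob_on (signs K) (tilt K a)"
  by (simp add: prob_on_def tilt_nonneg sum_tilt)

section \<open>The transcript of the public-coin mechanism\<close>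

definition hists :: "nat \<Rightarrow> nat \<Rightarrow> nat \<Rightarrow> hist set" where
  "hists K a b = PiE {..<a} (\<lambda>_. signs K) \<times> PiE {..<b} (\<lambda>_. signs K)"

lemma finite_hists [simp]: "finite (hists K a b)"
  unfolding hists_def by (intro finite_cartesian_product finite_PiE) auto

text \<open>A finite product of finite discrete spaces is discrete. Consequently every test is
  measurable, and kernels need checking only in the raw datum.\<close>

lemma histM_signs: "histM (count_space (signs K)) a b = count_space (hists K a b)"
  unfolding histM_def hists_def
  by (subst (1 2) count_space_PiM_finite)
     (auto intro!: pair_measure_countable countable_finite finite_PiE)

text \<open>The public coin is the output \<^term>\<open>zs 0\<close> of the first user of the first sample, which will be
  uniform on \<^term>\<open>signs K\<close> because that user gets the trivial query \<^term>\<open>g 0 = 0\<close>.\<close>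

definition coin_kern :: "nat \<Rightarrow> real \<Rightarrow> (nat \<Rightarrow> out \<Rightarrow> (nat \<Rightarrow> real) \<Rightarrow> real) \<Rightarrow> kern" where
  "coin_kern K e g i x zs ws = dmeas (signs K) (tilt K (e * g i (zs 0) x))"

text \<open>Used twice: with the queries evaluated at the data it is the density of the transcript,
  with the means of the queries it is the density of the outputs after the data are integrated out.
  The coin \<open>zs 0\<close> is read off the history itself.\<close>

definition coin_dens :: "nat \<Rightarrow> real \<Rightarrow> (nat \<Rightarrow> out \<Rightarrow> real) \<Rightarrow> (nat \<Rightarrow> out \<Rightarrow> real) \<Rightarrow> nat \<Rightarrow> nat \<Rightarrow>
    hist \<Rightarrow> real" where
  "coin_dens K e a b m n = (\<lambda>(zs, ws). (\<Prod>i<m. tilt K (e * a i (zs 0)) (zs i)) *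
     (\<Prod>i<n. tilt K (e * b i (zs 0)) (ws i)))"

lemma PiE_lessThan_Suc_upd:
  "u \<in> PiE {..<k} (\<lambda>_. S) \<Longrightarrow> z \<in> S \<Longrightarrow> u(k := z) \<in> PiE {..<Suc k} (\<lambda>_. S)"
  unfolding lessThan_Suc by (rule PiE_fun_upd)

text \<open>The equation \<open>y = u(k := z)\<close> has exactly one solution: an extensional
  \<open>u\<close> is \<open>undefined\<close> at \<open>k\<close>, so restoring that value in
  \<open>y\<close> recovers it.\<close>

lemma sum_PiE_extend:
  fixes F :: "(nat \<Rightarrow> 'a) \<Rightarrow> 'a \<Rightarrow> real"
  assumes "finite S" "y \<in> PiE {..<Suc k} (\<lambda>_. S)"
  shows "(\<Sum>u\<in>PiE {..<k} (\<lambda>_. S). \<Sum>z\<in>S. if y = u(k := z) then F u z else 0) =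
    F (y(k := undefined)) (y k)"
proof -
  have "(\<Sum>u\<in>PiE {..<k} (\<lambda>_. S). \<Sum>z\<in>S. if y = u(k := z) then F u z else 0) =
    (\<Sum>(u, z)\<in>PiE {..<k} (\<lambda>_. S) \<times> S. if y = u(k := z) then F u z else 0)"
    by (simp add: sum.cartesian_product)
  also have "\<dots> = (\<Sum>(u, z)\<in>{(y(k := undefined), y k)}. if y = u(k := z) then F u z else 0)"
  proof (rule sum.mono_neutral_right)
    show "finite (PiE {..<k} (\<lambda>_. S) \<times> S)" using assms by (auto intro: finite_PiE)
    show "{(y(k := undefined), y k)} \<subseteq> PiE {..<k} (\<lambda>_. S) \<times> S"
      using assms by (auto simp: PiE_iff extensional_def)
    show "\<forall>i\<in>PiE {..<k} (\<lambda>_. S) \<times> S - {(y(k := undefined), y k)}.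
        (case i of (u, z) \<Rightarrow> if y = u(k := z) then F u z else 0) = 0"
    proof
      fix i assume i: "i \<in> PiE {..<k} (\<lambda>_. S) \<times> S - {(y(k := undefined), y k)}"
      obtain u z where uz: "i = (u, z)" by force
      with i have u: "u \<in> PiE {..<k} (\<lambda>_. S)" and ne: "(u, z) \<noteq> (y(k := undefined), y k)" by auto
      have "u k = undefined" using PiE_arb[OF u, of k] by simp
      hence "u = (u(k := z))(k := undefined)" by (metis fun_upd_triv fun_upd_upd)
      with ne have "y \<noteq> u(k := z)" by auto
      thus "(case i of (u, z) \<Rightarrow> if y = u(k := z) then F u z else 0) = 0" by (simp add: uz)
    qed
  qed
  also have "\<dots> = F (y(k := undefined)) (y k)" by simp
  finally show ?thesis .
qed

text \<open>\<open>e\<close> stands for \<open>\<epsilon> / 3\<close>, hence the bound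
  \<open>1/3\<close>. The condition on \<open>g 0\<close> keeps the first round free of the data and
  of a coin that does not exist yet.\<close>

locale coin_mech =
  fixes K :: nat and e :: real and g :: "nat \<Rightarrow> out \<Rightarrow> (nat \<Rightarrow> real) \<Rightarrow> real" and n1 n2 d :: nat
  assumes K: "0 < K" and e: "0 \<le> e" "e \<le> 1/3"
    and g1: "\<And>i v x. \<bar>g i v x\<bar> \<le> 1" and g0: "\<And>v x. g 0 v x = 0" and n1: "1 \<le> n1" "n1 \<le> n2"
    and gm [measurable]: "\<And>i v. g i v \<in> borel_measurable (lebd d)"
begin

lemma e_bound: "\<bar>a\<bar> \<le> 1 \<Longrightarrow> \<bar>e * a\<bar> \<le> 1/3"
proof -
  assume a: "\<bar>a\<bar> \<le> 1"
  have "\<bar>e * a\<bar> = e * \<bar>a\<bar>" using e by (simp add: abs_mult)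
  also have "\<dots> \<le> 1/3 * 1" using a e by (intro mult_mono) auto
  finally show ?thesis by simp
qed

lemma prob_on_user: "prob_on (signs K) (tilt K (e * g i v x))"
  using e_bound[OF g1, of i v x] K by (intro prob_on_tilt) linarith+

text \<open>Induction over the rounds. Total mass is proved along with the density, because
  composing with the next kernel by \<open>bind_dmeas\<close> requires a probability law at the
  current stage. From round \<open>n1\<close> on only the second sample answers, which is what
  \<open>min k n1\<close> records.\<close>

lemma transcript_coin:
  "prob_on (hists K (min k n1) k)
     (coin_dens K e (\<lambda>i v. g i v (xs i)) (\<lambda>i v. g i v (ys i)) (min k n1) k) \<and>
   transcript (count_space (signs K)) n1 (coin_kern K e g) (coin_kern K e g) xs ys k =
     dmeas (hists K (min k n1) k)
       (coin_dens K e (\<lambda>i v. g i v (xs i)) (\<lambda>i v. g i v (ys i)) (min k n1) k)"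
proof (induction k)
  case 0
  have 1: "hists K 0 0 = {(\<lambda>_. undefined, \<lambda>_. undefined)}" by (auto simp: hists_def)
  have "return (count_space (hists K 0 0)) (\<lambda>_. undefined, \<lambda>_. undefined) =
    dmeas (hists K 0 0) (\<lambda>y'. if y' = (\<lambda>_. undefined, \<lambda>_. undefined) then 1 else 0)"
    by (intro return_eq_dmeas) (auto simp: 1)
  also have "\<dots> = dmeas (hists K 0 0) (coin_dens K e (\<lambda>i v. g i v (xs i)) (\<lambda>i v. g i v (ys i)) 0 0)"
    by (intro dmeas_cong) (auto simp: 1 coin_dens_def)
  finally show ?case by (simp add: histM_signs) (simp add: 1 coin_dens_def prob_on_def)
next
  case (Suc k)
  let ?c = "coin_dens K e (\<lambda>i v. g i v (xs i)) (\<lambda>i v. g i v (ys i))"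
  let ?p = "\<lambda>i (zs::nat \<Rightarrow> out). tilt K (e * g i (zs 0) (xs i))"
  let ?q = "\<lambda>i (zs::nat \<Rightarrow> out). tilt K (e * g i (zs 0) (ys i))"
  note IH1 = Suc[THEN conjunct1] and IH2 = Suc[THEN conjunct2]
  \<comment> \<open>Appending an output changes the coin only for \<open>k = 0\<close>, when it is
    written for the first time; then \<open>i = 0\<close>, and the query of user \<open>0\<close>
    vanishes.\<close>
  have g_upd: "g i ((zs(k := z)) 0) x = g i (zs 0) x" if "i \<le> k" for i zs z x
    using that by (cases "k = 0") (auto simp: g0)
  show ?case
  proof (cases "k < n1")
    case True
    let ?T = "hists K (Suc k) (Suc k)"
    let ?r = "\<lambda>(h::hist) (y::hist). \<Sum>z\<in>signs K. ?p k (fst h) z * (\<Sum>w\<in>signs K. ?q k (fst h) w *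
        (if y = ((fst h)(k := z), (snd h)(k := w)) then 1 else 0))"
    let ?f = "\<lambda>(zs::nat \<Rightarrow> out, ws::nat \<Rightarrow> out). Giry_Monad.bind (coin_kern K e g k (xs k) zs ws) (\<lambda>z.
          Giry_Monad.bind (coin_kern K e g k (ys k) zs ws)
          (\<lambda>w. return (count_space ?T) (zs(k := z), ws(k := w))))"
    have inT: "((fst h)(k := z), (snd h)(k := w)) \<in> ?T"
      if "h \<in> hists K k k" "z \<in> signs K" "w \<in> signs K" for h z w
      using that by (simp add: hists_def mem_Times_iff PiE_lessThan_Suc_upd)
    have r1: "prob_on ?T (\<lambda>y. \<Sum>w\<in>signs K. ?q k (fst h) w *
        (if y = ((fst h)(k := z), (snd h)(k := w)) then 1 else 0))"
      if "h \<in> hists K k k" "z \<in> signs K" for h z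
      by (intro prob_on_bind prob_on_user prob_on_delta inT that) auto
    have r: "prob_on ?T (?r h)" if "h \<in> hists K k k" for h
      by (intro prob_on_bind[OF prob_on_user _ r1] that) auto
    have fr: "?f h = dmeas ?T (?r h)" if h: "h \<in> hists K k k" for h
      unfolding coin_kern_def case_prod_unfold
      by (intro bind_dmeas prob_on_user r1 prob_on_delta return_eq_dmeas inT h) auto
    \<comment> \<open>A history \<open>y\<close> arises from one predecessor and one pair of new
      outputs, so the mixture over predecessors has a single nonzero term. The sums are reordered to
      let \<open>sum_PiE_extend\<close> act on each sample separately.\<close>
    have eq: "(\<Sum>h\<in>hists K k k. ?c k k h * ?r h y) = ?c (Suc k) (Suc k) y" if y: "y \<in> ?T" for y
    proof -
      obtain zs' ws' where y': "y = (zs', ws')" by force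
      let ?A = "PiE {..<k} (\<lambda>_. signs K)"
      let ?F = "\<lambda>zs z ws w. ?c k k (zs, ws) * ?p k zs z * ?q k zs w"
      have "(\<Sum>h\<in>hists K k k. ?c k k h * ?r h y) =
        (\<Sum>zs\<in>?A. \<Sum>ws\<in>?A. \<Sum>z\<in>signs K. \<Sum>w\<in>signs K.
           if zs' = zs(k := z) then (if ws' = ws(k := w) then ?F zs z ws w else 0) else 0)"
        unfolding hists_def sum.cartesian_product' y'
        by (simp only: sum_distrib_left fst_conv snd_conv, intro sum.cong refl, simp)
      also have "\<dots> = (\<Sum>zs\<in>?A. \<Sum>z\<in>signs K. if zs' = zs(k := z) then
          (\<Sum>ws\<in>?A. \<Sum>w\<in>signs K. if ws' = ws(k := w) then ?F zs z ws w else 0) else 0)"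
      proof (rule sum.cong[OF refl])
        fix zs show "(\<Sum>ws\<in>?A. \<Sum>z\<in>signs K. \<Sum>w\<in>signs K.
           if zs' = zs(k := z) then (if ws' = ws(k := w) then ?F zs z ws w else 0) else 0) =
          (\<Sum>z\<in>signs K. if zs' = zs(k := z) then
          (\<Sum>ws\<in>?A. \<Sum>w\<in>signs K. if ws' = ws(k := w) then ?F zs z ws w else 0) else 0)"
          by (subst sum.swap) (intro sum.cong, auto)
      qed
      also have "\<dots> = (\<Sum>zs\<in>?A. \<Sum>z\<in>signs K. if zs' = zs(k := z) then
          ?F zs z (ws'(k := undefined)) (ws' k) else 0)"
        using y y' by (subst sum_PiE_extend) (auto simp: hists_def)
      also have "\<dots> = ?F (zs'(k := undefined)) (zs' k) (ws'(k := undefined)) (ws' k)"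
        using y y' by (subst sum_PiE_extend) (auto simp: hists_def)
      also have "\<dots> = ?c (Suc k) (Suc k) y"
        unfolding coin_dens_def y' by (simp add: g_upd g0)
      finally show ?thesis .
    qed
    have "transcript (count_space (signs K)) n1 (coin_kern K e g) (coin_kern K e g) xs ys (Suc k) =
      dmeas (hists K k k) (?c k k) \<bind> ?f"
      using True IH2 by (simp add: histM_signs min_def)
    also have "\<dots> = dmeas ?T (\<lambda>y. \<Sum>h\<in>hists K k k. ?c k k h * ?r h y)"
      by (rule bind_dmeas[OF _ _ r fr]) (use IH1 True in \<open>auto simp: min_def\<close>)
    also have "\<dots> = dmeas ?T (?c (Suc k) (Suc k))" by (rule dmeas_cong) (rule eq)
    finally have t: "transcript (count_space (signs K)) n1 (coin_kern K e g) (coin_kern K e g) xs ys (Suc k) = \<dots>" .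
    have "prob_on ?T (\<lambda>y. \<Sum>h\<in>hists K k k. ?c k k h * ?r h y)"
      by (rule prob_on_bind[OF _ _ r]) (use IH1 True in \<open>auto simp: min_def\<close>)
    hence "prob_on ?T (?c (Suc k) (Suc k))" by (subst (asm) prob_on_cong[OF eq])
    with t show ?thesis using True by (simp add: min_def)
  next
    case False
    let ?T = "hists K n1 (Suc k)"
    let ?r = "\<lambda>(h::hist) (y::hist). \<Sum>w\<in>signs K. ?q k (fst h) w * (if y = (fst h, (snd h)(k := w)) then 1 else 0)"
    let ?f = "\<lambda>(zs::nat \<Rightarrow> out, ws::nat \<Rightarrow> out). Giry_Monad.bind (coin_kern K e g k (ys k) zs ws)
          (\<lambda>w. return (count_space ?T) (zs, ws(k := w)))"
    have inT: "(fst h, (snd h)(k := w)) \<in> ?T" if "h \<in> hists K n1 k" "w \<in> signs K" for h w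
      using that by (simp add: hists_def mem_Times_iff PiE_lessThan_Suc_upd)
    have r: "prob_on ?T (?r h)" if "h \<in> hists K n1 k" for h
      by (intro prob_on_bind prob_on_user prob_on_delta inT that) auto
    have fr: "?f h = dmeas ?T (?r h)" if h: "h \<in> hists K n1 k" for h
      unfolding coin_kern_def case_prod_unfold
      by (intro bind_dmeas prob_on_user prob_on_delta return_eq_dmeas inT h) auto
    have eq: "(\<Sum>h\<in>hists K n1 k. ?c n1 k h * ?r h y) = ?c n1 (Suc k) y" if y: "y \<in> ?T" for y
    proof -
      obtain zs' ws' where y': "y = (zs', ws')" by force
      let ?A = "PiE {..<k} (\<lambda>_. signs K)" and ?B = "PiE {..<n1} (\<lambda>_. signs K)"
      let ?F = "\<lambda>zs ws w. ?c n1 k (zs, ws) * ?q k zs w"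
      have "(\<Sum>h\<in>hists K n1 k. ?c n1 k h * ?r h y) =
        (\<Sum>zs\<in>?B. \<Sum>ws\<in>?A. \<Sum>w\<in>signs K.
           if zs' = zs then (if ws' = ws(k := w) then ?F zs ws w else 0) else 0)"
        unfolding hists_def sum.cartesian_product' y'
        by (simp only: sum_distrib_left fst_conv snd_conv, intro sum.cong refl, simp)
      also have "\<dots> = (\<Sum>zs\<in>?B. if zs' = zs then
          (\<Sum>ws\<in>?A. \<Sum>w\<in>signs K. if ws' = ws(k := w) then ?F zs ws w else 0) else 0)"
        by (intro sum.cong) auto
      also have "\<dots> = (\<Sum>zs\<in>?B. if zs' = zs then ?F zs (ws'(k := undefined)) (ws' k) else 0)"
        using y y' by (subst sum_PiE_extend) (auto simp: hists_def)
      also have "\<dots> = ?F zs' (ws'(k := undefined)) (ws' k)"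
        using y y' by (subst sum.delta') (auto simp: hists_def intro: finite_PiE)
      also have "\<dots> = ?c n1 (Suc k) y"
        unfolding coin_dens_def y' by simp
      finally show ?thesis .
    qed
    have "transcript (count_space (signs K)) n1 (coin_kern K e g) (coin_kern K e g) xs ys (Suc k) =
      dmeas (hists K n1 k) (?c n1 k) \<bind> ?f"
      using False IH2 by (simp add: histM_signs min_def)
    also have "\<dots> = dmeas ?T (\<lambda>y. \<Sum>h\<in>hists K n1 k. ?c n1 k h * ?r h y)"
      by (rule bind_dmeas[OF _ _ r fr]) (use IH1 False in \<open>simp_all add: min.absorb2\<close>)
    also have "\<dots> = dmeas ?T (?c n1 (Suc k))" by (rule dmeas_cong) (rule eq)
    finally have t: "transcript (count_space (signs K)) n1 (coin_kern K e g) (coin_kern K e g) xs ys (Suc k) = \<dots>" .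
    have "prob_on ?T (\<lambda>y. \<Sum>h\<in>hists K n1 k. ?c n1 k h * ?r h y)"
      by (rule prob_on_bind[OF _ _ r]) (use IH1 False in \<open>simp_all add: min.absorb2\<close>)
    hence "prob_on ?T (?c n1 (Suc k))" by (subst (asm) prob_on_cong[OF eq])
    with t show ?thesis using False by (simp add: min_def)
  qed
qed

end

section \<open>From the mechanism to a product law\<close>

lemma sets_dens [simp, measurable_cong]: "sets (dens d f) = sets (lebd d)"
  by (simp add: dens_def)

lemma ennreal_indicator_times: "indicator A x * ennreal y = ennreal (indicator A x * y)"
  by (simp add: indicator_def)

lemma prob_space_dens:
  assumes "is_density d f" shows "prob_space (dens d f)"
proof (rule prob_spaceI)
  have "(\<lambda>x. ennreal (indicator (cube d) x * f x)) \<in> borel_measurable (lebd d)"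
    using assms by (intro measurable_compose[OF _ measurable_ennreal]) (simp add: is_density_def)
  moreover have "(\<lambda>x. ennreal (indicator (cube d) x * f x)) = (\<lambda>x. indicator (cube d) x * ennreal (f x))"
    by (simp add: ennreal_indicator_times)
  ultimately show "emeasure (dens d f) (space (dens d f)) = 1"
    using assms by (simp add: dens_def emeasure_density is_density_def cong: nn_integral_cong)
qed

context coin_mech
begin

definition avg :: "((nat \<Rightarrow> real) \<Rightarrow> real) \<Rightarrow> nat \<Rightarrow> out \<Rightarrow> real" where
  "avg f i v = (\<integral>x. g i v x \<partial>dens d f)"

lemma avg_bound: "is_density d f \<Longrightarrow> \<bar>avg f i v\<bar> \<le> 1"
proof -
  assume "is_density d f"
  then interpret prob_space "dens d f" by (rule prob_space_dens)
  have "\<bar>avg f i v\<bar> \<le> (\<integral>x. \<bar>g i v x\<bar> \<partial>dens d f)" unfolding avg_def by (rule integral_abs_bound)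
  also have "\<dots> \<le> 1"
    by (intro integral_le_const integrable_const_bound[of _ 1]) (auto simp: g1)
  finally show ?thesis .
qed

text \<open>The tilt is affine in the query, so integrating out the raw datum amounts to replacing
  the query by its mean.\<close>

lemma nn_integral_tilt:
  assumes f: "is_density d f" and w: "\<omega> \<in> signs K"
  shows "(\<integral>\<^sup>+x. ennreal (tilt K (e * g i v x) \<omega>) \<partial>dens d f) = ennreal (tilt K (e * avg f i v) \<omega>)"
proof -
  interpret prob_space "dens d f" using f by (rule prob_space_dens)
  have nn: "0 \<le> tilt K (e * g i v x) \<omega>" for x
    using e_bound[OF g1, of i v x] K w by (intro tilt_nonneg) linarith+
  have int: "integrable (dens d f) (g i v)"
    by (intro integrable_const_bound[of _ 1]) (auto simp: g1)
  have "(\<integral>\<^sup>+x. ennreal (tilt K (e * g i v x) \<omega>) \<partial>dens d f) = ennreal (\<integral>x. tilt K (e * g i v x) \<omega> \<partial>dens d f)"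
    using int by (intro nn_integral_eq_integral AE_I2 nn) (auto simp: tilt_def)
  also have "(\<integral>x. tilt K (e * g i v x) \<omega> \<partial>dens d f) = tilt K (e * avg f i v) \<omega>"
    using int by (simp add: tilt_def avg_def prob_space)
  finally show ?thesis .
qed

text \<open>For a fixed history the coin \<open>zs 0\<close> is a constant, so the transcript
  density is a product in which every factor depends on one raw datum. Fubini for the two samples,
  and then for their coordinates, averages each factor on its own.\<close>

lemma out_law_coin:
  assumes fX: "is_density d fX" and fY: "is_density d fY"
  shows "out_law d (count_space (signs K)) n1 n2 (coin_kern K e g) (coin_kern K e g) fX fY =
    dmeas (hists K n1 n2) (coin_dens K e (avg fX) (avg fY) n1 n2)" (is "?L = dmeas ?H ?p")
    and "prob_on (hists K n1 n2) (coin_dens K e (avg fX) (avg fY) n1 n2)"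
proof -
  interpret X: prob_space "dens d fX" using fX by (rule prob_space_dens)
  interpret Y: prob_space "dens d fY" using fY by (rule prob_space_dens)
  interpret PX: product_prob_space "\<lambda>_::nat. dens d fX" "{..<n1}" ..
  interpret PY: product_prob_space "\<lambda>_::nat. dens d fY" "{..<n2}" ..
  interpret PX: finite_product_prob_space "\<lambda>_::nat. dens d fX" "{..<n1}" by standard simp
  interpret PY: finite_product_prob_space "\<lambda>_::nat. dens d fY" "{..<n2}" by standard simp
  let ?MX = "PiM {..<n1} (\<lambda>_. dens d fX)" and ?MY = "PiM {..<n2} (\<lambda>_. dens d fY)"
  interpret XY: pair_prob_space ?MX ?MY ..
  let ?M = "?MX \<Otimes>\<^sub>M ?MY"
  let ?t = "\<lambda>(xs, ys). transcript (count_space (signs K)) n1 (coin_kern K e g) (coin_kern K e g) xs ys n2"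
  let ?c = "\<lambda>w. coin_dens K e (\<lambda>i v. g i v (fst w i)) (\<lambda>i v. g i v (snd w i)) n1 n2"
  have mn: "min n2 n1 = n1" using n1 by simp
  have pc: "prob_on ?H (?c w)" and tc: "?t w = dmeas ?H (?c w)" for w
    using transcript_coin[of n2 "fst w" "snd w"]
    by (auto simp: mn case_prod_unfold)
  have cm [measurable]: "(\<lambda>w. ?c w h) \<in> borel_measurable ?M" for h
    unfolding coin_dens_def tilt_def case_prod_unfold
    by measurable
  have tm: "?t \<in> measurable ?M (subprob_algebra (count_space ?H))"
  proof (rule measurable_subprob_algebra)
    fix A assume "A \<in> sets (count_space ?H)"
    hence A: "A \<subseteq> ?H" by simp
    have "(\<lambda>w. ennreal (\<Sum>h\<in>A. ?c w h)) \<in> borel_measurable ?M" by measurable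
    thus "(\<lambda>w. emeasure (?t w) A) \<in> borel_measurable ?M"
      unfolding tc emeasure_dmeas[OF pc A] .
  qed (auto simp: tc pc prob_space_dmeas prob_space_imp_subprob_space)
  have nn: "0 \<le> tilt K (e * g i v x) \<omega>" if "\<omega> \<in> signs K" for i v x \<omega>
    using e_bound[OF g1, of i v x] K that by (intro tilt_nonneg) linarith+
  have nn': "0 \<le> tilt K (e * avg f i v) \<omega>" if "\<omega> \<in> signs K" "is_density d f" for i v x \<omega> f
    using e_bound[OF avg_bound[OF that(2)], of i v] K that by (intro tilt_nonneg) linarith+
  have c1: "(\<integral>\<^sup>+w. ennreal (?c w h) \<partial>?M) = ennreal (?p h)" if h: "h \<in> ?H" for h
  proof -
    obtain zs ws where h': "h = (zs, ws)" by force
    have zs: "zs i \<in> signs K" if "i < n1" for i using h h' that by (auto simp: hists_def PiE_iff)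
    have ws: "ws i \<in> signs K" if "i < n2" for i using h h' that by (auto simp: hists_def PiE_iff)
    let ?v = "zs 0"
    let ?P = "\<lambda>xs. \<Prod>i<n1. ennreal (tilt K (e * g i ?v (xs i)) (zs i))"
    let ?Q = "\<lambda>ys. \<Prod>i<n2. ennreal (tilt K (e * g i ?v (ys i)) (ws i))"
    have tmX [measurable]: "(\<lambda>xs. ennreal (tilt K (e * g i ?v (xs i)) (zs i))) \<in> borel_measurable ?MX" if "i < n1" for i
      using that unfolding tilt_def by simp
    have tmY [measurable]: "(\<lambda>xs. ennreal (tilt K (e * g i ?v (xs i)) (ws i))) \<in> borel_measurable ?MY" if "i < n2" for i
      using that unfolding tilt_def by simp
    have [measurable]: "?P \<in> borel_measurable ?MX" "?Q \<in> borel_measurable ?MY"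
      by (auto intro!: borel_measurable_prod_ennreal tmX tmY)
    have "(\<integral>\<^sup>+w. ennreal (?c w h) \<partial>?M) = (\<integral>\<^sup>+w. ?P (fst w) * ?Q (snd w) \<partial>?M)"
      unfolding h' coin_dens_def prod.case using zs ws
      by (intro nn_integral_cong) (subst (1 2) prod_ennreal, auto simp: nn intro!: ennreal_mult prod_nonneg)
    also have "\<dots> = (\<integral>\<^sup>+xs. (\<integral>\<^sup>+ys. ?P xs * ?Q ys \<partial>?MY) \<partial>?MX)"
      by (subst PY.nn_integral_fst[symmetric]) auto
    also have "\<dots> = (\<integral>\<^sup>+xs. ?P xs \<partial>?MX) * (\<integral>\<^sup>+ys. ?Q ys \<partial>?MY)"
      by (simp add: nn_integral_cmult nn_integral_multc)
    also have "(\<integral>\<^sup>+xs. ?P xs \<partial>?MX) = (\<Prod>i<n1. ennreal (tilt K (e * avg fX i ?v) (zs i)))"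
      by (subst PX.product_nn_integral_prod)
         (auto simp: nn_integral_tilt fX zs tilt_def intro!: prod.cong nn_integral_tilt[unfolded tilt_def])
    also have "(\<integral>\<^sup>+ys. ?Q ys \<partial>?MY) = (\<Prod>i<n2. ennreal (tilt K (e * avg fY i ?v) (ws i)))"
      by (subst PY.product_nn_integral_prod)
         (auto simp: nn_integral_tilt fY ws tilt_def intro!: prod.cong nn_integral_tilt[unfolded tilt_def])
    also have "(\<Prod>i<n1. ennreal (tilt K (e * avg fX i ?v) (zs i))) * \<dots> = ennreal (?p h)"
      unfolding h' coin_dens_def prod.case using zs ws
      by (subst (1 2) prod_ennreal) (auto simp: nn' fX fY intro!: ennreal_mult[symmetric] prod_nonneg)
    finally show ?thesis .
  qed
  have pn: "0 \<le> ?p h" if "h \<in> ?H" for h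
    using that unfolding coin_dens_def case_prod_unfold
    by (intro mult_nonneg_nonneg prod_nonneg ballI nn' fX fY) (auto simp: hists_def PiE_iff)
  have ne: "space ?M \<noteq> {}" by (rule XY.not_empty)
  have em: "emeasure ?L A = ennreal (sum ?p A)" if A: "A \<subseteq> ?H" for A
  proof -
    have "emeasure ?L A = (\<integral>\<^sup>+w. emeasure (?t w) A \<partial>?M)"
      unfolding out_law_def by (rule emeasure_bind[OF ne tm]) (use A in auto)
    also have "\<dots> = (\<integral>\<^sup>+w. (\<Sum>h\<in>A. ennreal (?c w h)) \<partial>?M)"
      unfolding tc emeasure_dmeas[OF pc A] using pc A
      by (intro nn_integral_cong sum_ennreal[symmetric]) (auto simp: prob_on_def)
    also have "\<dots> = (\<Sum>h\<in>A. ennreal (?p h))"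
      using A by (subst nn_integral_sum) (auto intro!: sum.cong c1)
    also have "\<dots> = ennreal (sum ?p A)"
      using A by (intro sum_ennreal pn) auto
    finally show ?thesis .
  qed
  \<comment> \<open>The total mass is read off before the data are integrated out, where every
    transcript law is already known to be a probability law.\<close>
  have "emeasure ?L ?H = (\<integral>\<^sup>+w. emeasure (?t w) ?H \<partial>?M)"
    unfolding out_law_def by (rule emeasure_bind[OF ne tm]) auto
  also have "\<dots> = 1"
    unfolding tc emeasure_dmeas[OF pc subset_refl] using pc XY.emeasure_space_1 by (simp add: prob_on_def)
  finally have "ennreal (sum ?p ?H) = 1" by (simp add: em)
  thus po: "prob_on ?H ?p"
    using pn by (simp add: prob_on_def)
  have sL: "sets ?L = Pow ?H"
    unfolding out_law_def by (subst sets_bind[of _ _ "count_space ?H"]) (use ne in \<open>auto simp: tc\<close>)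
  show "?L = dmeas ?H ?p"
    by (rule measure_eqI) (auto simp: sL em emeasure_dmeas[OF po])
qed

text \<open>Point masses of the tilt lie between \<open>1 - \<epsilon> / 3\<close> and
  \<open>1 + \<epsilon> / 3\<close> times the uniform mass. The ratio of these bounds is at most
  \<open>1 + \<epsilon> \<le> exp \<epsilon>\<close> because \<open>\<epsilon> \<le> 1\<close>; this
  is the origin of the third.\<close>

lemma LDP_coin:
  assumes "e = \<epsilon> / 3" "0 < \<epsilon>" "\<epsilon> \<le> 1"
  shows "LDP_mech d (count_space (signs K)) n1 n2 \<epsilon> (coin_kern K e g) (coin_kern K e g)"
proof -
  note pu = prob_on_user
  have meas: "(\<lambda>(x, h). coin_kern K e g i x (fst h) (snd h)) \<in>
     measurable (lebd d \<Otimes>\<^sub>M histM (count_space (signs K)) a b) (prob_algebra (count_space (signs K)))" for i a b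
  proof -
    have "(\<lambda>(x, h). coin_kern K e g i x (fst h) (snd h)) \<in>
       measurable (lebd d \<Otimes>\<^sub>M count_space (hists K a b)) (subprob_algebra (count_space (signs K)))"
    proof (rule measurable_subprob_algebra)
      fix A assume "A \<in> sets (count_space (signs K))"
      hence A: "A \<subseteq> signs K" by simp
      \<comment> \<open>Histories form a countable space, so joint measurability follows from
        measurability in the datum for each fixed history; the swap only puts the countable factor
        first.\<close>
      have "(\<lambda>(h, x). ennreal (sum (tilt K (e * g i (fst h 0) x)) A)) \<in>
          borel_measurable (count_space (hists K a b) \<Otimes>\<^sub>M lebd d)"
        by (rule measurable_pair_measure_countable1) (auto simp: tilt_def intro: countable_finite)
      from measurable_compose[OF measurable_pair_swap' this]
      show "(\<lambda>w. emeasure (case w of (x, h) \<Rightarrow> coin_kern K e g i x (fst h) (snd h)) A)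
          \<in> borel_measurable (lebd d \<Otimes>\<^sub>M count_space (hists K a b))"
        by (simp add: coin_kern_def case_prod_unfold emeasure_dmeas[OF pu A])
    qed (auto simp: coin_kern_def pu prob_space_dmeas prob_space_imp_subprob_space)
    thus ?thesis unfolding histM_signs
      by (intro measurable_prob_algebraI) (auto simp: coin_kern_def pu prob_space_dmeas)
  qed
  have ratio: "1 + a \<le> exp \<epsilon> * (1 + b)" if "\<bar>a\<bar> \<le> e" "\<bar>b\<bar> \<le> e" for a b
  proof -
    have "1 + a \<le> 1 + \<epsilon> / 3" using that assms by auto
    also have "\<dots> \<le> (1 + \<epsilon>) * (1 - \<epsilon> / 3)"
      using assms mult_left_mono[of \<epsilon> 1 \<epsilon>] by (simp add: field_simps)
    also have "\<dots> \<le> exp \<epsilon> * (1 + b)"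
      using that assms exp_ge_add_one_self[of \<epsilon>] by (intro mult_mono) auto
    finally show ?thesis .
  qed
  have ldp: "measure (coin_kern K e g i x zs ws) A \<le> exp \<epsilon> * measure (coin_kern K e g i x' zs ws) A"
    if "A \<subseteq> signs K" for i x x' zs ws A
  proof -
    have "tilt K (e * g i (zs 0) x) \<omega> \<le> exp \<epsilon> * tilt K (e * g i (zs 0) x') \<omega>" if "\<omega> \<in> signs K" for \<omega>
    proof -
      have "\<bar>e * g i (zs 0) x * \<omega> 0\<bar> \<le> e" for x
        using signs_cases[OF that K] e g1[of i "zs 0" x] mult_left_mono[OF g1[of i "zs 0" x] e(1)]
        by (auto simp: abs_mult)
      from ratio[OF this this] show ?thesis
        by (simp add: tilt_def divide_simps)
    qed
    thus ?thesis unfolding coin_kern_def measure_dmeas[OF pu that] sum_distrib_left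
      using that by (intro sum_mono) auto
  qed
  show ?thesis unfolding LDP_mech_def
    using meas ldp by (auto simp: coin_kern_def pu prob_space_dmeas)
qed

end

section \<open>Conditional laws given the coin\<close>

definition pmf_on :: "'a set \<Rightarrow> ('a \<Rightarrow> real) \<Rightarrow> 'a pmf" where
  "pmf_on S p = embed_pmf (\<lambda>x. if x \<in> S then p x else 0)"

lemma pmf_pmf_on:
  assumes "prob_on S p"
  shows "pmf (pmf_on S p) x = (if x \<in> S then p x else 0)"
  unfolding pmf_on_def
proof (rule pmf_embed_pmf)
  have "(\<integral>\<^sup>+x. ennreal (if x \<in> S then p x else 0) \<partial>count_space UNIV) =
      (\<Sum>x\<in>S. ennreal (if x \<in> S then p x else 0))"
    using assms by (intro nn_integral_count_space') (auto simp: prob_on_def)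
  also have "\<dots> = ennreal (sum p S)"
    using assms by (simp add: prob_on_def sum_ennreal)
  finally show "(\<integral>\<^sup>+x. ennreal (if x \<in> S then p x else 0) \<partial>count_space UNIV) = 1"
    using assms by (simp add: prob_on_def)
qed (use assms in \<open>auto simp: prob_on_def\<close>)

lemma set_pmf_on: "prob_on S p \<Longrightarrow> set_pmf (pmf_on S p) \<subseteq> S"
  by (auto simp: set_pmf_iff pmf_pmf_on split: if_splits)

lemma expectation_pmf_on:
  assumes "prob_on S p"
  shows "measure_pmf.expectation (pmf_on S p) f = (\<Sum>x\<in>S. p x * f x)"
  using assms set_pmf_on[OF assms]
  by (subst integral_measure_pmf[of S]) (auto simp: prob_on_def pmf_pmf_on[OF assms])

text \<open>Zipping two functions is injective, so the masses can be compared point by point. This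
  is what turns two independent samples into one sequence of independent pairs.\<close>

lemma map_pmf_pair_Pi:
  assumes A: "finite A"
  shows "map_pmf (\<lambda>(f, g) x. (f x, g x)) (pair_pmf (Pi_pmf A a p) (Pi_pmf A b q)) =
    Pi_pmf A (a, b) (\<lambda>x. pair_pmf (p x) (q x))"
proof (rule pmf_eqI)
  fix z :: "'a \<Rightarrow> 'b \<times> 'c"
  let ?\<pi> = "\<lambda>(f::'a \<Rightarrow> 'b, g::'a \<Rightarrow> 'c) x. (f x, g x)"
  have inj: "inj ?\<pi>" by (auto simp: inj_def fun_eq_iff)
  have z: "z = ?\<pi> (\<lambda>x. fst (z x), \<lambda>x. snd (z x))" by (simp add: fun_eq_iff)
  have "pmf (map_pmf ?\<pi> (pair_pmf (Pi_pmf A a p) (Pi_pmf A b q))) z =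
      pmf (Pi_pmf A a p) (\<lambda>x. fst (z x)) * pmf (Pi_pmf A b q) (\<lambda>x. snd (z x))"
    by (subst z, subst pmf_map_inj'[OF inj]) (simp add: pmf_pair)
  also have "\<dots> = pmf (Pi_pmf A (a, b) (\<lambda>x. pair_pmf (p x) (q x))) z"
  proof (cases "\<forall>x. x \<notin> A \<longrightarrow> z x = (a, b)")
    case True
    moreover have "pmf (pair_pmf (p x) (q x)) (z x) = pmf (p x) (fst (z x)) * pmf (q x) (snd (z x))" for x
      by (metis pmf_pair prod.collapse)
    ultimately show ?thesis using A by (simp add: pmf_Pi prod.distrib)
  next
    case False
    then obtain x where "x \<notin> A" "fst (z x) \<noteq> a \<or> snd (z x) \<noteq> b" by (metis prod.collapse)
    thus ?thesis using A False by (auto simp: pmf_Pi)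
  qed
  finally show "pmf (map_pmf ?\<pi> (pair_pmf (Pi_pmf A a p) (Pi_pmf A b q))) z =
      pmf (Pi_pmf A (a, b) (\<lambda>x. pair_pmf (p x) (q x))) z" .
qed

text \<open>Only coordinate \<open>0\<close> depends on the data, and halving keeps the difference
  of two signs in \<open>[-1, 1]\<close>.\<close>

definition half_diff :: "out \<times> out \<Rightarrow> real" where
  "half_diff zw = (fst zw 0 - snd zw 0) / 2"

context coin_mech
begin

abbreviation tp :: "((nat \<Rightarrow> real) \<Rightarrow> real) \<Rightarrow> out \<Rightarrow> nat \<Rightarrow> out pmf" where
  "tp f v i \<equiv> pmf_on (signs K) (tilt K (e * avg f i v))"

text \<open>The output law if the string \<open>v\<close> were announced by an outsider: all outputs
  are independent, and that of user \<open>0\<close> is a fresh uniform vector unrelated to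
  \<open>v\<close>. This avoids conditioning on an actual output.\<close>

definition cond_law :: "((nat \<Rightarrow> real) \<Rightarrow> real) \<Rightarrow> ((nat \<Rightarrow> real) \<Rightarrow> real) \<Rightarrow> out \<Rightarrow> hist pmf" where
  "cond_law fX fY v = pair_pmf (Pi_pmf {..<n1} undefined (tp fX v)) (Pi_pmf {..<n2} undefined (tp fY v))"

definition pair_law :: "((nat \<Rightarrow> real) \<Rightarrow> real) \<Rightarrow> ((nat \<Rightarrow> real) \<Rightarrow> real) \<Rightarrow> out \<Rightarrow> (nat \<Rightarrow> out \<times> out) pmf" where
  "pair_law fX fY v = Pi_pmf {..<n1} (undefined, undefined) (\<lambda>i. pair_pmf (tp fX v i) (tp fY v i))"

lemma prob_on_avg: "is_density d f \<Longrightarrow> prob_on (signs K) (tilt K (e * avg f i v))"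
  using e_bound[OF avg_bound, of f i v] K by (intro prob_on_tilt) simp_all

lemma avg_0: "avg f 0 v = 0"
  by (simp add: avg_def g0)

lemma pmf_cond_law:
  assumes fX: "is_density d fX" and fY: "is_density d fY" and h: "(zs, ws) \<in> hists K n1 n2"
  shows "pmf (cond_law fX fY v) (zs, ws) =
    (\<Prod>i<n1. tilt K (e * avg fX i v) (zs i)) * (\<Prod>i<n2. tilt K (e * avg fY i v) (ws i))"
proof -
  have "zs i \<in> signs K" if "i < n1" for i using h that by (auto simp: hists_def PiE_iff)
  moreover have "ws i \<in> signs K" if "i < n2" for i using h that by (auto simp: hists_def PiE_iff)
  moreover have "zs i = undefined" if "\<not> i < n1" for i
    using h that by (auto simp: hists_def PiE_iff extensional_def)
  moreover have "ws i = undefined" if "\<not> i < n2" for i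
    using h that by (auto simp: hists_def PiE_iff extensional_def)
  ultimately show ?thesis
    unfolding cond_law_def pmf_pair
    by (subst (1 2) pmf_Pi') (auto simp: pmf_pmf_on prob_on_avg fX fY)
qed

lemma set_cond_law:
  assumes fX: "is_density d fX" and fY: "is_density d fY"
  shows "set_pmf (cond_law fX fY v) \<subseteq> hists K n1 n2"
proof -
  have "set_pmf (Pi_pmf {..<n1} undefined (tp fX v)) \<subseteq> PiE {..<n1} (\<lambda>_. signs K)"
    "set_pmf (Pi_pmf {..<n2} undefined (tp fY v)) \<subseteq> PiE {..<n2} (\<lambda>_. signs K)"
    using set_pmf_on[OF prob_on_avg[OF fX]] set_pmf_on[OF prob_on_avg[OF fY]]
    by (subst set_Pi_pmf; fastforce simp: PiE_dflt_def PiE_iff extensional_def)+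
  thus ?thesis by (auto simp: cond_law_def hists_def)
qed

lemma prob_cond_law:
  assumes fX: "is_density d fX" and fY: "is_density d fY"
  shows "measure_pmf.prob (cond_law fX fY v) {h. \<phi> h} = (\<Sum>h | h \<in> hists K n1 n2 \<and> \<phi> h. pmf (cond_law fX fY v) h)"
proof -
  have "measure_pmf.prob (cond_law fX fY v) {h. \<phi> h} =
      measure_pmf.prob (cond_law fX fY v) {h. h \<in> hists K n1 n2 \<and> \<phi> h}"
    using set_cond_law[OF fX fY] by (intro measure_pmf.finite_measure_eq_AE) (auto simp: AE_measure_pmf_iff)
  also have "\<dots> = (\<Sum>h | h \<in> hists K n1 n2 \<and> \<phi> h. pmf (cond_law fX fY v) h)"
    by (intro measure_measure_pmf_finite) simp
  finally show ?thesis .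
qed

lemma hists_upd0:
  assumes "h \<in> hists K n1 n2" "w \<in> signs K"
  shows "((fst h)(0 := w), snd h) \<in> hists K n1 n2"
proof -
  have "(fst h)(0 := w) \<in> PiE (insert 0 {..<n1}) (\<lambda>_. signs K)"
    using assms by (intro PiE_fun_upd) (auto simp: hists_def)
  also have "insert 0 {..<n1} = {..<n1}" using n1 by (intro insert_absorb) simp
  finally show ?thesis
    unfolding hists_def mem_Times_iff fst_conv snd_conv
    using assms(1)[unfolded hists_def mem_Times_iff] by blast
qed

text \<open>In the true law \<open>zs 0\<close> is the coin, whereas \<open>cond_law\<close> at
  \<open>v\<close> leaves \<open>zs 0\<close> uniform. For an event that ignores \<open>zs 0\<close>
  the two agree after averaging over \<open>v\<close>, because each value of \<open>zs 0\<close>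
  carries the same share \<open>1 / 2 ^ K\<close> of the event.\<close>

lemma out_law_prob:
  assumes fX: "is_density d fX" and fY: "is_density d fY"
    and \<phi>: "\<And>zs ws z. \<phi> (zs(0 := z), ws) = \<phi> (zs, ws)"
  defines "M \<equiv> out_law d (count_space (signs K)) n1 n2 (coin_kern K e g) (coin_kern K e g) fX fY"
  shows "measure M {t \<in> space M. \<phi> t} =
    (\<Sum>v\<in>signs K. measure_pmf.prob (cond_law fX fY v) {h. \<phi> h}) / 2 ^ K"
proof -
  let ?H = "hists K n1 n2" and ?p = "coin_dens K e (avg fX) (avg fY) n1 n2"
  let ?c = "\<lambda>v. pmf (cond_law fX fY v)"
  let ?B = "\<lambda>v. {h. h \<in> ?H \<and> \<phi> h \<and> fst h 0 = v}"
  have H0: "fst h 0 \<in> signs K" if "h \<in> ?H" for h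
    using that n1 by (auto simp: hists_def PiE_iff)
  \<comment> \<open>The mean answer of user \<open>0\<close> is zero, so its factor in the product
    is the same for all outputs, and moving \<open>zs 0\<close> from \<open>z\<close> to
    \<open>v\<close> preserves both the mass and the event.\<close>
  have shift: "sum (?c v) (?B z) = sum (?c v) (?B v)" if "v \<in> signs K" "z \<in> signs K" for v z
  proof (rule sum.reindex_bij_witness[where i = "\<lambda>h. ((fst h)(0 := z), snd h)" and j = "\<lambda>h. ((fst h)(0 := v), snd h)"])
    fix h assume h: "h \<in> ?B z"
    show "((fst ((fst h)(0 := v), snd h))(0 := z), snd ((fst h)(0 := v), snd h)) = h"
      using h by (auto simp: prod_eq_iff)
    show "((fst h)(0 := v), snd h) \<in> ?B v" using h hists_upd0[of h v] that \<phi>[of "fst h" v "snd h"] by auto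
    obtain zs ws where hh: "h = (zs, ws)" by force
    have n1e: "{..<n1} = insert 0 {1..<n1}" using n1 by auto
    show "?c v ((fst h)(0 := v), snd h) = ?c v h"
      using h hists_upd0[of h v] that unfolding hh fst_conv snd_conv
      by (subst (1 2) pmf_cond_law[OF fX fY]) (auto simp: n1e avg_0 tilt_def)
  next
    fix h assume h: "h \<in> ?B v"
    show "((fst h)(0 := z), snd h) \<in> ?B z"
      using that h \<phi>[of "fst h" z "snd h"] hists_upd0[of h z] by auto
    show "((fst ((fst h)(0 := z), snd h))(0 := v), snd ((fst h)(0 := z), snd h)) = h"
      using h by (auto simp: prod_eq_iff)
  qed
  have split: "sum F {h. h \<in> ?H \<and> \<phi> h} = (\<Sum>z\<in>signs K. sum F (?B z))" for F :: "hist \<Rightarrow> real"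
  proof -
    have "(\<Sum>z\<in>signs K. sum F {h \<in> {h. h \<in> ?H \<and> \<phi> h}. fst h 0 = z}) = sum F {h. h \<in> ?H \<and> \<phi> h}"
      by (rule sum.group) (auto intro: H0)
    thus ?thesis by (simp add: conj_assoc)
  qed
  have one: "sum (?c v) (?B v) = measure_pmf.prob (cond_law fX fY v) {h. \<phi> h} / 2 ^ K" if "v \<in> signs K" for v
  proof -
    have "measure_pmf.prob (cond_law fX fY v) {h. \<phi> h} = (\<Sum>z\<in>signs K. sum (?c v) (?B z))"
      unfolding prob_cond_law[OF fX fY] by (rule split)
    also have "\<dots> = (\<Sum>z\<in>signs K. sum (?c v) (?B v))"
      by (intro sum.cong refl shift that)
    finally show ?thesis by (simp add: card_signs)
  qed
  have "measure M {t \<in> space M. \<phi> t} = sum ?p {h. h \<in> ?H \<and> \<phi> h}"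
    unfolding M_def out_law_coin(1)[OF fX fY] space_dmeas
    by (rule measure_dmeas[OF out_law_coin(2)[OF fX fY]]) auto
  also have "\<dots> = (\<Sum>v\<in>signs K. sum ?p (?B v))" by (rule split)
  also have "\<dots> = (\<Sum>v\<in>signs K. sum (?c v) (?B v))"
  proof (intro sum.cong refl)
    fix v h assume "h \<in> ?B v"
    thus "?p h = ?c v h"
      by (cases h) (auto simp: coin_dens_def pmf_cond_law[OF fX fY])
  qed
  also have "\<dots> = (\<Sum>v\<in>signs K. measure_pmf.prob (cond_law fX fY v) {h. \<phi> h} / 2 ^ K)"
    by (intro sum.cong refl one)
  finally show ?thesis by (simp add: sum_divide_distrib)
qed

text \<open>Users of the second sample from \<open>n1\<close> on have no partner; projecting them
  away leaves the product law of the pairs.\<close>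

lemma map_cond_law:
  "map_pmf (\<lambda>(zs, ws) i. (zs i, if i \<in> {..<n1} then ws i else undefined)) (cond_law fX fY v) = pair_law fX fY v"
proof -
  have "pair_law fX fY v = map_pmf (\<lambda>(f, g) x. (f x, g x))
      (pair_pmf (Pi_pmf {..<n1} undefined (tp fX v)) (Pi_pmf {..<n1} undefined (tp fY v)))"
    unfolding pair_law_def by (rule map_pmf_pair_Pi[symmetric]) simp
  also have "Pi_pmf {..<n1} undefined (tp fY v) =
      map_pmf (\<lambda>f x. if x \<in> {..<n1} then f x else undefined) (Pi_pmf {..<n2} undefined (tp fY v))"
    using n1 by (intro Pi_pmf_subset) auto
  finally show ?thesis
    unfolding cond_law_def
    by (simp add: pair_map_pmf2 map_pmf_comp case_prod_unfold)
qed

text \<open>The test may look only at the pairs \<open>1..<n1\<close>: pair \<open>0\<close>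
  contains the coin, and later users are unpaired. Its probability is then a plain average over
  coins of probabilities under product laws.\<close>

lemma test_prob:
  assumes fX: "is_density d fX" and fY: "is_density d fY"
    and \<psi>: "\<And>x y. (\<And>i. i \<in> {1..<n1} \<Longrightarrow> x i = y i) \<Longrightarrow> \<psi> x = \<psi> y"
  defines "M \<equiv> out_law d (count_space (signs K)) n1 n2 (coin_kern K e g) (coin_kern K e g) fX fY"
  shows "measure M {t \<in> space M. \<psi> (\<lambda>i. half_diff (fst t i, snd t i))} =
    (\<Sum>v\<in>signs K. measure_pmf.prob (pair_law fX fY v) {\<zeta>. \<psi> (\<lambda>i. half_diff (\<zeta> i))}) / 2 ^ K"
proof -
  have "measure M {t \<in> space M. \<psi> (\<lambda>i. half_diff (fst t i, snd t i))} =
    (\<Sum>v\<in>signs K. measure_pmf.prob (cond_law fX fY v) {t. \<psi> (\<lambda>i. half_diff (fst t i, snd t i))}) / 2 ^ K"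
    unfolding M_def by (rule out_law_prob[OF fX fY], rule \<psi>) auto
  also have "(\<Sum>v\<in>signs K. measure_pmf.prob (cond_law fX fY v) {t. \<psi> (\<lambda>i. half_diff (fst t i, snd t i))}) =
      (\<Sum>v\<in>signs K. measure_pmf.prob (pair_law fX fY v) {\<zeta>. \<psi> (\<lambda>i. half_diff (\<zeta> i))})"
  proof (intro sum.cong refl)
    fix v
    let ?\<pi> = "\<lambda>(zs::nat \<Rightarrow> out, ws::nat \<Rightarrow> out) i. (zs i, if i \<in> {..<n1} then ws i else undefined)"
    have "{t. \<psi> (\<lambda>i. half_diff (fst t i, snd t i))} = ?\<pi> -` {\<zeta>. \<psi> (\<lambda>i. half_diff (\<zeta> i))}"
    proof (intro set_eqI)
      fix t :: hist
      have "\<psi> (\<lambda>i. half_diff (fst t i, snd t i)) = \<psi> (\<lambda>i. half_diff (?\<pi> t i))"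
        by (rule \<psi>) (auto simp: case_prod_unfold)
      thus "t \<in> {t. \<psi> (\<lambda>i. half_diff (fst t i, snd t i))} \<longleftrightarrow> t \<in> ?\<pi> -` {\<zeta>. \<psi> (\<lambda>i. half_diff (\<zeta> i))}" by simp
    qed
    thus "measure_pmf.prob (cond_law fX fY v) {t. \<psi> (\<lambda>i. half_diff (fst t i, snd t i))} =
        measure_pmf.prob (pair_law fX fY v) {\<zeta>. \<psi> (\<lambda>i. half_diff (\<zeta> i))}"
      unfolding map_cond_law[symmetric] measure_map_pmf by simp
  qed
  finally show ?thesis .
qed

text \<open>These four facts are the interface to the voting argument, which never sees the
  mechanism. Privacy shows only in the mean, shrunk by \<open>e / 2\<close>, that is
  \<open>\<epsilon> / 6\<close>, while the noise stays of order one.\<close>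

lemma pair_law_facts:
  assumes fX: "is_density d fX" and fY: "is_density d fY"
  shows finite_pair_law: "finite (set_pmf (pair_law fX fY v))"
    and indep_pair_law: "prob_space.indep_vars (measure_pmf (pair_law fX fY v)) (\<lambda>_. borel) (\<lambda>i \<zeta>. half_diff (\<zeta> i)) {..<n1}"
    and bound_pair_law: "i < n1 \<Longrightarrow> \<zeta> \<in> set_pmf (pair_law fX fY v) \<Longrightarrow> \<bar>half_diff (\<zeta> i)\<bar> \<le> 1"
    and mean_pair_law: "i < n1 \<Longrightarrow> measure_pmf.expectation (pair_law fX fY v) (\<lambda>\<zeta>. half_diff (\<zeta> i)) =
          e / 2 * (avg fX i v - avg fY i v)"
proof -
  note pX = prob_on_avg[OF fX] and pY = prob_on_avg[OF fY]
  have set: "set_pmf (pair_law fX fY v) \<subseteq> PiE_dflt {..<n1} (undefined, undefined) (\<lambda>_. signs K \<times> signs K)"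
  proof
    fix \<zeta> assume "\<zeta> \<in> set_pmf (pair_law fX fY v)"
    hence "\<forall>i. (i \<in> {..<n1} \<longrightarrow> \<zeta> i \<in> set_pmf (tp fX v i) \<times> set_pmf (tp fY v i)) \<and>
        (i \<notin> {..<n1} \<longrightarrow> \<zeta> i = (undefined, undefined))"
      unfolding pair_law_def set_Pi_pmf[OF finite_lessThan] PiE_dflt_def by simp
    thus "\<zeta> \<in> PiE_dflt {..<n1} (undefined, undefined) (\<lambda>_. signs K \<times> signs K)"
      unfolding PiE_dflt_def mem_Times_iff mem_Collect_eq
      using subsetD[OF set_pmf_on[OF pX]] subsetD[OF set_pmf_on[OF pY]] by meson
  qed
  show "finite (set_pmf (pair_law fX fY v))"
    by (rule finite_subset[OF set]) auto
  show "prob_space.indep_vars (measure_pmf (pair_law fX fY v)) (\<lambda>_. borel) (\<lambda>i \<zeta>. half_diff (\<zeta> i)) {..<n1}"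
    unfolding pair_law_def
    by (rule prob_space.indep_vars_compose2[OF prob_space_measure_pmf indep_vars_Pi_pmf]) auto
  {
    assume i: "i < n1" and "\<zeta> \<in> set_pmf (pair_law fX fY v)"
    hence "\<zeta> i \<in> signs K \<times> signs K" using set by (auto simp: PiE_dflt_def)
    then obtain a b where "\<zeta> i = (a, b)" "a \<in> signs K" "b \<in> signs K" by auto
    thus "\<bar>half_diff (\<zeta> i)\<bar> \<le> 1"
      using signs_cases[OF _ K, of a] signs_cases[OF _ K, of b] by (auto simp: half_diff_def)
  }
  {
    assume i: "i < n1"
    have fX': "finite (set_pmf (tp fX v i))" by (rule finite_subset[OF set_pmf_on[OF pX] finite_signs])
    have fY': "finite (set_pmf (tp fY v i))" by (rule finite_subset[OF set_pmf_on[OF pY] finite_signs])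
    let ?Q = "pair_pmf (tp fX v i) (tp fY v i)"
    have fQ: "finite (set_pmf ?Q)" using fX' fY' by simp
    note [simp] = integrable_measure_pmf_finite[OF fQ]
    have "measure_pmf.expectation (pair_law fX fY v) (\<lambda>\<zeta>. half_diff (\<zeta> i)) =
      measure_pmf.expectation (map_pmf (\<lambda>\<zeta>. \<zeta> i) (pair_law fX fY v)) half_diff" by simp
    also have "map_pmf (\<lambda>\<zeta>. \<zeta> i) (pair_law fX fY v) = ?Q"
      unfolding pair_law_def using i by (subst Pi_pmf_component) auto
    also have "measure_pmf.expectation ?Q half_diff =
      (measure_pmf.expectation ?Q (\<lambda>x. fst x 0) - measure_pmf.expectation ?Q (\<lambda>x. snd x 0)) / 2"
      unfolding half_diff_def by simp
    also have "measure_pmf.expectation ?Q (\<lambda>x. fst x 0) = measure_pmf.expectation (map_pmf fst ?Q) (\<lambda>x. x 0)"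
      by (simp del: map_fst_pair_pmf)
    also have "\<dots> = e * avg fX i v"
      by (simp add: map_fst_pair_pmf expectation_pmf_on[OF pX] sum_tilt_0[OF K])
    also have "measure_pmf.expectation ?Q (\<lambda>x. snd x 0) = measure_pmf.expectation (map_pmf snd ?Q) (\<lambda>x. x 0)"
      by (simp del: map_snd_pair_pmf)
    also have "\<dots> = e * avg fY i v"
      by (simp add: map_snd_pair_pmf expectation_pmf_on[OF pY] sum_tilt_0[OF K])
    finally show "measure_pmf.expectation (pair_law fX fY v) (\<lambda>\<zeta>. half_diff (\<zeta> i)) =
        e / 2 * (avg fX i v - avg fY i v)" by (simp add: algebra_simps)
  }
qed

end

section \<open>Voting with pair statistics\<close>

lemmas pmf_indep_vars_compose2 = prob_space.indep_vars_compose2[OF prob_space_measure_pmf]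
  and pmf_indep_vars_cong = prob_space.indep_vars_cong[OF prob_space_measure_pmf]
  and pmf_indep_vars_lebesgue_integral = prob_space.indep_vars_lebesgue_integral[OF prob_space_measure_pmf]
  and pmf_indep_vars_subset = prob_space.indep_vars_subset[OF prob_space_measure_pmf]
  and pmf_indep_vars_restrict = prob_space.indep_vars_restrict[OF prob_space_measure_pmf]

text \<open>Functions of disjoint blocks of independent variables are independent. Here
  \<open>F l\<close> reads a total assignment and \<open>dep\<close> says that only the block
  \<open>W l\<close> matters, so that statistics can be written without restrictions.\<close>

lemma indep_vars_block:
  fixes P :: "'a pmf" and D :: "'i \<Rightarrow> 'a \<Rightarrow> real"
  assumes ind: "prob_space.indep_vars (measure_pmf P) (\<lambda>_. borel) D I"
    and sub: "\<And>l. l \<in> L \<Longrightarrow> W l \<subseteq> I" and dis: "disjoint_family_on W L"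
    and F: "\<And>l. l \<in> L \<Longrightarrow> F l \<in> borel_measurable (PiM (W l) (\<lambda>_. borel))"
    and dep: "\<And>l x. l \<in> L \<Longrightarrow> F l (restrict x (W l)) = F l x"
  shows "prob_space.indep_vars (measure_pmf P) (\<lambda>_. borel) (\<lambda>l \<omega>. F l (\<lambda>i. D i \<omega>) :: real) L"
proof -
  have "prob_space.indep_vars (measure_pmf P) (\<lambda>_. borel)
      (\<lambda>l \<omega>. F l (restrict (\<lambda>i. D i \<omega>) (W l))) L"
    by (intro pmf_indep_vars_compose2[OF pmf_indep_vars_restrict[OF ind sub dis]] F)
  thus ?thesis
    by (rule pmf_indep_vars_cong[THEN iffD1, rotated -1]) (auto simp: dep fun_eq_iff)
qed

lemma expectation_sum_sq:
  fixes P :: "'a pmf" and X :: "'i \<Rightarrow> 'a \<Rightarrow> real"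
  assumes fin: "finite (set_pmf P)" and I: "finite I"
    and ind: "prob_space.indep_vars (measure_pmf P) (\<lambda>_. borel) X I"
  shows "measure_pmf.expectation P (\<lambda>\<omega>. (\<Sum>i\<in>I. X i \<omega>)\<^sup>2) =
    (\<Sum>i\<in>I. measure_pmf.expectation P (X i))\<^sup>2 +
    (\<Sum>i\<in>I. measure_pmf.expectation P (\<lambda>\<omega>. (X i \<omega>)\<^sup>2) - (measure_pmf.expectation P (X i))\<^sup>2)"
proof -
  note [simp] = integrable_measure_pmf_finite[OF fin]
  let ?E = "measure_pmf.expectation P"
  have prod: "?E (\<lambda>\<omega>. X i \<omega> * X j \<omega>) = ?E (X i) * ?E (X j) +
      (if i = j then ?E (\<lambda>\<omega>. (X i \<omega>)\<^sup>2) - (?E (X i))\<^sup>2 else 0)" if "i \<in> I" "j \<in> I" for i j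
  proof (cases "i = j")
    case False
    have "prob_space.indep_vars (measure_pmf P) (\<lambda>_. borel) X {i, j}"
      using that by (intro pmf_indep_vars_subset[OF ind]) auto
    from pmf_indep_vars_lebesgue_integral[OF _ this] False
    show ?thesis by simp
  qed (simp add: power2_eq_square)
  have "?E (\<lambda>\<omega>. (\<Sum>i\<in>I. X i \<omega>)\<^sup>2) = (\<Sum>i\<in>I. \<Sum>j\<in>I. ?E (\<lambda>\<omega>. X i \<omega> * X j \<omega>))"
    by (simp add: power2_eq_square sum_product)
  also have "\<dots> = (\<Sum>i\<in>I. \<Sum>j\<in>I. ?E (X i) * ?E (X j) +
      (if i = j then ?E (\<lambda>\<omega>. (X i \<omega>)\<^sup>2) - (?E (X i))\<^sup>2 else 0))"
    by (intro sum.cong refl prod)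
  also have "\<dots> = (\<Sum>i\<in>I. ?E (X i))\<^sup>2 + (\<Sum>i\<in>I. ?E (\<lambda>\<omega>. (X i \<omega>)\<^sup>2) - (?E (X i))\<^sup>2)"
    using I by (simp add: sum.distrib power2_eq_square sum_product)
  finally show ?thesis .
qed

text \<open>Splitting each cell into two halves makes the product of the two sums an unbiased estimate of
  the squared mean, with no diagonal to subtract.\<close>

definition pair_stat :: "'l set \<Rightarrow> ('l \<Rightarrow> bool \<Rightarrow> 'i set) \<Rightarrow> ('i \<Rightarrow> real) \<Rightarrow> real" where
  "pair_stat L U x = (\<Sum>l\<in>L. (\<Sum>i\<in>U l True. x i) * (\<Sum>i\<in>U l False. x i))"

lemma pair_stat_measurable:
  assumes "\<And>l h. l \<in> L \<Longrightarrow> U l h \<subseteq> W"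
  shows "pair_stat L U \<in> borel_measurable (PiM W (\<lambda>_. borel))"
  unfolding pair_stat_def
  by (intro borel_measurable_sum borel_measurable_times measurable_component_singleton) (use assms in blast)+

lemma pair_stat_restrict:
  assumes "\<And>l h. l \<in> L \<Longrightarrow> U l h \<subseteq> W"
  shows "pair_stat L U (restrict x W) = pair_stat L U x"
  unfolding pair_stat_def
  by (intro sum.cong refl arg_cong2[where f = "(*)"]) (use assms in \<open>auto simp: subset_iff\<close>)

text \<open>The two half sums of a cell are independent, with mean \<open>m * \<mu> l\<close> and
  second moment at most \<open>m + (m * \<mu> l)^2\<close>. The second moment of their product is at
  most the square of this bound; subtracting \<open>(m * \<mu> l)^4\<close> leaves
  \<open>m^2 + 2 * m^3 * (\<mu> l)^2\<close>, and variances of cells add up.\<close>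

lemma pair_stat_moments:
  fixes P :: "'a pmf" and D :: "'i \<Rightarrow> 'a \<Rightarrow> real"
  assumes fin: "finite (set_pmf P)"
    and ind: "prob_space.indep_vars (measure_pmf P) (\<lambda>_. borel) D I"
    and bd: "\<And>i \<omega>. i \<in> I \<Longrightarrow> \<omega> \<in> set_pmf P \<Longrightarrow> \<bar>D i \<omega>\<bar> \<le> 1"
    and L: "finite L" and I: "finite I" and sub: "\<And>l h. l \<in> L \<Longrightarrow> U l h \<subseteq> I"
    and dis: "disjoint_family_on (\<lambda>(l, h). U l h) (L \<times> UNIV)"
    and card: "\<And>l h. l \<in> L \<Longrightarrow> card (U l h) = m"
    and mean: "\<And>l h i. l \<in> L \<Longrightarrow> i \<in> U l h \<Longrightarrow> measure_pmf.expectation P (D i) = \<mu> l"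
  shows "measure_pmf.expectation P (\<lambda>\<omega>. pair_stat L U (\<lambda>i. D i \<omega>)) = (real m)\<^sup>2 * (\<Sum>l\<in>L. (\<mu> l)\<^sup>2)"
    and "measure_pmf.variance P (\<lambda>\<omega>. pair_stat L U (\<lambda>i. D i \<omega>)) \<le>
      (real m)\<^sup>2 * real (card L) + 2 * real m ^ 3 * (\<Sum>l\<in>L. (\<mu> l)\<^sup>2)"
proof -
  note [simp] = integrable_measure_pmf_finite[OF fin]
  let ?E = "measure_pmf.expectation P"
  define S where "S = (\<lambda>c \<omega>. \<Sum>i\<in>(case c of (l, h) \<Rightarrow> U l h). D i \<omega>)"
  have indS: "prob_space.indep_vars (measure_pmf P) (\<lambda>_. borel) S (L \<times> UNIV)"
    unfolding S_def
  proof (rule indep_vars_block[where F = "\<lambda>c x. \<Sum>i\<in>(case c of (l, h) \<Rightarrow> U l h). x i", OF ind _ dis])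
    fix c :: "'b \<times> bool" assume "c \<in> L \<times> UNIV"
    show "(\<lambda>x. \<Sum>i\<in>(case c of (l, h) \<Rightarrow> U l h). x i)
        \<in> borel_measurable (PiM (case c of (l, h) \<Rightarrow> U l h) (\<lambda>_. borel :: real measure))"
      by (intro borel_measurable_sum measurable_component_singleton)
  qed (use sub in auto)
  have ES: "?E (S (l, h)) = real m * \<mu> l" if "l \<in> L" for l h
    using that mean card by (simp add: S_def)
  have ES2: "?E (\<lambda>\<omega>. (S (l, h) \<omega>)\<^sup>2) \<le> real m + (real m * \<mu> l)\<^sup>2" if l: "l \<in> L" for l h
  proof -
    have f: "finite (U l h)" using sub[OF l] I finite_subset by blast
    have "?E (\<lambda>\<omega>. (S (l, h) \<omega>)\<^sup>2) = (\<Sum>i\<in>U l h. ?E (D i))\<^sup>2 +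
      (\<Sum>i\<in>U l h. ?E (\<lambda>\<omega>. (D i \<omega>)\<^sup>2) - (?E (D i))\<^sup>2)"
      unfolding S_def prod.case
      by (rule expectation_sum_sq[OF fin f]) (rule pmf_indep_vars_subset[OF ind sub[OF l]])
    also have "(\<Sum>i\<in>U l h. ?E (D i)) = real m * \<mu> l" using l mean card by simp
    also have "(\<Sum>i\<in>U l h. ?E (\<lambda>\<omega>. (D i \<omega>)\<^sup>2) - (?E (D i))\<^sup>2) \<le> (\<Sum>i\<in>U l h. 1)"
    proof (rule sum_mono)
      fix i assume i: "i \<in> U l h"
      have "?E (\<lambda>\<omega>. (D i \<omega>)\<^sup>2) \<le> 1"
        using bd[of i] sub[OF l] i
        by (intro measure_pmf.integral_le_const) (auto simp: AE_measure_pmf_iff abs_square_le_1)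
      thus "?E (\<lambda>\<omega>. (D i \<omega>)\<^sup>2) - (?E (D i))\<^sup>2 \<le> 1" by (smt (verit) zero_le_power2)
    qed
    finally show ?thesis using card[OF l] by simp
  qed
  define Q where "Q = (\<lambda>l \<omega>. S (l, True) \<omega> * S (l, False) \<omega>)"
  have indQ: "prob_space.indep_vars (measure_pmf P) (\<lambda>_. borel) Q L"
    unfolding Q_def
  proof (rule indep_vars_block[where F = "\<lambda>l x. x (l, True) * x (l, False)" and W = "\<lambda>l. {l} \<times> UNIV", OF indS])
    fix l assume "l \<in> L"
    show "(\<lambda>x. x (l, True) * x (l, False)) \<in> borel_measurable (PiM ({l} \<times> (UNIV :: bool set)) (\<lambda>_. borel :: real measure))"
      by (intro borel_measurable_times measurable_component_singleton) auto
  qed (auto simp: disjoint_family_on_def)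
  have pair: "?E (\<lambda>\<omega>. f (S (l, True) \<omega>) * f (S (l, False) \<omega>)) =
      ?E (\<lambda>\<omega>. f (S (l, True) \<omega>)) * ?E (\<lambda>\<omega>. f (S (l, False) \<omega>))"
    if "l \<in> L" "f \<in> borel_measurable borel" for l and f :: "real \<Rightarrow> real"
  proof -
    have "prob_space.indep_vars (measure_pmf P) (\<lambda>_. borel) (\<lambda>c \<omega>. f (S c \<omega>)) {(l, True), (l, False)}"
      using that by (intro pmf_indep_vars_compose2[OF pmf_indep_vars_subset[OF indS]]) auto
    from pmf_indep_vars_lebesgue_integral[OF _ this] show ?thesis by simp
  qed
  have EQ: "?E (Q l) = (real m * \<mu> l)\<^sup>2" if "l \<in> L" for l
    using pair[OF that, of "\<lambda>x. x"] by (simp add: Q_def ES that power2_eq_square)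
  have EQ2: "?E (\<lambda>\<omega>. (Q l \<omega>)\<^sup>2) \<le> (real m + (real m * \<mu> l)\<^sup>2)\<^sup>2" if l: "l \<in> L" for l
  proof -
    have "?E (\<lambda>\<omega>. (Q l \<omega>)\<^sup>2) = ?E (\<lambda>\<omega>. (S (l, True) \<omega>)\<^sup>2) * ?E (\<lambda>\<omega>. (S (l, False) \<omega>)\<^sup>2)"
      using pair[OF that, of "\<lambda>x. x\<^sup>2"] by (simp add: Q_def power_mult_distrib)
    also have "\<dots> \<le> (real m + (real m * \<mu> l)\<^sup>2) * (real m + (real m * \<mu> l)\<^sup>2)"
      by (intro mult_mono ES2 l) auto
    finally show ?thesis by (simp add: power2_eq_square)
  qed
  have T: "pair_stat L U (\<lambda>i. D i \<omega>) = (\<Sum>l\<in>L. Q l \<omega>)" for \<omega>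
    by (simp add: pair_stat_def Q_def S_def)
  show 1: "?E (\<lambda>\<omega>. pair_stat L U (\<lambda>i. D i \<omega>)) = (real m)\<^sup>2 * (\<Sum>l\<in>L. (\<mu> l)\<^sup>2)"
    unfolding T by (simp add: EQ power_mult_distrib sum_distrib_left)
  have "measure_pmf.variance P (\<lambda>\<omega>. pair_stat L U (\<lambda>i. D i \<omega>)) =
      ?E (\<lambda>\<omega>. (\<Sum>l\<in>L. Q l \<omega>)\<^sup>2) - (?E (\<lambda>\<omega>. \<Sum>l\<in>L. Q l \<omega>))\<^sup>2"
    unfolding T by (rule measure_pmf.variance_eq) auto
  also have "\<dots> = (\<Sum>l\<in>L. ?E (\<lambda>\<omega>. (Q l \<omega>)\<^sup>2) - (?E (Q l))\<^sup>2)"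
    by (simp add: expectation_sum_sq[OF fin L indQ])
  also have "\<dots> \<le> (\<Sum>l\<in>L. (real m)\<^sup>2 + 2 * real m ^ 3 * (\<mu> l)\<^sup>2)"
  proof (rule sum_mono)
    fix l assume l: "l \<in> L"
    show "?E (\<lambda>\<omega>. (Q l \<omega>)\<^sup>2) - (?E (Q l))\<^sup>2 \<le> (real m)\<^sup>2 + 2 * real m ^ 3 * (\<mu> l)\<^sup>2"
      using EQ2[OF l] by (simp add: EQ[OF l] power2_sum power_mult_distrib power2_eq_square power3_eq_cube algebra_simps)
  qed
  also have "\<dots> = (real m)\<^sup>2 * real (card L) + 2 * real m ^ 3 * (\<Sum>l\<in>L. (\<mu> l)\<^sup>2)"
    by (simp add: sum.distrib sum_distrib_left)
  finally show "measure_pmf.variance P (\<lambda>\<omega>. pair_stat L U (\<lambda>i. D i \<omega>)) \<le>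
      (real m)\<^sup>2 * real (card L) + 2 * real m ^ 3 * (\<Sum>l\<in>L. (\<mu> l)\<^sup>2)" .
qed

text \<open>Sixteen times the bound \<open>m * sqrt k\<close> on the standard deviation under the
  null with \<open>k\<close> cells, so that Chebyshev's inequality allows a false vote with
  probability at most \<open>1/256\<close>.\<close>

definition pair_thr :: "nat \<Rightarrow> nat \<Rightarrow> real" where
  "pair_thr m k = 16 * real m * sqrt (real k)"

definition votes :: "nat \<Rightarrow> nat \<Rightarrow> 'l set \<Rightarrow> (nat \<Rightarrow> 'l \<Rightarrow> bool \<Rightarrow> 'i set) \<Rightarrow> ('i \<Rightarrow> real) \<Rightarrow> nat" where
  "votes mv m L U x = card {v. v < mv \<and> pair_thr m (card L) < pair_stat L (U v) x}"

text \<open>Groups \<open>v\<close>, cells \<open>l\<close> and halves \<open>h\<close> index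
  disjoint sets of \<open>m\<close> users each. The means are left free, so that one setup serves
  the null and the alternative.\<close>

locale vote_setup =
  fixes P :: "'a pmf" and D :: "'i \<Rightarrow> 'a \<Rightarrow> real" and I :: "'i set" and L :: "'l set"
    and U :: "nat \<Rightarrow> 'l \<Rightarrow> bool \<Rightarrow> 'i set" and m mv :: nat
  assumes fin: "finite (set_pmf P)"
    and ind: "prob_space.indep_vars (measure_pmf P) (\<lambda>_. borel) D I"
    and bd: "\<And>i \<omega>. i \<in> I \<Longrightarrow> \<omega> \<in> set_pmf P \<Longrightarrow> \<bar>D i \<omega>\<bar> \<le> 1"
    and L: "finite L" "L \<noteq> {}" and I: "finite I"
    and sub: "\<And>v l h. v < mv \<Longrightarrow> l \<in> L \<Longrightarrow> U v l h \<subseteq> I"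
    and dis: "disjoint_family_on (\<lambda>(v, l, h). U v l h) ({..<mv} \<times> L \<times> UNIV)"
    and card: "\<And>v l h. v < mv \<Longrightarrow> l \<in> L \<Longrightarrow> card (U v l h) = m"
begin

lemma disD:
  assumes "v < mv" "v' < mv" "l \<in> L" "l' \<in> L" "(v, l, h) \<noteq> (v', l', h')"
  shows "U v l h \<inter> U v' l' h' = {}"
  using disjoint_family_onD[OF dis, of "(v, l, h)" "(v', l', h')"] assms by simp

lemma dis_group: "v < mv \<Longrightarrow> disjoint_family_on (\<lambda>(l, h). U v l h) (L \<times> UNIV)"
  unfolding disjoint_family_on_def
proof (intro ballI impI)
  fix c c' :: "'l \<times> bool" assume "v < mv" "c \<in> L \<times> UNIV" "c' \<in> L \<times> UNIV" "c \<noteq> c'"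
  thus "(case c of (l, h) \<Rightarrow> U v l h) \<inter> (case c' of (l, h) \<Rightarrow> U v l h) = {}"
    using disD[of v v "fst c" "fst c'" "snd c" "snd c'"] by (simp add: case_prod_unfold prod_eq_iff mem_Times_iff)
qed

definition ballot :: "nat \<Rightarrow> 'a \<Rightarrow> real" where
  "ballot v \<omega> = of_bool (pair_thr m (card L) < pair_stat L (U v) (\<lambda>i. D i \<omega>))"

lemma votes_eq: "real (votes mv m L U (\<lambda>i. D i \<omega>)) = (\<Sum>v<mv. ballot v \<omega>)"
proof -
  have "(\<Sum>v<mv. ballot v \<omega>) = real (card ({..<mv} \<inter> {v. pair_thr m (card L) < pair_stat L (U v) (\<lambda>i. D i \<omega>)}))"
    unfolding ballot_def by (simp add: sum_of_bool_eq)
  also have "{..<mv} \<inter> {v. pair_thr m (card L) < pair_stat L (U v) (\<lambda>i. D i \<omega>)} =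
      {v. v < mv \<and> pair_thr m (card L) < pair_stat L (U v) (\<lambda>i. D i \<omega>)}" by auto
  finally show ?thesis by (simp add: votes_def)
qed

lemma indep_ballot: "prob_space.indep_vars (measure_pmf P) (\<lambda>_. borel) ballot {..<mv}"
  unfolding ballot_def
proof (rule indep_vars_block[where W = "\<lambda>v. \<Union>l\<in>L. \<Union>h. U v l h"
      and F = "\<lambda>v x. of_bool (pair_thr m (card L) < pair_stat L (U v) x)", OF ind])
  fix v assume "v \<in> {..<mv}"
  have [measurable]: "pair_stat L (U v) \<in> borel_measurable (PiM (\<Union>l\<in>L. \<Union>h. U v l h) (\<lambda>_. borel))"
    by (intro pair_stat_measurable) auto
  show "(\<lambda>x. of_bool (pair_thr m (card L) < pair_stat L (U v) x) :: real)
      \<in> borel_measurable (PiM (\<Union>l\<in>L. \<Union>h. U v l h) (\<lambda>_. borel))"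
    by measurable
next
  show "disjoint_family_on (\<lambda>v. \<Union>l\<in>L. \<Union>h. U v l h) {..<mv}"
    unfolding disjoint_family_on_def
  proof (intro ballI impI)
    fix v v' assume "v \<in> {..<mv}" "v' \<in> {..<mv}" "v \<noteq> v'"
    hence "U v l h \<inter> U v' l' h' = {}" if "l \<in> L" "l' \<in> L" for l l' h h'
      using that by (intro disD) auto
    thus "(\<Union>l\<in>L. \<Union>h. U v l h) \<inter> (\<Union>l\<in>L. \<Union>h. U v' l h) = {}" by blast
  qed
next
  fix v x
  have "pair_stat L (U v) (restrict x (\<Union>l\<in>L. \<Union>h. U v l h)) = pair_stat L (U v) x"
    by (intro pair_stat_restrict) auto
  thus "of_bool (pair_thr m (card L) < pair_stat L (U v) (restrict x (\<Union>l\<in>L. \<Union>h. U v l h))) =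
      (of_bool (pair_thr m (card L) < pair_stat L (U v) x) :: real)" by simp
qed (use sub in auto)

lemma expectation_ballot:
  "measure_pmf.expectation P (ballot v) =
     measure_pmf.prob P {\<omega>. pair_thr m (card L) < pair_stat L (U v) (\<lambda>i. D i \<omega>)}"
proof -
  have "ballot v = indicator {\<omega>. pair_thr m (card L) < pair_stat L (U v) (\<lambda>i. D i \<omega>)}"
    by (auto simp: ballot_def fun_eq_iff indicator_def)
  thus ?thesis by simp
qed

text \<open>At most \<open>mv / 256\<close> false votes are expected, while the decision level is
  \<open>4 * mv / 256\<close>. Hoeffding's inequality with the gap \<open>3 * mv / 256\<close> gives
  the exponent \<open>18 * mv / 65536\<close>, which is at least \<open>mv / 4096\<close>.\<close>

lemma votes_null:
  assumes "0 < mv" and mean: "\<And>v l h i. v < mv \<Longrightarrow> l \<in> L \<Longrightarrow> i \<in> U v l h \<Longrightarrow> measure_pmf.expectation P (D i) = 0"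
  shows "measure_pmf.prob P {\<omega>. real mv / 64 \<le> real (votes mv m L U (\<lambda>i. D i \<omega>))} \<le> exp (- real mv / 4096)"
proof -
  have e: "measure_pmf.expectation P (ballot v) \<le> 1/256" if v: "v < mv" for v
  proof (cases "m = 0")
    case True
    \<comment> \<open>With empty cells, statistic and threshold are both zero, and the strict
      comparison casts no vote.\<close>
    hence "U v l h = {}" if "l \<in> L" for l h
      using card[OF v that, of h] sub[OF v that, of h] I finite_subset by fastforce
    thus ?thesis unfolding expectation_ballot by (simp add: pair_stat_def pair_thr_def True)
  next
    case False
    let ?T = "\<lambda>\<omega>. pair_stat L (U v) (\<lambda>i. D i \<omega>)"
    have "measure_pmf.expectation P ?T = (real m)\<^sup>2 * (\<Sum>l\<in>L. 0\<^sup>2)"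
      by (rule pair_stat_moments(1)[OF fin ind bd L(1) I sub[OF v] dis_group[OF v] card[OF v] mean[OF v]])
    hence 1: "measure_pmf.expectation P ?T = 0" by simp
    have "measure_pmf.variance P ?T \<le> (real m)\<^sup>2 * real (card L) + 2 * real m ^ 3 * (\<Sum>l\<in>L. 0\<^sup>2)"
      by (rule pair_stat_moments(2)[OF fin ind bd L(1) I sub[OF v] dis_group[OF v] card[OF v] mean[OF v]])
    hence 2: "measure_pmf.variance P ?T \<le> (real m)\<^sup>2 * real (card L)" by simp
    have pos: "0 < pair_thr m (card L)"
      using False L by (simp add: pair_thr_def card_gt_0_iff)
    have "measure_pmf.prob P {\<omega>. pair_thr m (card L) < ?T \<omega>} \<le>
      measure_pmf.prob P {\<omega>\<in>space (measure_pmf P). pair_thr m (card L) \<le> \<bar>?T \<omega> - measure_pmf.expectation P ?T\<bar>}"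
      by (intro measure_pmf.finite_measure_mono) (auto simp: 1)
    also have "\<dots> \<le> measure_pmf.variance P ?T / (pair_thr m (card L))\<^sup>2"
      by (intro measure_pmf.Chebyshev_inequality pos integrable_measure_pmf_finite fin) auto
    also have "\<dots> \<le> (real m)\<^sup>2 * real (card L) / (pair_thr m (card L))\<^sup>2"
      by (intro divide_right_mono 2) auto
    also have "\<dots> = 1 / 256"
      using False L by (simp add: pair_thr_def power_mult_distrib card_gt_0_iff)
    finally show ?thesis by (simp add: expectation_ballot)
  qed
  interpret H: Hoeffding_ineq "measure_pmf P" "{..<mv}" ballot "\<lambda>_. 0" "\<lambda>_. 1"
      "\<Sum>v<mv. measure_pmf.expectation P (ballot v)"
    by unfold_locales (auto intro: indep_ballot simp: ballot_def)
  let ?\<mu> = "\<Sum>v<mv. measure_pmf.expectation P (ballot v)"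
  have mu: "?\<mu> \<le> real mv / 256"
    using sum_mono[of "{..<mv}" "\<lambda>v. measure_pmf.expectation P (ballot v)" "\<lambda>_. 1/256"] e by simp
  have "measure_pmf.prob P {\<omega>. real mv / 64 \<le> real (votes mv m L U (\<lambda>i. D i \<omega>))} \<le>
    measure_pmf.prob P {\<omega>\<in>space (measure_pmf P). ?\<mu> + 3 * real mv / 256 \<le> (\<Sum>v<mv. ballot v \<omega>)}"
    unfolding votes_eq using mu by (intro measure_pmf.finite_measure_mono) auto
  also have "\<dots> \<le> exp (-2 * (3 * real mv / 256)\<^sup>2 / (\<Sum>v<mv. (1 - 0)\<^sup>2))"
    by (rule H.Hoeffding_ineq_ge) (use assms in auto)
  also have "\<dots> \<le> exp (- real mv / 4096)"
    using assms(1) by (simp add: power2_eq_square field_simps)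
  finally show ?thesis .
qed

lemma votes_alt:
  assumes "0 < mv" and G: "G \<subseteq> {..<mv}" "real mv / 16 \<le> real (card G)" and m: "0 < m"
    and mean: "\<And>v l h i. v \<in> G \<Longrightarrow> l \<in> L \<Longrightarrow> i \<in> U v l h \<Longrightarrow> measure_pmf.expectation P (D i) = \<mu> v l"
    and big: "\<And>v. v \<in> G \<Longrightarrow> 256 * sqrt (real (card L)) \<le> real m * (\<Sum>l\<in>L. (\<mu> v l)\<^sup>2)"
  shows "measure_pmf.prob P {\<omega>. real (votes mv m L U (\<lambda>i. D i \<omega>)) < real mv / 64} \<le> exp (- real mv / 4096)"
proof -
  have e: "1/2 \<le> measure_pmf.expectation P (ballot v)" if vG: "v \<in> G" for v
  proof -
    have v: "v < mv" using vG G by auto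
    let ?T = "\<lambda>\<omega>. pair_stat L (U v) (\<lambda>i. D i \<omega>)"
    define A where "A = (\<Sum>l\<in>L. (\<mu> v l)\<^sup>2)"
    define k where "k = real (card L)"
    have k: "1 \<le> k" using L by (simp add: k_def card_gt_0_iff Suc_le_eq)
    have mA: "256 * sqrt k \<le> real m * A" using big[OF vG] by (simp add: A_def k_def)
    have mA1: "256 \<le> real m * A" using mA real_sqrt_ge_one[OF k] by linarith
    have mp: "0 < real m" using m by simp
    have 1: "measure_pmf.expectation P ?T = (real m)\<^sup>2 * A" unfolding A_def
      by (rule pair_stat_moments(1)[OF fin ind bd L(1) I sub[OF v] dis_group[OF v] card[OF v] mean[OF vG]])
    have 2: "measure_pmf.variance P ?T \<le> (real m)\<^sup>2 * k + 2 * real m ^ 3 * A" unfolding A_def k_def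
      by (rule pair_stat_moments(2)[OF fin ind bd L(1) I sub[OF v] dis_group[OF v] card[OF v] mean[OF vG]])
    \<comment> \<open>The signal assumption places the threshold at no more than one sixteenth of
      the mean \<open>m^2 * A\<close>, so a missed vote is a deviation by at least
      \<open>15/16\<close> of the mean.\<close>
    let ?a = "15/16 * ((real m)\<^sup>2 * A)"
    have thr: "pair_thr m (card L) \<le> (real m)\<^sup>2 * A / 16"
      using mult_left_mono[OF mA, of "real m"] by (simp add: pair_thr_def k_def power2_eq_square mult_ac)
    have "0 < real m * A" using mA1 by linarith
    hence pos: "0 < ?a"
      using mp by (simp add: zero_less_mult_iff)
    have "measure_pmf.prob P {\<omega>. \<not> pair_thr m (card L) < ?T \<omega>} \<le>
      measure_pmf.prob P {\<omega>\<in>space (measure_pmf P). ?a \<le> \<bar>?T \<omega> - measure_pmf.expectation P ?T\<bar>}"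
    proof (intro measure_pmf.finite_measure_mono subsetI)
      fix \<omega> assume "\<omega> \<in> {\<omega>. \<not> pair_thr m (card L) < ?T \<omega>}"
      hence "?T \<omega> \<le> pair_thr m (card L)" by simp
      hence "?a \<le> - (?T \<omega> - (real m)\<^sup>2 * A)" using thr by linarith
      also have "\<dots> \<le> \<bar>?T \<omega> - (real m)\<^sup>2 * A\<bar>" by (rule abs_ge_minus_self)
      finally show "\<omega> \<in> {\<omega>\<in>space (measure_pmf P). ?a \<le> \<bar>?T \<omega> - measure_pmf.expectation P ?T\<bar>}"
        by (simp add: 1)
    qed simp
    also have "\<dots> \<le> measure_pmf.variance P ?T / ?a\<^sup>2"
      by (intro measure_pmf.Chebyshev_inequality pos integrable_measure_pmf_finite fin) auto
    also have "\<dots> \<le> 1/2"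
    proof -
      \<comment> \<open>Both variance terms are measured against the squared mean: \<open>k\<close>
        is at most \<open>(m * A)^2 / 65536\<close>, and \<open>m * A \<ge> 256\<close> makes the
        linear term at most \<open>(m * A)^2 / 256\<close>.\<close>
      have "k = (sqrt k)\<^sup>2" using k by simp
      also have "\<dots> \<le> (real m * A / 256)\<^sup>2"
        using mA k by (intro power_mono) auto
      finally have k2: "k \<le> (real m * A)\<^sup>2 / 65536" by (simp add: power_divide)
      have mA2: "real m * A \<le> (real m * A)\<^sup>2 / 256"
        using mult_right_mono[OF mA1, of "real m * A"] mA1 by (simp add: power2_eq_square)
      have "(real m)\<^sup>2 * k + 2 * real m ^ 3 * A = (real m)\<^sup>2 * (k + 2 * (real m * A))"
        by (simp add: power2_eq_square power3_eq_cube algebra_simps)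
      also have "\<dots> \<le> (real m)\<^sup>2 * ((real m * A)\<^sup>2 / 65536 + 2 * ((real m * A)\<^sup>2 / 256))"
        by (intro mult_left_mono add_mono k2 mult_left_mono mA2) auto
      also have "\<dots> \<le> ?a\<^sup>2 / 2"
      proof -
        define Y where "Y = (real m)\<^sup>2 * (real m * A)\<^sup>2"
        have "0 \<le> Y" by (simp add: Y_def)
        moreover have "?a\<^sup>2 = 225/256 * Y"
          by (simp add: Y_def power_mult_distrib power2_eq_square)
        moreover have "(real m)\<^sup>2 * ((real m * A)\<^sup>2 / 65536 + 2 * ((real m * A)\<^sup>2 / 256)) = Y / 65536 + Y / 128"
          by (simp add: Y_def algebra_simps)
        ultimately show ?thesis by simp
      qed
      finally have "measure_pmf.variance P ?T \<le> ?a\<^sup>2 / 2" using 2 by linarith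
      thus ?thesis using pos by (simp add: divide_le_eq)
    qed
    finally have "measure_pmf.prob P (- {\<omega>. pair_thr m (card L) < ?T \<omega>}) \<le> 1/2"
      by (simp add: Compl_eq)
    thus ?thesis
      by (simp add: expectation_ballot measure_pmf.prob_compl[of "{\<omega>. pair_thr m (card L) < ?T \<omega>}", simplified] Compl_eq_Diff_UNIV)
  qed
  have fG: "finite G" using G finite_subset by blast
  interpret H: Hoeffding_ineq "measure_pmf P" G ballot "\<lambda>_. 0" "\<lambda>_. 1"
      "\<Sum>v\<in>G. measure_pmf.expectation P (ballot v)"
    by unfold_locales (auto intro: pmf_indep_vars_subset[OF indep_ballot G(1)] fG simp: ballot_def)
  let ?\<mu> = "\<Sum>v\<in>G. measure_pmf.expectation P (ballot v)"
  have mu: "real (card G) / 2 \<le> ?\<mu>"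
    using sum_mono[of G "\<lambda>_. 1/2" "\<lambda>v. measure_pmf.expectation P (ballot v)"] e by simp
  have le: "(\<Sum>v\<in>G. ballot v \<omega>) \<le> (\<Sum>v<mv. ballot v \<omega>)" for \<omega>
    using G by (intro sum_mono2) (auto simp: ballot_def)
  have cG: "0 < real (card G)" using G assms(1) by auto
  have "measure_pmf.prob P {\<omega>. real (votes mv m L U (\<lambda>i. D i \<omega>)) < real mv / 64} \<le>
    measure_pmf.prob P {\<omega>\<in>space (measure_pmf P). (\<Sum>v\<in>G. ballot v \<omega>) \<le> ?\<mu> - real (card G) / 4}"
  proof (intro measure_pmf.finite_measure_mono subsetI)
    fix \<omega> assume "\<omega> \<in> {\<omega>. real (votes mv m L U (\<lambda>i. D i \<omega>)) < real mv / 64}"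
    thus "\<omega> \<in> {\<omega>\<in>space (measure_pmf P). (\<Sum>v\<in>G. ballot v \<omega>) \<le> ?\<mu> - real (card G) / 4}"
      unfolding votes_eq using mu le[of \<omega>] G by auto
  qed auto
  also have "\<dots> \<le> exp (-2 * (real (card G) / 4)\<^sup>2 / (\<Sum>v\<in>G. (1 - 0)\<^sup>2))"
    by (rule H.Hoeffding_ineq_le) (use cG in auto)
  also have "\<dots> \<le> exp (- real mv / 4096)"
    using cG G by (simp add: power2_eq_square field_simps)
  finally show ?thesis .
qed

end

section \<open>Allocation of users and the general protocol\<close>

lemma exists_disjoint_blocks:
  assumes "finite C" "finite I" "sum m C \<le> card I"
  shows "\<exists>G. (\<forall>c\<in>C. G c \<subseteq> I \<and> card (G c) = m c) \<and> disjoint_family_on G C"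
  using assms
proof (induction C arbitrary: I rule: finite_induct)
  case empty
  thus ?case by (auto simp: disjoint_family_on_def)
next
  case (insert c C)
  have "m c \<le> card I" using insert by simp
  then obtain B where B: "B \<subseteq> I" "card B = m c" by (metis obtain_subset_with_card_n)
  have fB: "finite B" using B insert finite_subset by blast
  have "sum m C \<le> card (I - B)" using insert B fB by (simp add: card_Diff_subset)
  from insert.IH[OF _ this] insert.prems obtain G where
    G: "\<forall>c\<in>C. G c \<subseteq> I - B \<and> card (G c) = m c" "disjoint_family_on G C" by auto
  show ?case
  proof (intro exI[of _ "G(c := B)"] conjI ballI)
    show "(G(c := B)) c' \<subseteq> I" "card ((G(c := B)) c') = m c'" if "c' \<in> insert c C" for c'
      using that G B by (cases "c' = c"; fastforce)+
    show "disjoint_family_on (G(c := B)) (insert c C)"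
      unfolding disjoint_family_on_def
    proof (intro ballI impI)
      fix a b assume ab: "a \<in> insert c C" "b \<in> insert c C" "a \<noteq> b"
      show "(G(c := B)) a \<inter> (G(c := B)) b = {}"
      proof (cases "a = c \<or> b = c")
        case True
        thus ?thesis using ab G(1) by auto
      next
        case False
        thus ?thesis using ab disjoint_family_onD[OF G(2), of a b] by auto
      qed
    qed
  qed
qed

lemma votes_cong:
  assumes "\<And>v l h i. v < mv \<Longrightarrow> l \<in> L \<Longrightarrow> i \<in> U v l h \<Longrightarrow> x i = y i"
  shows "votes mv m L U x = votes mv m L U y"
proof -
  have "pair_stat L (U v) x = pair_stat L (U v) y" if "v < mv" for v
    unfolding pair_stat_def
    by (intro sum.cong refl arg_cong2[where f = "(*)"] assms[OF that]) auto
  thus ?thesis unfolding votes_def by (intro arg_cong[where f = card]) auto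
qed

text \<open>Everything the two tests share; they differ in the cells \<open>L\<close> and the
  queries \<open>h\<close>. A cell needs \<open>2 * m j\<close> users for its two halves, and
  \<open>n1 - 1\<close> are available because user \<open>0\<close> supplies the coin. The last
  conclusion separates two sources of failure: a fraction at most \<open>\<eta>\<close> of coins
  with which fewer than \<open>mv / 16\<close> groups see enough signal, and the error of the vote
  given a good coin.\<close>

lemma protocol:
  fixes L :: "nat \<Rightarrow> 'l set" and h :: "nat \<Rightarrow> nat \<Rightarrow> 'l \<Rightarrow> out \<Rightarrow> (nat \<Rightarrow> real) \<Rightarrow> real"
  assumes K: "0 < K" and eps: "0 < \<epsilon>" "\<epsilon> \<le> 1" and n1: "1 \<le> n1" "n1 \<le> n2" and mv: "0 < mv"
    and L: "\<And>j. j < J \<Longrightarrow> finite (L j)" "\<And>j. j < J \<Longrightarrow> L j \<noteq> {}"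
    and budget: "(\<Sum>j<J. mv * (card (L j) * (2 * m j))) \<le> n1 - 1"
    and h1: "\<And>j v l w x. \<bar>h j v l w x\<bar> \<le> 1"
    and hm: "\<And>j v l w. h j v l w \<in> borel_measurable (lebd d)"
  obtains Q \<phi> where
    "(\<And>j v l w w' x. h j v l w x = h j v l w' x) \<Longrightarrow> non_interactive Q Q"
    "LDP_mech d (count_space (signs K)) n1 n2 \<epsilon> Q Q"
    "test_ok (count_space (signs K)) n1 n2 \<phi>"
    "\<And>f. is_density d f \<Longrightarrow>
       reject_prob d (count_space (signs K)) n1 n2 Q Q \<phi> f f \<le> real J * exp (- real mv / 4096)"
    "\<And>fX fY j \<eta>. is_density d fX \<Longrightarrow> is_density d fY \<Longrightarrow> j < J \<Longrightarrow> 0 < m j \<Longrightarrow>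
       real (card {w \<in> signs K. real (card {v. v < mv \<and> 256 * sqrt (real (card (L j))) \<le>
          real (m j) * (\<Sum>l\<in>L j. (\<epsilon> / 6 * ((\<integral>x. h j v l w x \<partial>dens d fX) - (\<integral>x. h j v l w x \<partial>dens d fY)))\<^sup>2)})
          < real mv / 16}) \<le> \<eta> * 2 ^ K \<Longrightarrow>
       accept_prob d (count_space (signs K)) n1 n2 Q Q \<phi> fX fY \<le> \<eta> + exp (- real mv / 4096)"
proof -
  define C where "C = (SIGMA j:{..<J}. {..<mv} \<times> L j \<times> (UNIV :: bool set))"
  have finC: "finite C" unfolding C_def using L by (intro finite_SigmaI finite_cartesian_product) auto
  have "sum (\<lambda>c. m (fst c)) C = (\<Sum>j<J. \<Sum>c\<in>{..<mv} \<times> L j \<times> (UNIV :: bool set). m j)"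
    unfolding C_def using L by (subst sum.Sigma) (auto simp: case_prod_unfold)
  also have "\<dots> = (\<Sum>j<J. mv * (card (L j) * (2 * m j)))"
    by (intro sum.cong) (auto simp: card_cartesian_product)
  also have "\<dots> \<le> card {1..<n1}" using budget by simp
  finally obtain G where G: "\<And>c. c \<in> C \<Longrightarrow> G c \<subseteq> {1..<n1}" "\<And>c. c \<in> C \<Longrightarrow> card (G c) = m (fst c)"
      "disjoint_family_on G C"
    using exists_disjoint_blocks[OF finC, of "{1..<n1}" "\<lambda>c. m (fst c)"] by blast
  have Guniq: "c = c'" if "c \<in> C" "c' \<in> C" "i \<in> G c" "i \<in> G c'" for c c' i
    using disjoint_family_onD[OF G(3) that(1,2)] that by auto
  \<comment> \<open>A user outside all blocks, in particular user \<open>0\<close>, gets the zero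
    query. The choice is unambiguous because the blocks are disjoint.\<close>
  define g where "g = (\<lambda>i w x. if \<exists>c\<in>C. i \<in> G c then
     (case (SOME c. c \<in> C \<and> i \<in> G c) of (j, v, l, b) \<Rightarrow> h j v l w x) else 0)"
  have gG: "g i w x = h j v l w x" if "(j, v, l, b) \<in> C" "i \<in> G (j, v, l, b)" for i w x j v l b
  proof -
    have "(SOME c. c \<in> C \<and> i \<in> G c) = (j, v, l, b)"
      by (rule some_equality) (use that Guniq in blast)+
    thus ?thesis using that unfolding g_def by (auto simp: case_prod_unfold)
  qed
  define U where "U = (\<lambda>j v l b. G (j, v, l, b))"
  have CI: "(j, v, l, b) \<in> C" if "j < J" "v < mv" "l \<in> L j" for j v l b
    using that by (simp add: C_def)
  interpret coin_mech K "\<epsilon> / 3" g n1 n2 d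
  proof
    show "\<bar>g i v x\<bar> \<le> 1" for i v x
      using h1 by (auto simp: g_def case_prod_unfold)
    show "g 0 v x = 0" for v x
      using G(1) by (force simp: g_def)
    show "g i v \<in> borel_measurable (lebd d)" for i v
      using hm by (cases "\<exists>c\<in>C. i \<in> G c") (auto simp: g_def case_prod_unfold)
  qed (use K eps n1 in auto)
  \<comment> \<open>One convinced scale suffices to reject. The scale that carries the signal
    depends on \<open>s\<close>, which the test cannot know.\<close>
  define \<psi> where "\<psi> = (\<lambda>x. \<exists>j<J. real mv / 64 \<le> real (votes mv (m j) (L j) (U j) x))"
  define \<phi> where "\<phi> = (\<lambda>t::hist. \<psi> (\<lambda>i. half_diff (fst t i, snd t i)))"
  let ?Q = "coin_kern K (\<epsilon> / 3) g"
  have psi_cong: "\<psi> x = \<psi> y" if "\<And>i. i \<in> {1..<n1} \<Longrightarrow> x i = y i" for x y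
  proof -
    have "votes mv (m j) (L j) (U j) x = votes mv (m j) (L j) (U j) y" if j: "j < J" for j
    proof (rule votes_cong)
      fix v l b i assume "v < mv" "l \<in> L j" "i \<in> U j v l b"
      hence "i \<in> {1..<n1}" using G(1)[OF CI[OF j], of v l b] by (auto simp: U_def)
      thus "x i = y i" by (rule \<open>\<And>i. i \<in> {1..<n1} \<Longrightarrow> x i = y i\<close>)
    qed
    thus ?thesis unfolding \<psi>_def by metis
  qed
  have vs: "vote_setup (pair_law fX fY w) (\<lambda>i \<zeta>. half_diff (\<zeta> i)) {..<n1} (L j) (U j) (m j) mv"
    if f: "is_density d fX" "is_density d fY" and j: "j < J" for fX fY w j
  proof
    show "finite (set_pmf (pair_law fX fY w))" by (rule finite_pair_law[OF f])
    show "prob_space.indep_vars (measure_pmf (pair_law fX fY w)) (\<lambda>_. borel) (\<lambda>i \<zeta>. half_diff (\<zeta> i)) {..<n1}"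
      by (rule indep_pair_law[OF f])
    show "\<bar>half_diff (\<zeta> i)\<bar> \<le> 1" if "i \<in> {..<n1}" "\<zeta> \<in> set_pmf (pair_law fX fY w)" for i \<zeta>
      using bound_pair_law[OF f] that by simp
    show "finite (L j)" "L j \<noteq> {}" using L j by auto
    show "finite {..<n1}" by simp
    show "U j v l b \<subseteq> {..<n1}" if "v < mv" "l \<in> L j" for v l b
      using G(1)[OF CI[OF j that, of b]] by (force simp: U_def)
    show "card (U j v l b) = m j" if "v < mv" "l \<in> L j" for v l b
      using G(2)[OF CI[OF j that, of b]] by (simp add: U_def)
    show "disjoint_family_on (\<lambda>(v, l, b). U j v l b) ({..<mv} \<times> L j \<times> UNIV)"
      unfolding disjoint_family_on_def
    proof (intro ballI impI)
      fix c c' :: "nat \<times> 'l \<times> bool"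
      assume "c \<in> {..<mv} \<times> L j \<times> UNIV" "c' \<in> {..<mv} \<times> L j \<times> UNIV" "c \<noteq> c'"
      thus "(case c of (v, l, b) \<Rightarrow> U j v l b) \<inter> (case c' of (v, l, b) \<Rightarrow> U j v l b) = {}"
        using disjoint_family_onD[OF G(3), of "(j, c)" "(j, c')"] j
        by (simp add: U_def case_prod_unfold C_def)
    qed
  qed
  have mean: "measure_pmf.expectation (pair_law fX fY w) (\<lambda>\<zeta>. half_diff (\<zeta> i)) =
      \<epsilon> / 6 * ((\<integral>x. h j v l w x \<partial>dens d fX) - (\<integral>x. h j v l w x \<partial>dens d fY))"
    if f: "is_density d fX" "is_density d fY" and c: "j < J" "v < mv" "l \<in> L j" "i \<in> U j v l b" for fX fY w j v l b i
  proof -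
    have "i < n1" using G(1)[OF CI[OF c(1-3), of b]] c(4) by (force simp: U_def)
    moreover have "avg f i w = (\<integral>x. h j v l w x \<partial>dens d f)" for f
      using gG[OF CI[OF c(1-3), of b]] c(4) by (simp add: avg_def U_def)
    ultimately show ?thesis using mean_pair_law[OF f] by simp
  qed
  show ?thesis
  proof (rule that[of ?Q \<phi>])
    assume "\<And>j v l w w' x. h j v l w x = h j v l w' x"
    hence "g i w x = g i undefined x" for i w x
      unfolding g_def case_prod_unfold by metis
    hence "?Q i x zs ws = dmeas (signs K) (tilt K (\<epsilon> / 3 * g i undefined x))" for i x zs ws
      unfolding coin_kern_def by metis
    thus "non_interactive ?Q ?Q" unfolding non_interactive_def
      by (intro exI[of _ "\<lambda>i x. dmeas (signs K) (tilt K (\<epsilon> / 3 * g i undefined x))"]) auto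
  next
    show "LDP_mech d (count_space (signs K)) n1 n2 \<epsilon> ?Q ?Q"
      by (rule LDP_coin) (use eps in auto)
    show "test_ok (count_space (signs K)) n1 n2 \<phi>"
      by (simp add: test_ok_def histM_signs)
  next
    fix f assume f: "is_density d f"
    have "measure_pmf.prob (pair_law f f w) {\<zeta>. \<psi> (\<lambda>i. half_diff (\<zeta> i))} \<le> real J * exp (- real mv / 4096)" for w
    proof -
      let ?A = "\<lambda>j. {\<zeta>. real mv / 64 \<le> real (votes mv (m j) (L j) (U j) (\<lambda>i. half_diff (\<zeta> i)))}"
      have "{\<zeta>. \<psi> (\<lambda>i. half_diff (\<zeta> i))} = (\<Union>j\<in>{..<J}. ?A j)" by (auto simp: \<psi>_def)
      hence "measure_pmf.prob (pair_law f f w) {\<zeta>. \<psi> (\<lambda>i. half_diff (\<zeta> i))} \<le>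
        (\<Sum>j<J. measure_pmf.prob (pair_law f f w) (?A j))"
        by (simp only:) (intro measure_pmf.finite_measure_subadditive_finite, auto)
      also have "\<dots> \<le> (\<Sum>j<J. exp (- real mv / 4096))"
      proof (rule sum_mono)
        fix j assume "j \<in> {..<J}"
        hence j: "j < J" by simp
        show "measure_pmf.prob (pair_law f f w) (?A j) \<le> exp (- real mv / 4096)"
          by (rule vote_setup.votes_null[OF vs[OF f f j] mv]) (simp add: mean[OF f f j])
      qed
      finally show ?thesis by simp
    qed
    note le = this
    have "reject_prob d (count_space (signs K)) n1 n2 ?Q ?Q \<phi> f f =
      (\<Sum>w\<in>signs K. measure_pmf.prob (pair_law f f w) {\<zeta>. \<psi> (\<lambda>i. half_diff (\<zeta> i))}) / 2 ^ K"
      unfolding reject_prob_def \<phi>_def by (rule test_prob[OF f f psi_cong])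
    also have "\<dots> \<le> (\<Sum>w\<in>signs K. real J * exp (- real mv / 4096)) / 2 ^ K"
      by (intro divide_right_mono sum_mono le) simp
    also have "\<dots> = real J * exp (- real mv / 4096)" by (simp add: card_signs)
    finally show "reject_prob d (count_space (signs K)) n1 n2 ?Q ?Q \<phi> f f \<le> real J * exp (- real mv / 4096)" .
  next
    fix fX fY j \<eta>
    assume fX: "is_density d fX" and fY: "is_density d fY" and j: "j < J" and mj: "0 < m j"
    let ?\<mu> = "\<lambda>w v l. \<epsilon> / 6 * ((\<integral>x. h j v l w x \<partial>dens d fX) - (\<integral>x. h j v l w x \<partial>dens d fY))"
    let ?good = "\<lambda>w. {v. v < mv \<and> 256 * sqrt (real (card (L j))) \<le> real (m j) * (\<Sum>l\<in>L j. (?\<mu> w v l)\<^sup>2)}"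
    let ?bad = "{w \<in> signs K. real (card (?good w)) < real mv / 16}"
    assume bad: "real (card ?bad) \<le> \<eta> * 2 ^ K"
    let ?p = "\<lambda>w. measure_pmf.prob (pair_law fX fY w) {\<zeta>. \<not> \<psi> (\<lambda>i. half_diff (\<zeta> i))}"
    let ?x = "exp (- real mv / 4096)"
    \<comment> \<open>A bad coin is charged the full probability one, a good coin the error of the
      vote.\<close>
    have le: "?p w \<le> of_bool (w \<in> ?bad) + ?x" if w: "w \<in> signs K" for w
    proof (cases "w \<in> ?bad")
      case True
      have "?p w \<le> 1" by simp
      also have "\<dots> \<le> of_bool (w \<in> ?bad) + ?x" using True by simp
      finally show ?thesis .
    next
      case False
      have "?p w \<le> measure_pmf.prob (pair_law fX fY w)
          {\<zeta>. real (votes mv (m j) (L j) (U j) (\<lambda>i. half_diff (\<zeta> i))) < real mv / 64}"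
        using j by (intro measure_pmf.finite_measure_mono) (auto simp: \<psi>_def not_le)
      also have "\<dots> \<le> ?x"
      proof (rule vote_setup.votes_alt[OF vs[OF fX fY j] mv, where G = "?good w" and \<mu> = "?\<mu> w"])
        show "real mv / 16 \<le> real (card (?good w))" using False w by auto
        show "measure_pmf.expectation (pair_law fX fY w) (\<lambda>\<zeta>. half_diff (\<zeta> i)) = ?\<mu> w v l"
          if "v \<in> ?good w" "l \<in> L j" "i \<in> U j v l b" for v l b i
          using mean[OF fX fY j] that by simp
      qed (use mj in auto)
      finally show ?thesis by simp
    qed
    have "accept_prob d (count_space (signs K)) n1 n2 ?Q ?Q \<phi> fX fY = (\<Sum>w\<in>signs K. ?p w) / 2 ^ K"
      unfolding accept_prob_def \<phi>_def
      by (rule test_prob[OF fX fY, of "\<lambda>x. \<not> \<psi> x"]) (use psi_cong in blast)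
    also have "\<dots> \<le> (\<Sum>w\<in>signs K. of_bool (w \<in> ?bad) + ?x) / 2 ^ K"
      by (intro divide_right_mono sum_mono le) auto
    also have "\<dots> = real (card ?bad) / 2 ^ K + ?x"
    proof -
      have "(\<Sum>w\<in>signs K. of_bool (w \<in> ?bad)) = (\<Sum>w\<in>?bad. 1 :: real)"
        by (subst sum.mono_neutral_cong_right[of "signs K" ?bad _ "\<lambda>_. 1"]) auto
      thus ?thesis by (simp add: sum.distrib card_signs add_divide_distrib)
    qed
    also have "\<dots> \<le> \<eta> + ?x" using bad by (simp add: divide_le_eq)
    finally show "accept_prob d (count_space (signs K)) n1 n2 ?Q ?Q \<phi> fX fY \<le> \<eta> + ?x" .
  qed
qed

section \<open>The trigonometric system\<close>

lemma integrable_Icc: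
  fixes f :: "real \<Rightarrow> real"
  assumes "continuous_on {0..1} f"
  shows "integrable lborel (\<lambda>t. indicator {0..1} t * f t)"
  using borel_integrable_atLeastAtMost'[OF assms] by (simp add: set_integrable_def)

lemma integral_cos_Icc:
  "(\<integral>t. indicator {0..1} t * cos (2 * pi * of_int n * t) \<partial>lborel) = of_bool (n = 0)"
proof (cases "n = 0")
  case True
  thus ?thesis by simp
next
  case False
  have "(\<integral>t. indicator {0..1} t *\<^sub>R cos (2 * pi * of_int n * t) \<partial>lborel) =
     sin (2 * pi * of_int n * 1) / (2 * pi * of_int n) - sin (2 * pi * of_int n * 0) / (2 * pi * of_int n)"
    by (rule integral_FTC_atLeastAtMost)
       (use False in \<open>auto intro!: derivative_eq_intros continuous_intros
         simp: has_real_derivative_iff_has_vector_derivative[symmetric]\<close>)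
  also have "sin (2 * pi * of_int n * 1) = 0"
    by (simp only: mult_1_right sin_int_2pin)
  finally show ?thesis using False by simp
qed

lemma integral_sin_Icc:
  "(\<integral>t. indicator {0..1} t * sin (2 * pi * of_int n * t) \<partial>lborel) = 0"
proof (cases "n = 0")
  case False
  have "(\<integral>t. indicator {0..1} t *\<^sub>R sin (2 * pi * of_int n * t) \<partial>lborel) =
     - cos (2 * pi * of_int n * 1) / (2 * pi * of_int n) - (- cos (2 * pi * of_int n * 0) / (2 * pi * of_int n))"
    by (rule integral_FTC_atLeastAtMost)
       (use False in \<open>auto intro!: derivative_eq_intros continuous_intros
         simp: has_real_derivative_iff_has_vector_derivative[symmetric]\<close>)
  also have "cos (2 * pi * of_int n * 1) = 1"
    by (simp only: mult_1_right cos_int_2pin)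
  finally show ?thesis by simp
qed simp

text \<open>Product-to-sum formulas leave cosines and sines of frequency \<open>a - b\<close> and
  \<open>a + b\<close>. The sum is never zero and the difference only for \<open>a = b\<close>;
  since the difference may be negative, the basic integrals are stated for integer
  frequencies.\<close>

lemma trig1_ortho_aux:
  fixes a b :: nat
  assumes "0 < a" "0 < b"
  shows "(\<integral>t. indicator {0..1} t * ((sqrt 2 * sin (2 * pi * real a * t)) * (sqrt 2 * sin (2 * pi * real b * t))) \<partial>lborel) = of_bool (a = b)"
    "(\<integral>t. indicator {0..1} t * ((sqrt 2 * cos (2 * pi * real a * t)) * (sqrt 2 * cos (2 * pi * real b * t))) \<partial>lborel) = of_bool (a = b)"
    "(\<integral>t. indicator {0..1} t * ((sqrt 2 * sin (2 * pi * real a * t)) * (sqrt 2 * cos (2 * pi * real b * t))) \<partial>lborel) = 0"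
proof -
  let ?C = "\<lambda>n::int. \<lambda>t. indicator {0..1} t * cos (2 * pi * of_int n * t)"
  let ?S = "\<lambda>n::int. \<lambda>t. indicator {0..1} t * sin (2 * pi * of_int n * t)"
  have C [simp]: "integrable lborel (?C n)" and S [simp]: "integrable lborel (?S n)" for n
    by (intro integrable_Icc continuous_intros)+
  let ?p = "int a - int b" and ?q = "int a + int b"
  have r: "2 * pi * real a * t - 2 * pi * real b * t = 2 * pi * of_int ?p * t"
    "2 * pi * real a * t + 2 * pi * real b * t = 2 * pi * of_int ?q * t" for t
    by (simp_all add: algebra_simps)
  have s2: "(sqrt 2 * x) * (sqrt 2 * y) = 2 * (x * y)" for x y :: real
    by (simp add: algebra_simps)
  have "(\<integral>t. indicator {0..1} t * ((sqrt 2 * sin (2 * pi * real a * t)) * (sqrt 2 * sin (2 * pi * real b * t))) \<partial>lborel)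
      = (\<integral>t. ?C ?p t - ?C ?q t \<partial>lborel)"
    unfolding s2 sin_times_sin r
    by (intro Bochner_Integration.integral_cong refl) (simp add: right_diff_distrib distrib_left)
  also have "\<dots> = integral\<^sup>L lborel (?C ?p) - integral\<^sup>L lborel (?C ?q)"
    by (intro Bochner_Integration.integral_diff C)
  also have "\<dots> = of_bool (a = b)"
    unfolding integral_cos_Icc using assms by (auto simp del: of_int_diff of_int_add)
  finally show "(\<integral>t. indicator {0..1} t * ((sqrt 2 * sin (2 * pi * real a * t)) * (sqrt 2 * sin (2 * pi * real b * t))) \<partial>lborel) = of_bool (a = b)" .
  have "(\<integral>t. indicator {0..1} t * ((sqrt 2 * cos (2 * pi * real a * t)) * (sqrt 2 * cos (2 * pi * real b * t))) \<partial>lborel)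
      = (\<integral>t. ?C ?p t + ?C ?q t \<partial>lborel)"
    unfolding s2 cos_times_cos r
    by (intro Bochner_Integration.integral_cong refl) (simp add: right_diff_distrib distrib_left)
  also have "\<dots> = integral\<^sup>L lborel (?C ?p) + integral\<^sup>L lborel (?C ?q)"
    by (intro Bochner_Integration.integral_add C)
  also have "\<dots> = of_bool (a = b)"
    unfolding integral_cos_Icc using assms by (auto simp del: of_int_diff of_int_add)
  finally show "(\<integral>t. indicator {0..1} t * ((sqrt 2 * cos (2 * pi * real a * t)) * (sqrt 2 * cos (2 * pi * real b * t))) \<partial>lborel) = of_bool (a = b)" .
  have "(\<integral>t. indicator {0..1} t * ((sqrt 2 * sin (2 * pi * real a * t)) * (sqrt 2 * cos (2 * pi * real b * t))) \<partial>lborel)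
      = (\<integral>t. ?S ?q t + ?S ?p t \<partial>lborel)"
    unfolding s2 sin_times_cos r
    by (intro Bochner_Integration.integral_cong refl) (simp add: right_diff_distrib distrib_left)
  also have "\<dots> = integral\<^sup>L lborel (?S ?q) + integral\<^sup>L lborel (?S ?p)"
    by (intro Bochner_Integration.integral_add S)
  also have "\<dots> = 0"
    unfolding integral_sin_Icc by simp
  finally show "(\<integral>t. indicator {0..1} t * ((sqrt 2 * sin (2 * pi * real a * t)) * (sqrt 2 * cos (2 * pi * real b * t))) \<partial>lborel) = 0" .
qed

lemma trig1_0: "trig1 0 t = 1"
  by (simp add: trig1_def)

lemma trig1_odd: "odd l \<Longrightarrow> trig1 l t = sqrt 2 * sin (2 * pi * real ((l + 1) div 2) * t)"
  by (cases "l = 0") (auto simp: trig1_def)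

lemma trig1_even: "even l \<Longrightarrow> 0 < l \<Longrightarrow> trig1 l t = sqrt 2 * cos (2 * pi * real (l div 2) * t)"
  by (simp add: trig1_def)

lemma trig1_mean: "0 < l \<Longrightarrow> (\<integral>t. indicator {0..1} t * trig1 l t \<partial>lborel) = 0"
proof (cases "odd l")
  case True
  have "(\<integral>t. indicator {0..1} t * trig1 l t \<partial>lborel) =
      (\<integral>t. sqrt 2 * (indicator {0..1} t * sin (2 * pi * of_int (int ((l + 1) div 2)) * t)) \<partial>lborel)"
    unfolding trig1_odd[OF True] of_int_of_nat_eq by (simp add: mult_ac)
  thus ?thesis unfolding integral_mult_right_zero integral_sin_Icc by simp
next
  case False
  assume "0 < l"
  have "(\<integral>t. indicator {0..1} t * trig1 l t \<partial>lborel) =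
      (\<integral>t. sqrt 2 * (indicator {0..1} t * cos (2 * pi * of_int (int (l div 2)) * t)) \<partial>lborel)"
    using trig1_even[of l] False \<open>0 < l\<close> unfolding of_int_of_nat_eq by (simp add: mult_ac)
  also have "int (l div 2) \<noteq> 0" using False \<open>0 < l\<close> by (auto elim: evenE)
  hence "(\<integral>t. sqrt 2 * (indicator {0..1} t * cos (2 * pi * of_int (int (l div 2)) * t)) \<partial>lborel) = 0"
    unfolding integral_mult_right_zero integral_cos_Icc by simp
  finally show ?thesis .
qed

lemma trig1_ortho: "(\<integral>t. indicator {0..1} t * (trig1 l t * trig1 k t) \<partial>lborel) = of_bool (l = k)"
proof (cases "l = 0 \<or> k = 0")
  case True
  thus ?thesis
    using trig1_mean[of l] trig1_mean[of k] by (cases "l = 0"; cases "k = 0") (auto simp: trig1_0)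
next
  case False
  hence pos: "0 < l" "0 < k" by auto
  show ?thesis
  proof (cases "odd l"; cases "odd k")
    assume o: "odd l" "odd k"
    have "(l + 1) div 2 = (k + 1) div 2 \<longleftrightarrow> l = k" using o by presburger
    moreover have "0 < (l + 1) div 2" "0 < (k + 1) div 2" using pos by auto
    ultimately show ?thesis unfolding trig1_odd[OF o(1)] trig1_odd[OF o(2)]
      using trig1_ortho_aux(1)[of "(l + 1) div 2" "(k + 1) div 2"] by simp
  next
    assume o: "odd l" "\<not> odd k"
    have "l \<noteq> k" using o by auto
    moreover have "0 < (l + 1) div 2" "0 < k div 2" using pos o by (auto elim: evenE)
    ultimately show ?thesis unfolding trig1_odd[OF o(1)] using trig1_even[of k] o pos
      trig1_ortho_aux(3)[of "(l + 1) div 2" "k div 2"] by simp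
  next
    assume o: "\<not> odd l" "odd k"
    have "l \<noteq> k" using o by auto
    moreover have "0 < (k + 1) div 2" "0 < l div 2" using pos o by (auto elim: evenE)
    ultimately show ?thesis unfolding trig1_odd[OF o(2)] using trig1_even[of l] o pos
      trig1_ortho_aux(3)[of "(k + 1) div 2" "l div 2"] by (simp add: mult.commute)
  next
    assume o: "\<not> odd l" "\<not> odd k"
    have "l div 2 = k div 2 \<longleftrightarrow> l = k" using o by presburger
    moreover have "0 < l div 2" "0 < k div 2" using pos o by (auto elim: evenE)
    ultimately show ?thesis using trig1_even[of l] trig1_even[of k] o pos
      trig1_ortho_aux(2)[of "l div 2" "k div 2"] by simp
  qed
qed

lemma continuous_trig1: "continuous_on A (trig1 l)"
  unfolding trig1_def by (cases "l = 0"; cases "odd l") (auto intro!: continuous_intros)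

lemma trig1_measurable [measurable]: "trig1 l \<in> borel_measurable borel"
  by (intro borel_measurable_continuous_onI continuous_trig1)

lemma trig1_bound: "\<bar>trig1 l t\<bar> \<le> sqrt 2"
  by (auto simp: trig1_def abs_mult intro: mult_left_le)

lemma trig_bound: "\<bar>trig d l x\<bar> \<le> sqrt 2 ^ d"
proof -
  have "\<bar>trig d l x\<bar> = (\<Prod>j<d. \<bar>trig1 (l j) (x j)\<bar>)" by (simp add: trig_def abs_prod)
  also have "\<dots> \<le> (\<Prod>j<d. sqrt 2)" by (intro prod_mono) (simp add: trig1_bound)
  finally show ?thesis by simp
qed

lemma trig_measurable [measurable]: "trig d l \<in> borel_measurable (lebd d)"
  unfolding trig_def[abs_def] lebd_def by measurable

section \<open>Fourier expansion on the cube\<close>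

definition cubeM :: "nat \<Rightarrow> (nat \<Rightarrow> real) measure" where
  "cubeM d = density (lebd d) (indicator (cube d))"

lemma cube_sets [measurable]: "cube d \<in> sets (lebd d)"
  unfolding cube_def lebd_def by (intro sets_PiM_I_finite) auto

lemma sets_cubeM [simp, measurable_cong]: "sets (cubeM d) = sets (lebd d)"
  by (simp add: cubeM_def)

lemma prob_space_cubeM: "prob_space (cubeM d)"
proof (rule prob_spaceI)
  interpret product_sigma_finite "\<lambda>_::nat. lborel :: real measure" ..
  have "emeasure (lebd d) (cube d) = (\<Prod>i<d. emeasure lborel {0..1::real})"
    unfolding lebd_def cube_def by (subst emeasure_PiM) auto
  moreover have "cube d \<inter> space (lebd d) = cube d"
    using sets.sets_into_space[OF cube_sets] by auto
  ultimately show "emeasure (cubeM d) (space (cubeM d)) = 1"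
    by (simp add: cubeM_def emeasure_density)
qed

lemma integral_cubeM:
  fixes f :: "(nat \<Rightarrow> real) \<Rightarrow> real"
  assumes "f \<in> borel_measurable (lebd d)"
  shows "(\<integral>x. f x \<partial>cubeM d) = (\<integral>x. indicator (cube d) x * f x \<partial>lebd d)"
proof -
  have "cubeM d = density (lebd d) (\<lambda>x. ennreal (indicator (cube d) x))"
    unfolding cubeM_def by (intro arg_cong2[where f = density] refl) (auto simp: fun_eq_iff indicator_def)
  moreover have "integral\<^sup>L (density (lebd d) (\<lambda>x. ennreal (indicator (cube d) x))) f =
      (\<integral>x. indicator (cube d) x *\<^sub>R f x \<partial>lebd d)"
    using assms by (intro integral_density) auto
  ultimately show ?thesis by simp
qed

lemma nn_integral_cubeM:
  assumes "f \<in> borel_measurable (lebd d)"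
  shows "(\<integral>\<^sup>+x. f x \<partial>cubeM d) = (\<integral>\<^sup>+x. indicator (cube d) x * f x \<partial>lebd d)"
  unfolding cubeM_def using assms by (simp add: nn_integral_density)

lemma indicator_cube:
  assumes "x \<in> space (lebd d)"
  shows "indicator (cube d) x = (\<Prod>j<d. indicator {0..1} (x j) :: real)"
proof (cases "x \<in> cube d")
  case True
  hence "\<forall>j<d. x j \<in> {0..1}" by (auto simp: cube_def PiE_iff)
  with True show ?thesis by simp
next
  case False
  then obtain j where "j < d" "x j \<notin> {0..1}" using assms by (auto simp: cube_def lebd_def space_PiM PiE_iff)
  hence "(\<Prod>j<d. indicator {0..1} (x j) :: real) = 0"
    by (intro prod_zero bexI[of _ j]) (auto simp del: atLeastAtMost_iff)
  with False show ?thesis by simp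
qed

text \<open>Indicator and integrand factorise over the coordinates. Distinct indices in
  \<open>MI d\<close> are extensional, so they differ in a coordinate below \<open>d\<close>, where
  the one-dimensional factor vanishes.\<close>

lemma trig_ortho:
  assumes "l \<in> MI d" "k \<in> MI d"
  shows "(\<integral>x. trig d l x * trig d k x \<partial>cubeM d) = of_bool (l = k)"
proof -
  interpret product_sigma_finite "\<lambda>_::nat. lborel :: real measure" ..
  have "(\<integral>x. trig d l x * trig d k x \<partial>cubeM d) = (\<integral>x. indicator (cube d) x * (trig d l x * trig d k x) \<partial>lebd d)"
    by (rule integral_cubeM) measurable
  also have "\<dots> = (\<integral>x. (\<Prod>j<d. indicator {0..1} (x j) * (trig1 (l j) (x j) * trig1 (k j) (x j))) \<partial>lebd d)"
    by (intro Bochner_Integration.integral_cong refl) (simp add: indicator_cube trig_def prod.distrib)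
  also have "\<dots> = (\<Prod>j<d. \<integral>t. indicator {0..1} t * (trig1 (l j) t * trig1 (k j) t) \<partial>lborel)"
    unfolding lebd_def
    by (rule product_integral_prod) (auto intro!: integrable_Icc continuous_intros continuous_trig1)
  also have "\<dots> = (\<Prod>j<d. of_bool (l j = k j))" by (simp add: trig1_ortho)
  also have "\<dots> = of_bool (l = k)"
  proof (cases "l = k")
    case False
    then obtain j where "j < d" "l j \<noteq> k j" using assms by (metis MI_def PiE_ext lessThan_iff)
    hence "(\<Prod>j<d. of_bool (l j = k j) :: real) = 0" by (intro prod_zero bexI[of _ j]) auto
    with False show ?thesis by simp
  qed simp
  finally show ?thesis .
qed

text \<open>A box rather than a Euclidean ball of frequencies: it has exactly \<open>M ^ d\<close>
  elements, and an index outside it has a coordinate of size at least \<open>M\<close>, which is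
  enough for the bias bound.\<close>

definition freq_box :: "nat \<Rightarrow> nat \<Rightarrow> (nat \<Rightarrow> nat) set" where
  "freq_box d M = PiE {..<d} (\<lambda>_. {..<M})"

lemma finite_freq_box [simp]: "finite (freq_box d M)"
  unfolding freq_box_def by (intro finite_PiE) auto

lemma card_freq_box: "card (freq_box d M) = M ^ d"
  unfolding freq_box_def by (subst card_PiE) auto

lemma freq_box_subset_MI: "freq_box d M \<subseteq> MI d"
  unfolding freq_box_def MI_def by (intro PiE_mono) auto

lemma mi_norm_pow_outside_freq_box:
  assumes "l \<in> MI d" "l \<notin> freq_box d M" "0 < s" "0 < M"
  shows "real M powr (2 * s) \<le> mi_norm_pow d s l"
proof -
  obtain j where j: "j < d" "M \<le> l j"
    using assms by (auto simp: freq_box_def MI_def PiE_iff not_less)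
  have "(real M)\<^sup>2 \<le> (real (l j))\<^sup>2" using j by (intro power_mono) auto
  also have "\<dots> \<le> (\<Sum>j<d. real (l j) ^ 2)" using j by (intro member_le_sum) auto
  finally have "((real M)\<^sup>2) powr s \<le> mi_norm_pow d s l"
    unfolding mi_norm_pow_def using assms by (intro powr_mono2) auto
  moreover have "(real M)\<^sup>2 = real M powr 2" using assms by simp
  hence "((real M)\<^sup>2) powr s = real M powr (2 * s)" by (simp only: powr_powr)
  ultimately show ?thesis by simp
qed

lemma (in prob_space) integrable_square_imp:
  fixes f :: "'a \<Rightarrow> real"
  assumes [measurable]: "f \<in> borel_measurable M" and "integrable M (\<lambda>x. (f x)\<^sup>2)"
  shows "integrable M f"
proof (rule Bochner_Integration.integrable_bound)
  show "integrable M (\<lambda>x. 1 + (f x)\<^sup>2)" using assms by simp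
  have "\<bar>y\<bar> \<le> 1 + y\<^sup>2" for y :: real
  proof -
    have "0 \<le> (\<bar>y\<bar> - 1)\<^sup>2" by simp
    thus ?thesis by (simp add: power2_diff)
  qed
  thus "AE x in M. norm (f x) \<le> norm (1 + (f x)\<^sup>2)" by (simp add: add_nonneg_nonneg)
qed simp

text \<open>The pointwise inequality \<open>2 * t * |y| \<le> t^2 + y^2\<close>, integrated over a
  probability space.\<close>

lemma (in prob_space) integral_abs_le_sqrt:
  fixes f :: "'a \<Rightarrow> real"
  assumes m [measurable]: "f \<in> borel_measurable M" and i: "integrable M (\<lambda>x. (f x)\<^sup>2)"
    and t: "0 < t" "(\<integral>x. (f x)\<^sup>2 \<partial>M) \<le> t\<^sup>2"
  shows "(\<integral>x. \<bar>f x\<bar> \<partial>M) \<le> t"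
proof -
  have "2 * t * \<bar>y\<bar> \<le> t\<^sup>2 + y\<^sup>2" for y :: real
  proof -
    have "0 \<le> (\<bar>y\<bar> - t)\<^sup>2" by simp
    thus ?thesis by (simp add: power2_diff mult_ac)
  qed
  hence "(\<integral>x. 2 * t * \<bar>f x\<bar> \<partial>M) \<le> (\<integral>x. t\<^sup>2 + (f x)\<^sup>2 \<partial>M)"
    using i integrable_square_imp[OF m i] by (intro integral_mono) auto
  also have "\<dots> \<le> 2 * t\<^sup>2" using i t by (simp add: prob_space)
  finally show ?thesis using t by (simp add: power2_eq_square)
qed

text \<open>Comparison of \<open>L^p\<close> and \<open>L^2\<close> norms by a pointwise bound: the
  weighted mean inequality for \<open>y^2\<close> and \<open>B\<close> with weights
  \<open>p / 2\<close> and \<open>1 - p / 2\<close> is linear in \<open>y^2\<close>, so it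
  integrates directly, and it covers the endpoint \<open>p = 2\<close> as well.\<close>

lemma (in prob_space) integral_powr_le:
  fixes f :: "'a \<Rightarrow> real"
  assumes m [measurable]: "f \<in> borel_measurable M" and i: "integrable M (\<lambda>x. (f x)\<^sup>2)"
    and p: "1 \<le> p" "p \<le> 2" and B: "0 < B" "(\<integral>x. (f x)\<^sup>2 \<partial>M) \<le> B"
  shows "(\<integral>x. \<bar>f x\<bar> powr p \<partial>M) powr (1 / p) \<le> sqrt B"
proof -
  have young: "\<bar>y\<bar> powr p * B powr (1 - p / 2) \<le> p / 2 * y\<^sup>2 + (1 - p / 2) * B" for y :: real
  proof (cases "y = 0")
    case True
    thus ?thesis using p B by simp
  next
    case False
    have "(y\<^sup>2) powr (p / 2) * B powr (1 - p / 2) \<le> p / 2 * y\<^sup>2 + (1 - p / 2) * B"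
      using p B False by (intro Youngs_inequality_0) auto
    moreover have "y\<^sup>2 = \<bar>y\<bar> powr 2" using False by simp
    hence "(y\<^sup>2) powr (p / 2) = \<bar>y\<bar> powr (2 * (p / 2))" by (simp only: powr_powr)
    ultimately show ?thesis by simp
  qed
  have Bp: "0 < B powr (1 - p / 2)" using B by simp
  have int: "integrable M (\<lambda>x. \<bar>f x\<bar> powr p * B powr (1 - p / 2))"
  proof (rule Bochner_Integration.integrable_bound)
    show "integrable M (\<lambda>x. p / 2 * (f x)\<^sup>2 + (1 - p / 2) * B)" using i by simp
    have "0 \<le> p / 2 * (f x)\<^sup>2 + (1 - p / 2) * B" for x using p B by (intro add_nonneg_nonneg mult_nonneg_nonneg) auto
    thus "AE x in M. norm (\<bar>f x\<bar> powr p * B powr (1 - p / 2)) \<le> norm (p / 2 * (f x)\<^sup>2 + (1 - p / 2) * B)"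
      using young by (simp add: abs_mult)
  qed simp
  have "(\<integral>x. \<bar>f x\<bar> powr p \<partial>M) * B powr (1 - p / 2) = (\<integral>x. \<bar>f x\<bar> powr p * B powr (1 - p / 2) \<partial>M)"
    by simp
  also have "\<dots> \<le> (\<integral>x. p / 2 * (f x)\<^sup>2 + (1 - p / 2) * B \<partial>M)"
    using i int young by (intro integral_mono) auto
  also have "\<dots> = p / 2 * (\<integral>x. (f x)\<^sup>2 \<partial>M) + (1 - p / 2) * B"
    using i by (simp add: prob_space)
  also have "\<dots> \<le> p / 2 * B + (1 - p / 2) * B" using p B by (intro add_mono mult_left_mono) auto
  also have "\<dots> = B powr (p / 2) * B powr (1 - p / 2)"
    using B by (simp add: powr_add[symmetric] algebra_simps)
  finally have "(\<integral>x. \<bar>f x\<bar> powr p \<partial>M) \<le> B powr (p / 2)"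
    using Bp by (simp add: mult_le_cancel_right)
  hence "(\<integral>x. \<bar>f x\<bar> powr p \<partial>M) powr (1 / p) \<le> (B powr (p / 2)) powr (1 / p)"
    using p by (intro powr_mono2 integral_nonneg_AE) auto
  also have "\<dots> = sqrt B" using p B by (simp add: powr_powr powr_half_sqrt)
  finally show ?thesis .
qed

lemma sum_trig_sq:
  assumes G: "finite G" "G \<subseteq> MI d"
  shows "(\<integral>x. (\<Sum>l\<in>G. c l * trig d l x)\<^sup>2 \<partial>cubeM d) = (\<Sum>l\<in>G. (c l)\<^sup>2)"
    and "l \<in> MI d \<Longrightarrow> (\<integral>x. (\<Sum>k\<in>G. c k * trig d k x) * trig d l x \<partial>cubeM d) = (if l \<in> G then c l else 0)"
proof -
  interpret prob_space "cubeM d" by (rule prob_space_cubeM)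
  have int [simp]: "integrable (cubeM d) (\<lambda>x. trig d l x * trig d k x)" for l k
  proof (rule integrable_const_bound[of _ "sqrt 2 ^ d * sqrt 2 ^ d"])
    show "AE x in cubeM d. norm (trig d l x * trig d k x) \<le> sqrt 2 ^ d * sqrt 2 ^ d"
      unfolding real_norm_def abs_mult by (intro AE_I2 mult_mono trig_bound) auto
  qed simp
  have "(\<integral>x. (\<Sum>l\<in>G. c l * trig d l x)\<^sup>2 \<partial>cubeM d) =
      (\<integral>x. (\<Sum>l\<in>G. \<Sum>k\<in>G. (c l * c k) * (trig d l x * trig d k x)) \<partial>cubeM d)"
    by (simp add: power2_eq_square sum_product mult_ac)
  also have "\<dots> = (\<Sum>l\<in>G. \<Sum>k\<in>G. (c l * c k) * (\<integral>x. trig d l x * trig d k x \<partial>cubeM d))"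
    by (simp add: Bochner_Integration.integral_sum)
  also have "\<dots> = (\<Sum>l\<in>G. \<Sum>k\<in>G. if l = k then c l * c k else 0)"
    using G by (intro sum.cong refl) (auto simp: trig_ortho subset_iff)
  also have "\<dots> = (\<Sum>l\<in>G. (c l)\<^sup>2)" using G by (simp add: power2_eq_square)
  finally show "(\<integral>x. (\<Sum>l\<in>G. c l * trig d l x)\<^sup>2 \<partial>cubeM d) = (\<Sum>l\<in>G. (c l)\<^sup>2)" .
  assume l: "l \<in> MI d"
  have "(\<integral>x. (\<Sum>k\<in>G. c k * trig d k x) * trig d l x \<partial>cubeM d) =
      (\<integral>x. (\<Sum>k\<in>G. c k * (trig d k x * trig d l x)) \<partial>cubeM d)"
    by (simp only: sum_distrib_right mult.assoc)
  also have "\<dots> = (\<Sum>k\<in>G. c k * (\<integral>x. trig d k x * trig d l x \<partial>cubeM d))"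
    by (simp add: Bochner_Integration.integral_sum)
  also have "\<dots> = (\<Sum>k\<in>G. if k = l then c k else 0)"
    using G l by (intro sum.cong refl) (auto simp: trig_ortho subset_iff)
  also have "\<dots> = (if l \<in> G then c l else 0)" using G by simp
  finally show "(\<integral>x. (\<Sum>k\<in>G. c k * trig d k x) * trig d l x \<partial>cubeM d) = (if l \<in> G then c l else 0)" .
qed

text \<open>The class constrains \<open>f\<close> only on the cube. Multiplying by the indicator
  gives a function that is measurable everywhere and turns the approximation into a statement about
  the probability measure \<open>cubeM d\<close>.\<close>

lemma dens_class_approx:
  assumes "f \<in> dens_class d s r"
  obtains \<theta> where "\<theta> (MI0 d) = 0"
    "(\<lambda>l. mi_norm_pow d s l * (\<theta> l)\<^sup>2) summable_on MI d"
    "(\<Sum>\<^sub>\<infinity>l\<in>MI d. mi_norm_pow d s l * (\<theta> l)\<^sup>2) \<le> r\<^sup>2"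
    "\<And>e. 0 < e \<Longrightarrow> \<exists>F. finite F \<and> F \<subseteq> MI d \<and> (\<forall>G. finite G \<and> F \<subseteq> G \<and> G \<subseteq> MI d \<longrightarrow>
       (\<integral>\<^sup>+x. ennreal ((indicator (cube d) x * f x - 1 - (\<Sum>l\<in>G. \<theta> l * trig d l x))\<^sup>2) \<partial>cubeM d) < ennreal e)"
proof -
  have m: "(\<lambda>x. indicator (cube d) x * f x) \<in> borel_measurable (lebd d)"
    using assms by (simp add: dens_class_def sobolev_class_def)
  have gen: "(\<lambda>x. ennreal ((u x - 1 - (\<Sum>l\<in>G. \<theta> l * trig d l x))\<^sup>2)) \<in> borel_measurable (lebd d)"
    if [measurable]: "u \<in> borel_measurable (lebd d)" for u G and \<theta> :: "(nat \<Rightarrow> nat) \<Rightarrow> real" by measurable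
  have eq: "(\<integral>\<^sup>+x. ennreal ((indicator (cube d) x * f x - 1 - (\<Sum>l\<in>G. \<theta> l * trig d l x))\<^sup>2) \<partial>cubeM d) =
     (\<integral>\<^sup>+x. indicator (cube d) x * ennreal ((f x - 1 - (\<Sum>l\<in>G. \<theta> l * trig d l x))\<^sup>2) \<partial>lebd d)" for G and \<theta> :: "(nat \<Rightarrow> nat) \<Rightarrow> real"
  proof -
    have "(\<integral>\<^sup>+x. ennreal ((indicator (cube d) x * f x - 1 - (\<Sum>l\<in>G. \<theta> l * trig d l x))\<^sup>2) \<partial>cubeM d) =
      (\<integral>\<^sup>+x. indicator (cube d) x * ennreal ((indicator (cube d) x * f x - 1 - (\<Sum>l\<in>G. \<theta> l * trig d l x))\<^sup>2) \<partial>lebd d)"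
      by (intro nn_integral_cubeM gen m)
    also have "\<dots> = (\<integral>\<^sup>+x. indicator (cube d) x * ennreal ((f x - 1 - (\<Sum>l\<in>G. \<theta> l * trig d l x))\<^sup>2) \<partial>lebd d)"
      by (intro nn_integral_cong) (simp add: indicator_def)
    finally show ?thesis .
  qed
  have "\<exists>\<theta> :: (nat \<Rightarrow> nat) \<Rightarrow> real. \<theta> (MI0 d) = 0 \<and>
        (\<lambda>l. mi_norm_pow d s l * (\<theta> l)\<^sup>2) summable_on MI d \<and>
        (\<Sum>\<^sub>\<infinity>l\<in>MI d. mi_norm_pow d s l * (\<theta> l)\<^sup>2) \<le> r\<^sup>2 \<and>
        (\<forall>e>0. \<exists>F. finite F \<and> F \<subseteq> MI d \<and>
           (\<forall>G. finite G \<and> F \<subseteq> G \<and> G \<subseteq> MI d \<longrightarrow>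
              (\<integral>\<^sup>+x. indicator (cube d) x *
                  ennreal ((f x - 1 - (\<Sum>l\<in>G. \<theta> l * trig d l x))\<^sup>2) \<partial>lebd d) < ennreal e))"
    using assms unfolding dens_class_def sobolev_class_def by simp
  then obtain \<theta> :: "(nat \<Rightarrow> nat) \<Rightarrow> real" where t: "\<theta> (MI0 d) = 0"
        "(\<lambda>l. mi_norm_pow d s l * (\<theta> l)\<^sup>2) summable_on MI d"
        "(\<Sum>\<^sub>\<infinity>l\<in>MI d. mi_norm_pow d s l * (\<theta> l)\<^sup>2) \<le> r\<^sup>2"
    and ap: "\<forall>e>0. \<exists>F. finite F \<and> F \<subseteq> MI d \<and>
           (\<forall>G. finite G \<and> F \<subseteq> G \<and> G \<subseteq> MI d \<longrightarrow>
              (\<integral>\<^sup>+x. indicator (cube d) x *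
                  ennreal ((f x - 1 - (\<Sum>l\<in>G. \<theta> l * trig d l x))\<^sup>2) \<partial>lebd d) < ennreal e)"
    by (elim exE conjE)
  show ?thesis
    by (rule that[OF t]) (unfold eq, rule ap[rule_format])
qed

lemma integral_dens:
  assumes f: "is_density d f" and q: "q \<in> borel_measurable (lebd d)"
  shows "(\<integral>x. q x \<partial>dens d f) = (\<integral>x. (indicator (cube d) x * f x) * q x \<partial>cubeM d)"
proof -
  let ?f = "\<lambda>x. indicator (cube d) x * f x"
  have m: "?f \<in> borel_measurable (lebd d)" using f by (simp add: is_density_def)
  have nn: "0 \<le> ?f x" for x using f by (auto simp: is_density_def indicator_def)
  have "dens d f = density (lebd d) (\<lambda>x. ennreal (?f x))"
    by (simp add: dens_def ennreal_indicator_times)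
  moreover have "integral\<^sup>L (density (lebd d) (\<lambda>x. ennreal (?f x))) q = (\<integral>x. ?f x *\<^sub>R q x \<partial>lebd d)"
    by (intro integral_density AE_I2 nn m q)
  ultimately have "(\<integral>x. q x \<partial>dens d f) = (\<integral>x. ?f x * q x \<partial>lebd d)" by simp
  also have "\<dots> = (\<integral>x. indicator (cube d) x * (?f x * q x) \<partial>lebd d)"
    by (intro Bochner_Integration.integral_cong refl) (simp add: indicator_def)
  also have "\<dots> = (\<integral>x. ?f x * q x \<partial>cubeM d)" by (intro integral_cubeM[symmetric] borel_measurable_times m q)
  finally show ?thesis .
qed

lemma integrable_density:
  assumes f: "is_density d f"
  shows "integrable (cubeM d) (\<lambda>x. indicator (cube d) x * f x)"
proof -
  let ?f = "\<lambda>x. indicator (cube d) x * f x"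
  have m: "?f \<in> borel_measurable (lebd d)" using f by (simp add: is_density_def)
  have nn: "0 \<le> ?f x" for x using f by (auto simp: is_density_def indicator_def)
  have "(\<integral>\<^sup>+x. ennreal (?f x) \<partial>cubeM d) = (\<integral>\<^sup>+x. indicator (cube d) x * ennreal (?f x) \<partial>lebd d)"
    by (intro nn_integral_cubeM measurable_compose[OF m measurable_ennreal])
  also have "\<dots> = (\<integral>\<^sup>+x. indicator (cube d) x * ennreal (f x) \<partial>lebd d)"
    by (intro nn_integral_cong) (simp add: indicator_def)
  also have "\<dots> = 1" using f by (simp add: is_density_def)
  finally show ?thesis
    using nn m by (intro integrableI_bounded) (simp_all cong: measurable_cong_sets)
qed

text \<open>The only properties of the class that the tests exploit: coefficients of the difference
  are differences of means of bounded functions, hence can be queried, and low-frequency energy plus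
  bias controls every distance. The factors \<open>2\<close> and \<open>8\<close> come from
  splitting squares crudely; this lets finite partial sums with an arbitrarily small remainder do
  the work of Parseval's identity.\<close>

lemma sobolev_pair:
  assumes fX: "fX \<in> dens_class d s r" and fY: "fY \<in> dens_class d s r" and s: "0 < s" and r: "0 < r"
  obtains \<delta> where
    "\<And>l. l \<in> MI d \<Longrightarrow> (\<integral>x. trig d l x \<partial>dens d fX) - (\<integral>x. trig d l x \<partial>dens d fY) = \<delta> l"
    "\<delta> (MI0 d) = 0"
    "\<And>M p. 0 < M \<Longrightarrow> 1 \<le> p \<Longrightarrow> p \<le> 2 \<Longrightarrow>
       (Lp_dist d p fX fY)\<^sup>2 \<le> 2 * (\<Sum>l\<in>freq_box d M. (\<delta> l)\<^sup>2) + 8 * r\<^sup>2 * real M powr (- 2 * s)"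
proof -
  have dX: "is_density d fX" and dY: "is_density d fY" using fX fY by (auto simp: dens_class_def)
  obtain tX where tX: "tX (MI0 d) = 0"
    "(\<lambda>l. mi_norm_pow d s l * (tX l)\<^sup>2) summable_on MI d"
    "(\<Sum>\<^sub>\<infinity>l\<in>MI d. mi_norm_pow d s l * (tX l)\<^sup>2) \<le> r\<^sup>2"
    "\<And>e. 0 < e \<Longrightarrow> \<exists>F. finite F \<and> F \<subseteq> MI d \<and> (\<forall>G. finite G \<and> F \<subseteq> G \<and> G \<subseteq> MI d \<longrightarrow>
       (\<integral>\<^sup>+x. ennreal ((indicator (cube d) x * fX x - 1 - (\<Sum>l\<in>G. tX l * trig d l x))\<^sup>2) \<partial>cubeM d) < ennreal e)"
    by (rule dens_class_approx[OF fX]) blast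
  obtain tY where tY: "tY (MI0 d) = 0"
    "(\<lambda>l. mi_norm_pow d s l * (tY l)\<^sup>2) summable_on MI d"
    "(\<Sum>\<^sub>\<infinity>l\<in>MI d. mi_norm_pow d s l * (tY l)\<^sup>2) \<le> r\<^sup>2"
    "\<And>e. 0 < e \<Longrightarrow> \<exists>F. finite F \<and> F \<subseteq> MI d \<and> (\<forall>G. finite G \<and> F \<subseteq> G \<and> G \<subseteq> MI d \<longrightarrow>
       (\<integral>\<^sup>+x. ennreal ((indicator (cube d) x * fY x - 1 - (\<Sum>l\<in>G. tY l * trig d l x))\<^sup>2) \<partial>cubeM d) < ennreal e)"
    by (rule dens_class_approx[OF fY]) blast
  define uX where "uX = (\<lambda>x. indicator (cube d) x * fX x)"
  define uY where "uY = (\<lambda>x. indicator (cube d) x * fY x)"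
  define u where "u = (\<lambda>x. uX x - uY x)"
  define \<delta> where "\<delta> = (\<lambda>l. tX l - tY l)"
  interpret prob_space "cubeM d" by (rule prob_space_cubeM)
  have [measurable]: "uX \<in> borel_measurable (lebd d)" "uY \<in> borel_measurable (lebd d)"
    using dX dY by (auto simp: is_density_def uX_def uY_def)
  hence [measurable]: "u \<in> borel_measurable (lebd d)" by (simp add: u_def)
  have iX: "integrable (cubeM d) uX" unfolding uX_def by (rule integrable_density[OF dX])
  have iY: "integrable (cubeM d) uY" unfolding uY_def by (rule integrable_density[OF dY])
  define v where "v = (\<lambda>G x. u x - (\<Sum>l\<in>G. \<delta> l * trig d l x))"
  have vm [measurable]: "v G \<in> borel_measurable (lebd d)" for G
    unfolding v_def by measurable
  have approx: "\<exists>F. finite F \<and> F \<subseteq> MI d \<and> (\<forall>G. finite G \<longrightarrow> F \<subseteq> G \<longrightarrow> G \<subseteq> MI d \<longrightarrow>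
      integrable (cubeM d) (\<lambda>x. (v G x)\<^sup>2) \<and> (\<integral>x. (v G x)\<^sup>2 \<partial>cubeM d) \<le> e)" if e: "0 < e" for e
  proof -
    from tX(4)[of "e / 4"] obtain F1 where F1: "finite F1" "F1 \<subseteq> MI d"
      "\<And>G. finite G \<Longrightarrow> F1 \<subseteq> G \<Longrightarrow> G \<subseteq> MI d \<Longrightarrow>
       (\<integral>\<^sup>+x. ennreal ((uX x - 1 - (\<Sum>l\<in>G. tX l * trig d l x))\<^sup>2) \<partial>cubeM d) < ennreal (e / 4)"
      using e unfolding uX_def by auto
    from tY(4)[of "e / 4"] obtain F2 where F2: "finite F2" "F2 \<subseteq> MI d"
      "\<And>G. finite G \<Longrightarrow> F2 \<subseteq> G \<Longrightarrow> G \<subseteq> MI d \<Longrightarrow>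
       (\<integral>\<^sup>+x. ennreal ((uY x - 1 - (\<Sum>l\<in>G. tY l * trig d l x))\<^sup>2) \<partial>cubeM d) < ennreal (e / 4)"
      using e unfolding uY_def by auto
    show ?thesis
    proof (intro exI[of _ "F1 \<union> F2"] conjI allI impI)
      fix G assume G: "finite G" "F1 \<union> F2 \<subseteq> G" "G \<subseteq> MI d"
      let ?a = "\<lambda>x. uX x - 1 - (\<Sum>l\<in>G. tX l * trig d l x)"
      let ?b = "\<lambda>x. uY x - 1 - (\<Sum>l\<in>G. tY l * trig d l x)"
      have "(v G x)\<^sup>2 \<le> 2 * (?a x)\<^sup>2 + 2 * (?b x)\<^sup>2" for x
      proof -
        have "v G x = ?a x - ?b x"
          by (simp add: v_def u_def \<delta>_def left_diff_distrib sum_subtractf)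
        moreover have "(a - b)\<^sup>2 \<le> 2 * a\<^sup>2 + 2 * b\<^sup>2" for a b :: real
          using zero_le_power2[of "a + b"] by (simp add: power2_diff power2_sum)
        ultimately show ?thesis by (simp only:)
      qed
      note pw = this
      have "ennreal ((v G x)\<^sup>2) \<le> 2 * ennreal ((?a x)\<^sup>2) + 2 * ennreal ((?b x)\<^sup>2)" for x
      proof -
        have "ennreal ((v G x)\<^sup>2) \<le> ennreal (2 * (?a x)\<^sup>2 + 2 * (?b x)\<^sup>2)" by (rule ennreal_leI[OF pw])
        also have "\<dots> = 2 * ennreal ((?a x)\<^sup>2) + 2 * ennreal ((?b x)\<^sup>2)"
          by (subst ennreal_plus) (simp_all add: ennreal_mult')
        finally show ?thesis .
      qed
      hence "(\<integral>\<^sup>+x. ennreal ((v G x)\<^sup>2) \<partial>cubeM d) \<le>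
          (\<integral>\<^sup>+x. 2 * ennreal ((?a x)\<^sup>2) + 2 * ennreal ((?b x)\<^sup>2) \<partial>cubeM d)"
        by (intro nn_integral_mono)
      also have "\<dots> = 2 * (\<integral>\<^sup>+x. ennreal ((?a x)\<^sup>2) \<partial>cubeM d) + 2 * (\<integral>\<^sup>+x. ennreal ((?b x)\<^sup>2) \<partial>cubeM d)"
        by (simp add: nn_integral_add nn_integral_cmult)
      also have "\<dots> \<le> 2 * ennreal (e / 4) + 2 * ennreal (e / 4)"
        using F1(3)[of G] F2(3)[of G] G by (intro add_mono mult_left_mono less_imp_le) auto
      also have "\<dots> = ennreal e"
        using e by (simp add: ennreal_mult'[symmetric] ennreal_plus[symmetric] flip: ennreal_numeral del: ennreal_plus)
      finally have le: "(\<integral>\<^sup>+x. ennreal ((v G x)\<^sup>2) \<partial>cubeM d) \<le> ennreal e" .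
      show i: "integrable (cubeM d) (\<lambda>x. (v G x)\<^sup>2)"
        using le by (intro integrableI_bounded) (auto simp: order_le_less_trans)
      show "(\<integral>x. (v G x)\<^sup>2 \<partial>cubeM d) \<le> e"
        using le nn_integral_eq_integral[OF i] e by simp
    qed (use F1 F2 in auto)
  qed
  have tb [simp]: "integrable (cubeM d) (\<lambda>x. q x * trig d l x)" if "integrable (cubeM d) q" for q l
  proof (rule Bochner_Integration.integrable_bound)
    show "integrable (cubeM d) (\<lambda>x. sqrt 2 ^ d * q x)" using that by simp
    show "AE x in cubeM d. norm (q x * trig d l x) \<le> norm (sqrt 2 ^ d * q x)"
      by (intro AE_I2) (simp add: abs_mult mult.commute mult_left_mono trig_bound)
  qed (use borel_measurable_integrable[OF that] in simp)
  have ti: "integrable (cubeM d) (trig d l)" for l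
    by (rule integrable_const_bound[of _ "sqrt 2 ^ d"]) (use trig_bound in auto)
  \<comment> \<open>A partial sum containing \<open>l\<close> has coefficient exactly
    \<open>\<delta> l\<close>. The remainder is small in \<open>L^2\<close>, hence in
    \<open>L^1\<close>, and is integrated against a function bounded by
    \<open>sqrt 2 ^ d\<close>.\<close>
  have coeff: "(\<integral>x. u x * trig d l x \<partial>cubeM d) = \<delta> l" if l: "l \<in> MI d" for l
  proof -
    have "\<bar>(\<integral>x. u x * trig d l x \<partial>cubeM d) - \<delta> l\<bar> \<le> t" if t: "0 < t" for t
    proof -
      define t' where "t' = t / sqrt 2 ^ d"
      have t': "0 < t'" using t by (simp add: t'_def)
      from approx[of "t'\<^sup>2"] t' obtain F where F: "finite F" "F \<subseteq> MI d"
        "\<And>G. finite G \<Longrightarrow> F \<subseteq> G \<Longrightarrow> G \<subseteq> MI d \<Longrightarrow>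
          integrable (cubeM d) (\<lambda>x. (v G x)\<^sup>2) \<and> (\<integral>x. (v G x)\<^sup>2 \<partial>cubeM d) \<le> t'\<^sup>2" by auto
      let ?G = "insert l F"
      have G: "finite ?G" "?G \<subseteq> MI d" using F l by auto
      have v2: "integrable (cubeM d) (\<lambda>x. (v ?G x)\<^sup>2)" "(\<integral>x. (v ?G x)\<^sup>2 \<partial>cubeM d) \<le> t'\<^sup>2"
        using F(3)[of ?G] G by auto
      have iv: "integrable (cubeM d) (v ?G)" by (rule integrable_square_imp[OF _ v2(1)]) simp
      have iS: "integrable (cubeM d) (\<lambda>x. \<Sum>k\<in>?G. \<delta> k * trig d k x)" using ti by auto
      have "(\<integral>x. u x * trig d l x \<partial>cubeM d) =
          (\<integral>x. v ?G x * trig d l x + (\<Sum>k\<in>?G. \<delta> k * trig d k x) * trig d l x \<partial>cubeM d)"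
        by (intro Bochner_Integration.integral_cong refl) (simp only: v_def left_diff_distrib diff_add_cancel)
      also have "\<dots> = (\<integral>x. v ?G x * trig d l x \<partial>cubeM d) + (\<integral>x. (\<Sum>k\<in>?G. \<delta> k * trig d k x) * trig d l x \<partial>cubeM d)"
        by (intro Bochner_Integration.integral_add tb iv iS)
      also have "(\<integral>x. (\<Sum>k\<in>?G. \<delta> k * trig d k x) * trig d l x \<partial>cubeM d) = \<delta> l"
        by (subst sum_trig_sq(2)[OF G l]) simp
      finally have "\<bar>(\<integral>x. u x * trig d l x \<partial>cubeM d) - \<delta> l\<bar> = \<bar>\<integral>x. v ?G x * trig d l x \<partial>cubeM d\<bar>" by simp
      also have "\<dots> \<le> (\<integral>x. \<bar>v ?G x * trig d l x\<bar> \<partial>cubeM d)" by (rule integral_abs_bound)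
      also have "\<dots> \<le> (\<integral>x. sqrt 2 ^ d * \<bar>v ?G x\<bar> \<partial>cubeM d)"
      proof (rule integral_mono)
        show "integrable (cubeM d) (\<lambda>x. \<bar>v ?G x * trig d l x\<bar>)" by (intro integrable_abs tb iv)
        show "integrable (cubeM d) (\<lambda>x. sqrt 2 ^ d * \<bar>v ?G x\<bar>)" using iv by simp
        show "\<bar>v ?G x * trig d l x\<bar> \<le> sqrt 2 ^ d * \<bar>v ?G x\<bar>" for x
          using mult_right_mono[OF trig_bound[of d l x], of "\<bar>v ?G x\<bar>"] by (simp add: abs_mult mult.commute)
      qed
      also have "\<dots> = sqrt 2 ^ d * (\<integral>x. \<bar>v ?G x\<bar> \<partial>cubeM d)" by simp
      also have "\<dots> \<le> sqrt 2 ^ d * t'"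
        by (intro mult_left_mono integral_abs_le_sqrt[OF _ v2(1) t' v2(2)]) auto
      also have "\<dots> = t" by (simp add: t'_def)
      finally show ?thesis .
    qed
    hence "\<bar>(\<integral>x. u x * trig d l x \<partial>cubeM d) - \<delta> l\<bar> \<le> 0"
      by (rule field_le_epsilon) (simp only: add_0)
    thus ?thesis by simp
  qed
  \<comment> \<open>Outside the box the Sobolev weight is at least \<open>M\<close> to the power
    \<open>2 * s\<close>, and each of the two coefficient families has weighted energy at most
    \<open>r^2\<close>.\<close>
  have tail: "(\<Sum>l\<in>G. (\<delta> l)\<^sup>2) \<le> (\<Sum>l\<in>freq_box d M. (\<delta> l)\<^sup>2) + 4 * r\<^sup>2 * real M powr (- 2 * s)"
    if G: "finite G" "G \<subseteq> MI d" "freq_box d M \<subseteq> G" and M: "0 < M" for G M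
  proof -
    let ?w = "real M powr (- 2 * s)" and ?n = "mi_norm_pow d s"
    have fin: "(\<Sum>l\<in>G - freq_box d M. ?n l * (t l)\<^sup>2) \<le> r\<^sup>2"
      if "(\<lambda>l. ?n l * (t l)\<^sup>2) summable_on MI d" "(\<Sum>\<^sub>\<infinity>l\<in>MI d. ?n l * (t l)\<^sup>2) \<le> r\<^sup>2"
      for t :: "(nat \<Rightarrow> nat) \<Rightarrow> real"
    proof -
      have "(\<Sum>l\<in>G - freq_box d M. ?n l * (t l)\<^sup>2) \<le> (\<Sum>\<^sub>\<infinity>l\<in>MI d. ?n l * (t l)\<^sup>2)"
        using G by (intro finite_sum_le_infsum that) (auto simp: mi_norm_pow_def)
      thus ?thesis using that by simp
    qed
    have "(\<Sum>l\<in>G - freq_box d M. (\<delta> l)\<^sup>2) \<le> (\<Sum>l\<in>G - freq_box d M. ?w * (2 * (?n l * (tX l)\<^sup>2) + 2 * (?n l * (tY l)\<^sup>2)))"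
    proof (rule sum_mono)
      fix l assume l: "l \<in> G - freq_box d M"
      have "real M powr (2 * s) \<le> ?n l" using l G M s by (intro mi_norm_pow_outside_freq_box) auto
      hence "?w * real M powr (2 * s) \<le> ?w * ?n l" by (intro mult_left_mono) auto
      moreover have "?w * real M powr (2 * s) = 1" using M by (simp add: powr_add[symmetric])
      ultimately have 1: "1 \<le> ?w * ?n l" by simp
      have "(\<delta> l)\<^sup>2 \<le> 2 * (tX l)\<^sup>2 + 2 * (tY l)\<^sup>2"
        using zero_le_power2[of "tX l + tY l"] by (simp add: \<delta>_def power2_diff power2_sum)
      also have "\<dots> \<le> (?w * ?n l) * (2 * (tX l)\<^sup>2 + 2 * (tY l)\<^sup>2)"
        using mult_right_mono[OF 1, of "2 * (tX l)\<^sup>2 + 2 * (tY l)\<^sup>2"] by simp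
      finally show "(\<delta> l)\<^sup>2 \<le> ?w * (2 * (?n l * (tX l)\<^sup>2) + 2 * (?n l * (tY l)\<^sup>2))"
        by (simp add: algebra_simps)
    qed
    also have "\<dots> = ?w * (2 * (\<Sum>l\<in>G - freq_box d M. ?n l * (tX l)\<^sup>2) + 2 * (\<Sum>l\<in>G - freq_box d M. ?n l * (tY l)\<^sup>2))"
      by (simp only: sum_distrib_left[symmetric] sum.distrib)
    also have "\<dots> \<le> ?w * (2 * r\<^sup>2 + 2 * r\<^sup>2)"
      by (intro mult_left_mono add_mono fin tX tY) auto
    finally have "(\<Sum>l\<in>G - freq_box d M. (\<delta> l)\<^sup>2) \<le> 4 * r\<^sup>2 * ?w" by (simp add: mult_ac)
    moreover have "(\<Sum>l\<in>G. (\<delta> l)\<^sup>2) = (\<Sum>l\<in>G - freq_box d M. (\<delta> l)\<^sup>2) + (\<Sum>l\<in>freq_box d M. (\<delta> l)\<^sup>2)"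
      by (rule sum.subset_diff[OF G(3) G(1)])
    ultimately show ?thesis by simp
  qed
  have L2: "integrable (cubeM d) (\<lambda>x. (u x)\<^sup>2) \<and>
      (\<integral>x. (u x)\<^sup>2 \<partial>cubeM d) \<le> 2 * (\<Sum>l\<in>freq_box d M. (\<delta> l)\<^sup>2) + 8 * r\<^sup>2 * real M powr (- 2 * s)" if M: "0 < M" for M
  proof -
    \<comment> \<open>Square integrability of \<open>u\<close> is a consequence here:
      \<open>u\<close> is a finite trigonometric sum plus a square integrable remainder. The slack
      \<open>t\<close> disappears at the end.\<close>
    have *: "integrable (cubeM d) (\<lambda>x. (u x)\<^sup>2) \<and>
      (\<integral>x. (u x)\<^sup>2 \<partial>cubeM d) \<le> 2 * (\<Sum>l\<in>freq_box d M. (\<delta> l)\<^sup>2) + 8 * r\<^sup>2 * real M powr (- 2 * s) + t" if t: "0 < t" for t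
    proof -
      from approx[of "t / 2"] t obtain F where F: "finite F" "F \<subseteq> MI d"
        "\<And>G. finite G \<Longrightarrow> F \<subseteq> G \<Longrightarrow> G \<subseteq> MI d \<Longrightarrow>
          integrable (cubeM d) (\<lambda>x. (v G x)\<^sup>2) \<and> (\<integral>x. (v G x)\<^sup>2 \<partial>cubeM d) \<le> t / 2" by auto
      let ?G = "F \<union> freq_box d M"
      have G: "finite ?G" "?G \<subseteq> MI d" using F freq_box_subset_MI by auto
      have v2: "integrable (cubeM d) (\<lambda>x. (v ?G x)\<^sup>2)" "(\<integral>x. (v ?G x)\<^sup>2 \<partial>cubeM d) \<le> t / 2"
        using F(3)[of ?G] G by auto
      let ?S = "\<lambda>x. \<Sum>k\<in>?G. \<delta> k * trig d k x"
      have iS: "integrable (cubeM d) (\<lambda>x. (?S x)\<^sup>2)"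
      proof -
        have "\<bar>?S x\<bar> \<le> (\<Sum>k\<in>?G. \<bar>\<delta> k\<bar> * sqrt 2 ^ d)" for x
          by (rule order_trans[OF sum_abs sum_mono]) (simp add: abs_mult mult_left_mono trig_bound)
        hence "norm ((?S x)\<^sup>2) \<le> (\<Sum>k\<in>?G. \<bar>\<delta> k\<bar> * sqrt 2 ^ d)\<^sup>2" for x
          by (metis (no_types, lifting) abs_ge_zero norm_power power_mono real_norm_def)
        thus ?thesis by (intro integrable_const_bound) auto
      qed
      have pw: "(u x)\<^sup>2 \<le> 2 * (v ?G x)\<^sup>2 + 2 * (?S x)\<^sup>2" for x
      proof -
        have "u x = v ?G x + ?S x" by (simp only: v_def diff_add_cancel)
        moreover have "(a + b)\<^sup>2 \<le> 2 * a\<^sup>2 + 2 * b\<^sup>2" for a b :: real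
          using zero_le_power2[of "a - b"] by (simp add: power2_diff power2_sum)
        ultimately show ?thesis by metis
      qed
      have iu2: "integrable (cubeM d) (\<lambda>x. (u x)\<^sup>2)"
      proof (rule Bochner_Integration.integrable_bound)
        show "integrable (cubeM d) (\<lambda>x. 2 * (v ?G x)\<^sup>2 + 2 * (?S x)\<^sup>2)"
          by (intro Bochner_Integration.integrable_add integrable_mult_right v2 iS)
        show "AE x in cubeM d. norm ((u x)\<^sup>2) \<le> norm (2 * (v ?G x)\<^sup>2 + 2 * (?S x)\<^sup>2)"
          using order_trans[OF pw abs_ge_self] by (intro AE_I2) (simp only: real_norm_def abs_power2)
      qed simp
      have "(\<integral>x. (u x)\<^sup>2 \<partial>cubeM d) \<le> (\<integral>x. 2 * (v ?G x)\<^sup>2 + 2 * (?S x)\<^sup>2 \<partial>cubeM d)"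
        by (intro integral_mono iu2 pw Bochner_Integration.integrable_add integrable_mult_right v2 iS)
      also have "\<dots> = 2 * (\<integral>x. (v ?G x)\<^sup>2 \<partial>cubeM d) + 2 * (\<integral>x. (?S x)\<^sup>2 \<partial>cubeM d)"
        by (subst Bochner_Integration.integral_add) (auto intro: v2 iS)
      also have "(\<integral>x. (?S x)\<^sup>2 \<partial>cubeM d) = (\<Sum>l\<in>?G. (\<delta> l)\<^sup>2)"
        by (rule sum_trig_sq(1)[OF G])
      also have "2 * (\<integral>x. (v ?G x)\<^sup>2 \<partial>cubeM d) + 2 * (\<Sum>l\<in>?G. (\<delta> l)\<^sup>2) \<le>
          2 * (t / 2) + 2 * ((\<Sum>l\<in>freq_box d M. (\<delta> l)\<^sup>2) + 4 * r\<^sup>2 * real M powr (- 2 * s))"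
        by (intro add_mono mult_left_mono v2 tail G M) auto
      finally show ?thesis using iu2 by (simp add: algebra_simps)
    qed
    show ?thesis
    proof
      show "integrable (cubeM d) (\<lambda>x. (u x)\<^sup>2)" using *[of 1] by simp
      show "(\<integral>x. (u x)\<^sup>2 \<partial>cubeM d) \<le> 2 * (\<Sum>l\<in>freq_box d M. (\<delta> l)\<^sup>2) + 8 * r\<^sup>2 * real M powr (- 2 * s)"
        by (rule field_le_epsilon) (rule conjunct2[OF *])
    qed
  qed
  show ?thesis
  proof (rule that[of \<delta>])
    fix l assume l: "l \<in> MI d"
    have "(\<integral>x. trig d l x \<partial>dens d fX) - (\<integral>x. trig d l x \<partial>dens d fY) =
        (\<integral>x. uX x * trig d l x \<partial>cubeM d) - (\<integral>x. uY x * trig d l x \<partial>cubeM d)"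
      unfolding uX_def uY_def by (simp only: integral_dens[OF dX trig_measurable] integral_dens[OF dY trig_measurable])
    also have "\<dots> = (\<integral>x. uX x * trig d l x - uY x * trig d l x \<partial>cubeM d)"
      by (intro Bochner_Integration.integral_diff[symmetric] tb iX iY)
    also have "\<dots> = (\<integral>x. u x * trig d l x \<partial>cubeM d)" by (simp add: u_def left_diff_distrib)
    also have "\<dots> = \<delta> l" by (rule coeff[OF l])
    finally show "(\<integral>x. trig d l x \<partial>dens d fX) - (\<integral>x. trig d l x \<partial>dens d fY) = \<delta> l" .
  next
    show "\<delta> (MI0 d) = 0" using tX tY by (simp add: \<delta>_def)
  next
    fix M :: nat and p :: real assume M: "0 < M" and p: "1 \<le> p" "p \<le> 2"
    let ?B = "2 * (\<Sum>l\<in>freq_box d M. (\<delta> l)\<^sup>2) + 8 * r\<^sup>2 * real M powr (- 2 * s)"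
    have B: "0 < ?B" using r M by (intro add_nonneg_pos) (auto intro: sum_nonneg)
    have "(\<integral>x. indicator (cube d) x * \<bar>fX x - fY x\<bar> powr p \<partial>lebd d) =
        (\<integral>x. indicator (cube d) x * \<bar>u x\<bar> powr p \<partial>lebd d)"
      by (intro Bochner_Integration.integral_cong refl) (auto simp: u_def uX_def uY_def indicator_def)
    also have "\<dots> = (\<integral>x. \<bar>u x\<bar> powr p \<partial>cubeM d)"
      by (rule integral_cubeM[symmetric]) measurable
    finally have "Lp_dist d p fX fY \<le> sqrt ?B"
      unfolding Lp_dist_def using integral_powr_le[of u p ?B] L2[OF M] p B by simp
    hence "(Lp_dist d p fX fY)\<^sup>2 \<le> (sqrt ?B)\<^sup>2"
      by (intro power_mono) (auto simp: Lp_dist_def)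
    thus "(Lp_dist d p fX fY)\<^sup>2 \<le> ?B" using B by simp
  qed
qed

section \<open>Random signs\<close>

text \<open>Induction over \<open>L\<close>, splitting off one sign. Terms with an odd power of it
  vanish by flipping, and the new fourth moment bound \<open>a^4 + 6 * a^2 * s2 + 3 * s2^2\<close>
  is at most \<open>3 * (a^2 + s2)^2\<close>. The map \<open>E\<close> says which bit of the coin
  serves as the sign of \<open>l\<close>.\<close>

lemma rademacher_moments:
  fixes a :: "'l \<Rightarrow> real"
  assumes "finite L" "inj_on E L" "E ` L \<subseteq> {..<K}"
  shows "(\<Sum>w\<in>signs K. (\<Sum>l\<in>L. a l * w (E l))\<^sup>2) = 2 ^ K * (\<Sum>l\<in>L. (a l)\<^sup>2) \<and>
    (\<Sum>w\<in>signs K. (\<Sum>l\<in>L. a l * w (E l)) ^ 4) \<le> 3 * 2 ^ K * (\<Sum>l\<in>L. (a l)\<^sup>2)\<^sup>2"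
  using assms
proof (induction L rule: finite_induct)
  case empty
  show ?case by simp
next
  case (insert l L)
  define Y where "Y = (\<lambda>w::out. \<Sum>l\<in>L. a l * w (E l))"
  define s2 where "s2 = (\<Sum>l\<in>L. (a l)\<^sup>2)"
  let ?i = "E l"
  have Ei: "E k \<noteq> ?i" if "k \<in> L" for k
    using insert.prems insert.hyps that by (auto simp: inj_on_def)
  have i: "?i < K" using insert.prems by auto
  have Yf: "Y (w(?i := - w ?i)) = Y w" for w
    unfolding Y_def using Ei by (intro sum.cong refl) simp
  have IH: "(\<Sum>w\<in>signs K. (Y w)\<^sup>2) = 2 ^ K * s2" "(\<Sum>w\<in>signs K. Y w ^ 4) \<le> 3 * 2 ^ K * s2\<^sup>2"
    using insert.IH insert.prems by (auto simp: Y_def s2_def)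
  have z1: "(\<Sum>w\<in>signs K. Y w * w ?i) = 0" by (rule sum_signs_flip[OF i]) (rule Yf)
  have z3: "(\<Sum>w\<in>signs K. Y w ^ 3 * w ?i) = 0" by (rule sum_signs_flip[OF i]) (simp only: Yf)
  have sum: "(\<Sum>k\<in>insert l L. a k * w (E k)) = a l * w ?i + Y w" for w
    using insert.hyps by (simp add: Y_def)
  have sq: "(a l * w ?i + Y w)\<^sup>2 = (a l)\<^sup>2 + 2 * a l * (Y w * w ?i) + (Y w)\<^sup>2" if "w \<in> signs K" for w
  proof -
    have "(a l * w ?i + Y w)\<^sup>2 = (a l)\<^sup>2 * (w ?i * w ?i) + 2 * a l * (Y w * w ?i) + (Y w)\<^sup>2"
      by (simp add: power2_eq_square algebra_simps)
    thus ?thesis using signs_sq[OF that i] by simp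
  qed
  have q: "(a l * w ?i + Y w) ^ 4 = (a l) ^ 4 + 4 * (a l) ^ 3 * (Y w * w ?i) + 6 * (a l)\<^sup>2 * (Y w)\<^sup>2 +
      4 * a l * (Y w ^ 3 * w ?i) + Y w ^ 4" if "w \<in> signs K" for w
  proof -
    have "(a l * w ?i + Y w) ^ 4 = ((a l * w ?i + Y w)\<^sup>2)\<^sup>2" by simp
    also have "\<dots> = ((a l)\<^sup>2 + 2 * a l * (Y w * w ?i) + (Y w)\<^sup>2)\<^sup>2" unfolding sq[OF that] ..
    also have "\<dots> = (a l) ^ 4 + 4 * (a l) ^ 3 * (Y w * w ?i) + (2 * (a l)\<^sup>2 * (Y w)\<^sup>2 + 4 * (a l)\<^sup>2 * (Y w)\<^sup>2 * (w ?i * w ?i)) +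
      4 * a l * (Y w ^ 3 * w ?i) + Y w ^ 4"
      by (simp add: power2_eq_square power3_eq_cube power4_eq_xxxx algebra_simps)
    finally show ?thesis using signs_sq[OF that i] by simp
  qed
  have e2: "(\<Sum>k\<in>insert l L. (a k)\<^sup>2) = (a l)\<^sup>2 + s2" using insert.hyps by (simp add: s2_def)
  have "(\<Sum>w\<in>signs K. (a l * w ?i + Y w)\<^sup>2) = (\<Sum>w\<in>signs K. (a l)\<^sup>2 + 2 * a l * (Y w * w ?i) + (Y w)\<^sup>2)"
    by (intro sum.cong refl sq)
  also have "\<dots> = 2 ^ K * (a l)\<^sup>2 + 2 * a l * (\<Sum>w\<in>signs K. Y w * w ?i) + (\<Sum>w\<in>signs K. (Y w)\<^sup>2)"
    by (simp add: sum.distrib sum_distrib_left card_signs)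
  finally have m2: "(\<Sum>w\<in>signs K. (a l * w ?i + Y w)\<^sup>2) = 2 ^ K * ((a l)\<^sup>2 + s2)"
    by (simp add: z1 IH algebra_simps)
  have "(\<Sum>w\<in>signs K. (a l * w ?i + Y w) ^ 4) = (\<Sum>w\<in>signs K. (a l) ^ 4 + 4 * (a l) ^ 3 * (Y w * w ?i) +
      6 * (a l)\<^sup>2 * (Y w)\<^sup>2 + 4 * a l * (Y w ^ 3 * w ?i) + Y w ^ 4)"
    by (intro sum.cong refl q)
  also have "\<dots> = 2 ^ K * (a l) ^ 4 + 4 * (a l) ^ 3 * (\<Sum>w\<in>signs K. Y w * w ?i) +
      6 * (a l)\<^sup>2 * (\<Sum>w\<in>signs K. (Y w)\<^sup>2) + 4 * a l * (\<Sum>w\<in>signs K. Y w ^ 3 * w ?i) + (\<Sum>w\<in>signs K. Y w ^ 4)"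
    by (simp add: sum.distrib sum_distrib_left card_signs)
  also have "\<dots> \<le> 2 ^ K * (a l) ^ 4 + 6 * (a l)\<^sup>2 * (2 ^ K * s2) + 3 * 2 ^ K * s2\<^sup>2"
    using IH by (simp add: z1 z3)
  also have "\<dots> = 3 * 2 ^ K * ((a l)\<^sup>2 + s2)\<^sup>2 - 2 * 2 ^ K * (a l) ^ 4"
    by (simp add: power2_eq_square power4_eq_xxxx algebra_simps)
  also have "\<dots> \<le> 3 * 2 ^ K * ((a l)\<^sup>2 + s2)\<^sup>2" by simp
  finally have m4: "(\<Sum>w\<in>signs K. (a l * w ?i + Y w) ^ 4) \<le> 3 * 2 ^ K * ((a l)\<^sup>2 + s2)\<^sup>2" .
  show ?case unfolding sum e2 using m2 m4 by simp
qed

text \<open>The Paley-Zygmund argument as one pointwise bound of \<open>X^2\<close> by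
  \<open>s2 / 4 + X^4 / (8 * s2)\<close> plus \<open>2 * s2\<close> on the event. Averaging with the
  fourth moment bound gives \<open>1 \<le> 1/4 + 3/8 + 2 * P\<close>, hence the share
  \<open>3/16\<close>.\<close>

lemma rademacher_anticoncentration:
  fixes a :: "'l \<Rightarrow> real"
  assumes L: "finite L" "inj_on E L" "E ` L \<subseteq> {..<K}" and pos: "0 < (\<Sum>l\<in>L. (a l)\<^sup>2)"
  shows "3/16 * 2 ^ K \<le> real (card {w \<in> signs K. (\<Sum>l\<in>L. (a l)\<^sup>2) / 4 \<le> (\<Sum>l\<in>L. a l * w (E l))\<^sup>2})"
proof -
  define X where "X = (\<lambda>w::out. \<Sum>l\<in>L. a l * w (E l))"
  define s2 where "s2 = (\<Sum>l\<in>L. (a l)\<^sup>2)"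
  let ?A = "{w \<in> signs K. s2 / 4 \<le> (X w)\<^sup>2}"
  have s2: "0 < s2" using pos by (simp add: s2_def)
  have m: "(\<Sum>w\<in>signs K. (X w)\<^sup>2) = 2 ^ K * s2" "(\<Sum>w\<in>signs K. X w ^ 4) \<le> 3 * 2 ^ K * s2\<^sup>2"
    using rademacher_moments[OF L, of a] by (auto simp: X_def s2_def)
  have pw: "(X w)\<^sup>2 \<le> s2 / 4 + X w ^ 4 / (8 * s2) + 2 * s2 * of_bool (w \<in> ?A)" if "w \<in> signs K" for w
  proof (cases "w \<in> ?A")
    case True
    have "0 \<le> ((X w)\<^sup>2 - 4 * s2)\<^sup>2" by simp
    hence "8 * s2 * (X w)\<^sup>2 \<le> X w ^ 4 + 16 * s2\<^sup>2"
      by (simp add: power2_diff power_mult_distrib mult_ac)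
    hence "(X w)\<^sup>2 \<le> X w ^ 4 / (8 * s2) + 2 * s2"
      using s2 by (simp add: field_simps power2_eq_square)
    thus ?thesis using True s2 by simp
  next
    case False
    hence "(X w)\<^sup>2 \<le> s2 / 4" using that by simp
    moreover have "0 \<le> X w ^ 4 / (8 * s2)" using s2 by simp
    ultimately show ?thesis using False by simp
  qed
  have "2 ^ K * s2 \<le> (\<Sum>w\<in>signs K. s2 / 4 + X w ^ 4 / (8 * s2) + 2 * s2 * of_bool (w \<in> ?A))"
    unfolding m(1)[symmetric] by (intro sum_mono pw)
  also have "\<dots> = 2 ^ K * (s2 / 4) + (\<Sum>w\<in>signs K. X w ^ 4) / (8 * s2) + 2 * s2 * (\<Sum>w\<in>signs K. of_bool (w \<in> ?A))"
    by (simp add: sum.distrib sum_distrib_left sum_divide_distrib card_signs)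
  also have "(\<Sum>w\<in>signs K. of_bool (w \<in> ?A)) = real (card ?A)"
    by (simp add: sum_of_bool_eq Int_def conj_commute)
  also have "(\<Sum>w\<in>signs K. X w ^ 4) / (8 * s2) \<le> 3 * 2 ^ K * s2\<^sup>2 / (8 * s2)"
    using s2 m by (intro divide_right_mono) auto
  also have "3 * 2 ^ K * s2\<^sup>2 / (8 * s2) = 3/8 * 2 ^ K * s2" using s2 by (simp add: power2_eq_square)
  finally have "s2 * (3/8 * 2 ^ K) \<le> s2 * (2 * real (card ?A))" by (simp add: algebra_simps)
  hence "3/8 * 2 ^ K \<le> 2 * real (card ?A)" using s2 by (simp only: mult_le_cancel_left_pos)
  thus ?thesis by (simp add: X_def s2_def)
qed

lemma signs_nonempty: "signs K \<noteq> {}"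
  using card_signs[of K] by auto

lemma pmf_signs: "pmf_of_set (signs K) = Pi_pmf {..<K} undefined (\<lambda>_. pmf_of_set {-1, 1})"
proof -
  have "PiE_dflt {..<K} undefined (\<lambda>_. {-1, 1}) = signs K"
    by (auto simp: signs_def PiE_dflt_def PiE_iff extensional_def)
  thus ?thesis by (subst Pi_pmf_of_set) auto
qed

lemma prob_signs: "measure_pmf.prob (pmf_of_set (signs K)) {w. Q w} = real (card {w \<in> signs K. Q w}) / 2 ^ K"
  by (simp add: measure_pmf_of_set signs_nonempty card_signs Int_def)

lemma expectation_signs:
  fixes f :: "out \<Rightarrow> real"
  shows "measure_pmf.expectation (pmf_of_set (signs K)) f = (\<Sum>w\<in>signs K. f w) / 2 ^ K"
  by (simp add: integral_pmf_of_set signs_nonempty card_signs)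

text \<open>Nothing is known about \<open>F v\<close> away from \<open>signs K\<close>. Decoding the
  sign bits yields a version \<open>G v\<close> that agrees with it there and is a function of
  finitely many bits, hence measurable on a discrete product.\<close>

lemma indep_signs:
  fixes F :: "'v \<Rightarrow> out \<Rightarrow> real"
  assumes sub: "\<And>v. v \<in> V \<Longrightarrow> W v \<subseteq> {..<K}" and dis: "disjoint_family_on W V"
    and dep: "\<And>v w w'. v \<in> V \<Longrightarrow> w \<in> signs K \<Longrightarrow> w' \<in> signs K \<Longrightarrow> (\<And>i. i \<in> W v \<Longrightarrow> w i = w' i) \<Longrightarrow> F v w = F v w'"
  obtains G where "prob_space.indep_vars (measure_pmf (pmf_of_set (signs K))) (\<lambda>_. borel) G V"
    "\<And>v w. v \<in> V \<Longrightarrow> w \<in> signs K \<Longrightarrow> G v w = F v w"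
proof -
  define dec :: "(nat \<Rightarrow> bool) \<Rightarrow> out" where "dec = (\<lambda>b i. if i < K then (if b i then 1 else -1) else undefined)"
  have dec: "dec b \<in> signs K" for b
    by (auto simp: dec_def signs_def PiE_iff extensional_def)
  define G where "G = (\<lambda>v (w::out). F v (dec (restrict (\<lambda>i. w i = 1) (W v))))"
  have ind: "prob_space.indep_vars (measure_pmf (pmf_of_set (signs K))) (\<lambda>_. count_space UNIV) (\<lambda>i w. w i = 1) {..<K}"
    unfolding pmf_signs
    by (rule prob_space.indep_vars_compose2[OF prob_space_measure_pmf indep_vars_Pi_pmf]) auto
  have "prob_space.indep_vars (measure_pmf (pmf_of_set (signs K))) (\<lambda>_. borel) G V"
    unfolding G_def
  proof (rule pmf_indep_vars_compose2[OF pmf_indep_vars_restrict[OF ind sub dis]])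
    fix v assume v: "v \<in> V"
    have "finite (W v)" using sub[OF v] finite_subset by blast
    hence "PiM (W v) (\<lambda>_. count_space (UNIV :: bool set)) = count_space (PiE (W v) (\<lambda>_. UNIV))"
      by (intro count_space_PiM_finite) auto
    thus "(\<lambda>b. F v (dec b)) \<in> borel_measurable (PiM (W v) (\<lambda>_. count_space UNIV))" by simp
  qed
  moreover have "G v w = F v w" if v: "v \<in> V" and w: "w \<in> signs K" for v w
    unfolding G_def
  proof (rule dep[OF v dec w])
    fix i assume i: "i \<in> W v"
    hence "i < K" using sub[OF v] by auto
    moreover have "w i = -1 \<or> w i = 1" by (rule signs_cases[OF w \<open>i < K\<close>])
    ultimately show "dec (restrict (\<lambda>i. w i = 1) (W v)) i = w i" using i by (auto simp: dec_def)
  qed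
  ultimately show ?thesis by (rule that)
qed

lemma AE_signs: "(\<And>w. w \<in> signs K \<Longrightarrow> Q w) \<Longrightarrow> AE w in measure_pmf (pmf_of_set (signs K)). Q w"
  by (simp add: AE_measure_pmf_iff signs_nonempty)

lemma prob_signs_cong:
  "(\<And>w. w \<in> signs K \<Longrightarrow> Q w = R w) \<Longrightarrow>
   measure_pmf.prob (pmf_of_set (signs K)) {w. Q w} = measure_pmf.prob (pmf_of_set (signs K)) {w. R w}"
  unfolding prob_signs by (metis (mono_tags, lifting) Collect_cong)

text \<open>Hoeffding's inequality for summands in \<open>[-B, B]\<close>; the squared ranges add up
  to \<open>4 * card L * B^2\<close>.\<close>

lemma rademacher_tail:
  fixes c :: "'l \<Rightarrow> real"
  assumes L: "finite L" "L \<noteq> {}" "inj_on E L" "E ` L \<subseteq> {..<K}" and c: "\<And>l. l \<in> L \<Longrightarrow> \<bar>c l\<bar> \<le> B" and B: "0 < B"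
    and t: "0 \<le> t"
  shows "real (card {w \<in> signs K. t \<le> \<bar>\<Sum>l\<in>L. c l * w (E l)\<bar>}) \<le>
    2 * exp (- t\<^sup>2 / (2 * real (card L) * B\<^sup>2)) * 2 ^ K"
proof -
  let ?P = "measure_pmf (pmf_of_set (signs K))"
  obtain G where G: "prob_space.indep_vars ?P (\<lambda>_. borel) G L"
    "\<And>l w. l \<in> L \<Longrightarrow> w \<in> signs K \<Longrightarrow> G l w = c l * w (E l)"
  proof (rule indep_signs[of L "\<lambda>l. {E l}" K "\<lambda>l w. c l * w (E l)"])
    show "disjoint_family_on (\<lambda>l. {E l}) L"
      using L by (auto simp: disjoint_family_on_def inj_on_def)
  qed (use L in auto)
  have El: "E l < K" if "l \<in> L" for l using L that by auto
  have "measure_pmf.expectation (pmf_of_set (signs K)) (G l) = 0" if l: "l \<in> L" for l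
  proof -
    have "(\<Sum>w\<in>signs K. G l w) = (\<Sum>w\<in>signs K. c l * w (E l))" by (intro sum.cong refl G l)
    also have "\<dots> = 0" by (rule sum_signs_flip[OF El[OF l]]) simp
    finally show ?thesis by (simp add: expectation_signs)
  qed
  hence mu: "(\<Sum>l\<in>L. measure_pmf.expectation (pmf_of_set (signs K)) (G l)) = 0" by simp
  interpret H: Hoeffding_ineq ?P L G "\<lambda>_. - B" "\<lambda>_. B" "\<Sum>l\<in>L. measure_pmf.expectation (pmf_of_set (signs K)) (G l)"
  proof unfold_locales
    fix l assume l: "l \<in> L"
    show "AE w in ?P. G l w \<in> {- B..B}"
    proof (rule AE_signs)
      fix w assume w: "w \<in> signs K"
      have "\<bar>G l w\<bar> \<le> B" using c[OF l] signs_abs[OF w El[OF l]] by (simp add: G(2)[OF l w] abs_mult)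
      thus "G l w \<in> {- B..B}" by auto
    qed
  qed (use L G in auto)
  have "measure_pmf.prob (pmf_of_set (signs K)) {w. t \<le> \<bar>\<Sum>l\<in>L. c l * w (E l)\<bar>} =
    measure_pmf.prob (pmf_of_set (signs K)) {w. t \<le> \<bar>\<Sum>l\<in>L. G l w\<bar>}"
    by (intro prob_signs_cong) (simp add: G(2))
  also have "\<dots> \<le> 2 * exp (-2 * t\<^sup>2 / (\<Sum>l\<in>L. (B - - B)\<^sup>2))"
    using H.Hoeffding_ineq_abs_ge[OF t] L B unfolding mu by (simp add: card_gt_0_iff)
  also have "-2 * t\<^sup>2 / (\<Sum>l\<in>L. (B - - B)\<^sup>2) = - t\<^sup>2 / (2 * real (card L) * B\<^sup>2)"
    using B L by (simp add: power2_eq_square field_simps)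
  finally show ?thesis unfolding prob_signs by (simp add: divide_le_eq)
qed

text \<open>Groups read disjoint parts of the coin, so their being good is independent. An eighth of
  them is good on average and a sixteenth is asked for; Hoeffding's inequality with the gap
  \<open>mv / 16\<close> gives the exponent \<open>mv / 128\<close>.\<close>

lemma signs_votes:
  assumes mv: "0 < mv" and sub: "\<And>v. v < mv \<Longrightarrow> W v \<subseteq> {..<K}" and dis: "disjoint_family_on W {..<mv}"
    and dep: "\<And>v w w'. v < mv \<Longrightarrow> w \<in> signs K \<Longrightarrow> w' \<in> signs K \<Longrightarrow> (\<And>i. i \<in> W v \<Longrightarrow> w i = w' i) \<Longrightarrow> good v w = good v w'"
    and p: "\<And>v. v < mv \<Longrightarrow> 1/8 * 2 ^ K \<le> real (card {w \<in> signs K. good v w})"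
  shows "real (card {w \<in> signs K. real (card {v. v < mv \<and> good v w}) < real mv / 16}) \<le> exp (- real mv / 4096) * 2 ^ K"
proof -
  let ?P = "measure_pmf (pmf_of_set (signs K))"
  obtain G where G: "prob_space.indep_vars ?P (\<lambda>_. borel) G {..<mv}"
    "\<And>v w. v \<in> {..<mv} \<Longrightarrow> w \<in> signs K \<Longrightarrow> G v w = (of_bool (good v w) :: real)"
  proof (rule indep_signs[of "{..<mv}" W K "\<lambda>v w. of_bool (good v w)"])
    show "(of_bool (good v w) :: real) = of_bool (good v w')"
      if "v \<in> {..<mv}" "w \<in> signs K" "w' \<in> signs K" "\<And>i. i \<in> W v \<Longrightarrow> w i = w' i" for v w w'
      using dep[of v w w'] that by simp
  qed (use sub dis in auto)
  let ?\<mu> = "\<Sum>v<mv. measure_pmf.expectation (pmf_of_set (signs K)) (G v)"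
  have e: "1/8 \<le> measure_pmf.expectation (pmf_of_set (signs K)) (G v)" if v: "v < mv" for v
  proof -
    have "(\<Sum>w\<in>signs K. G v w) = (\<Sum>w\<in>signs K. of_bool (good v w))" using v by (intro sum.cong refl G) auto
    also have "\<dots> = real (card {w \<in> signs K. good v w})" by (simp add: sum_of_bool_eq Int_def)
    finally show ?thesis using p[OF v] by (simp add: expectation_signs le_divide_eq)
  qed
  have mu: "real mv / 8 \<le> ?\<mu>"
    using sum_mono[of "{..<mv}" "\<lambda>_. 1/8" "\<lambda>v. measure_pmf.expectation (pmf_of_set (signs K)) (G v)"] e by simp
  interpret H: Hoeffding_ineq ?P "{..<mv}" G "\<lambda>_. 0" "\<lambda>_. 1" ?\<mu>
  proof unfold_locales
    fix v assume "v \<in> {..<mv}"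
    thus "AE w in ?P. G v w \<in> {0..1}" by (intro AE_signs) (simp add: G(2))
  qed (use G in auto)
  have "measure_pmf.prob (pmf_of_set (signs K)) {w. real (card {v. v < mv \<and> good v w}) < real mv / 16} =
    measure_pmf.prob (pmf_of_set (signs K)) {w. (\<Sum>v<mv. G v w) < real mv / 16}"
  proof (rule prob_signs_cong)
    fix w assume w: "w \<in> signs K"
    have "(\<Sum>v<mv. G v w) = (\<Sum>v<mv. of_bool (good v w))" using w by (intro sum.cong refl G) auto
    also have "\<dots> = real (card {v. v < mv \<and> good v w})" by (simp add: sum_of_bool_eq Int_def)
    finally show "real (card {v. v < mv \<and> good v w}) < real mv / 16 \<longleftrightarrow> (\<Sum>v<mv. G v w) < real mv / 16" by simp
  qed
  also have "\<dots> \<le> measure_pmf.prob (pmf_of_set (signs K)) {w \<in> space ?P. (\<Sum>v<mv. G v w) \<le> ?\<mu> - real mv / 16}"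
    using mu by (intro measure_pmf.finite_measure_mono) auto
  also have "\<dots> \<le> exp (-2 * (real mv / 16)\<^sup>2 / (\<Sum>v<mv. (1 - 0)\<^sup>2))"
    by (rule H.Hoeffding_ineq_le) (use mv in auto)
  also have "\<dots> \<le> exp (- real mv / 4096)" using mv by (simp add: power2_eq_square field_simps)
  finally show ?thesis unfolding prob_signs by (simp add: divide_le_eq)
qed

section \<open>Clipped random polynomials\<close>

definition clip :: "real \<Rightarrow> real \<Rightarrow> real" where
  "clip \<tau> y = max (- \<tau>) (min \<tau> y)"

text \<open>\<open>E\<close> assigns to each frequency its bit of the coin. At a point the typical
  size is of order \<open>sqrt (M ^ d)\<close>, against \<open>M ^ d\<close> in the worst case,
  which is why clipping before the normalisation pays.\<close>

definition coin_poly :: "nat \<Rightarrow> nat \<Rightarrow> ((nat \<Rightarrow> nat) \<Rightarrow> nat) \<Rightarrow> out \<Rightarrow> (nat \<Rightarrow> real) \<Rightarrow> real" where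
  "coin_poly d M E w x = (\<Sum>l\<in>freq_box d M. trig d l x * w (E l))"

lemma coin_poly_measurable [measurable]: "coin_poly d M E w \<in> borel_measurable (lebd d)"
  unfolding coin_poly_def[abs_def] by measurable

lemma clip_measurable [measurable]: "clip \<tau> \<in> borel_measurable borel"
  unfolding clip_def[abs_def] by measurable

lemma clip_bound: "0 \<le> \<tau> \<Longrightarrow> \<bar>clip \<tau> y\<bar> \<le> \<tau>"
  by (auto simp: clip_def)

lemma clip_diff: "0 \<le> \<tau> \<Longrightarrow> \<bar>y - clip \<tau> y\<bar> \<le> \<bar>y\<bar> * of_bool (\<tau> \<le> \<bar>y\<bar>)"
  by (auto simp: clip_def)

text \<open>The signs are independent of the data, so at every fixed point the random polynomial is
  sub-Gaussian; clipping at a logarithmic multiple of its standard deviation therefore moves its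
  integrals by less than the typical size of the signal.\<close>

lemma coin_core:
  fixes \<tau> :: real
  assumes mv: "0 < mv" and M: "0 < M" and \<tau>: "0 < \<tau>"
    and inj: "inj_on (\<lambda>(v, l). E v l) ({..<mv} \<times> freq_box d M)"
    and EK: "\<And>v l. v < mv \<Longrightarrow> l \<in> freq_box d M \<Longrightarrow> E v l < K"
    and fX: "is_density d fX" and fY: "is_density d fY"
    and \<delta>: "\<And>l. l \<in> MI d \<Longrightarrow> (\<integral>x. trig d l x \<partial>dens d fX) - (\<integral>x. trig d l x \<partial>dens d fY) = \<delta> l"
    and \<Delta>: "\<Delta> = (\<Sum>l\<in>freq_box d M. (\<delta> l)\<^sup>2)" "0 < \<Delta>"
    and small: "256 * real (M ^ d) * sqrt 2 ^ d * exp (- \<tau>\<^sup>2 / (2 * real (M ^ d) * 2 ^ d)) \<le> sqrt \<Delta>"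
  shows "real (card {w \<in> signs K. real (card {v. v < mv \<and> \<Delta> / (16 * \<tau>\<^sup>2) \<le>
      ((\<integral>x. clip \<tau> (coin_poly d M (E v) w x) / \<tau> \<partial>dens d fX) - (\<integral>x. clip \<tau> (coin_poly d M (E v) w x) / \<tau> \<partial>dens d fY))\<^sup>2}) < real mv / 16})
    \<le> exp (- real mv / 4096) * 2 ^ K"
proof (rule signs_votes[OF mv, where W = "\<lambda>v. E v ` freq_box d M"])
  let ?D = "\<lambda>v w. (\<integral>x. clip \<tau> (coin_poly d M (E v) w x) / \<tau> \<partial>dens d fX) - (\<integral>x. clip \<tau> (coin_poly d M (E v) w x) / \<tau> \<partial>dens d fY)"
  show "E v ` freq_box d M \<subseteq> {..<K}" if "v < mv" for v using EK that by auto
  show "disjoint_family_on (\<lambda>v. E v ` freq_box d M) {..<mv}"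
    unfolding disjoint_family_on_def
  proof (intro ballI impI)
    fix v v' assume v: "v \<in> {..<mv}" "v' \<in> {..<mv}" "v \<noteq> v'"
    have "E v l \<noteq> E v' l'" if "l \<in> freq_box d M" "l' \<in> freq_box d M" for l l'
      using inj_onD[OF inj, of "(v, l)" "(v', l')"] v that by auto
    thus "E v ` freq_box d M \<inter> E v' ` freq_box d M = {}" by blast
  qed
  show "(\<Delta> / (16 * \<tau>\<^sup>2) \<le> (?D v w)\<^sup>2) = (\<Delta> / (16 * \<tau>\<^sup>2) \<le> (?D v w')\<^sup>2)"
    if "\<And>i. i \<in> E v ` freq_box d M \<Longrightarrow> w i = w' i" for v w w'
  proof -
    have "coin_poly d M (E v) w = coin_poly d M (E v) w'"
      unfolding coin_poly_def using that by (auto simp: fun_eq_iff intro!: sum.cong)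
    thus ?thesis by simp
  qed
  fix v assume v: "v < mv"
  interpret X: prob_space "dens d fX" by (rule prob_space_dens[OF fX])
  interpret Y: prob_space "dens d fY" by (rule prob_space_dens[OF fY])
  define k where "k = real (M ^ d)"
  define B where "B = sqrt 2 ^ d"
  have B: "0 < B" "B\<^sup>2 = 2 ^ d" by (auto simp: B_def power_mult[symmetric] mult.commute[of d] power_mult)
  have k: "0 < k" using M by (simp add: k_def)
  have cardk: "real (card (freq_box d M)) = k" by (simp add: card_freq_box k_def)
  let ?S = "\<lambda>w x. coin_poly d M (E v) w x"
  have injv: "inj_on (E v) (freq_box d M)"
    using inj v by (auto simp: inj_on_def)
  have Ev: "E v ` freq_box d M \<subseteq> {..<K}" using EK v by auto
  have Sb: "\<bar>?S w x\<bar> \<le> k * B" if w: "w \<in> signs K" for w x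
  proof -
    have "\<bar>?S w x\<bar> \<le> (\<Sum>l\<in>freq_box d M. \<bar>trig d l x * w (E v l)\<bar>)"
      unfolding coin_poly_def by (rule sum_abs)
    also have "\<dots> \<le> (\<Sum>l\<in>freq_box d M. B)"
    proof (rule sum_mono)
      fix l assume "l \<in> freq_box d M"
      hence "\<bar>w (E v l)\<bar> = 1" using EK v by (intro signs_abs[OF w])
      thus "\<bar>trig d l x * w (E v l)\<bar> \<le> B" using trig_bound[of d l x] by (simp add: abs_mult B_def)
    qed
    also have "\<dots> = k * B" by (simp add: cardk)
    finally show ?thesis .
  qed
  define q where "q = 2 * exp (- \<tau>\<^sup>2 / (2 * k * 2 ^ d))"
  define er where "er = (\<lambda>w x. \<bar>?S w x - clip \<tau> (?S w x)\<bar>)"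
  \<comment> \<open>At a fixed point only the coin is random: clipping changes the value by at most
    \<open>k * B\<close>, and only on the sub-Gaussian tail event.\<close>
  have er_sum: "(\<Sum>w\<in>signs K. er w x) \<le> k * B * q * 2 ^ K" for x
  proof -
    have "freq_box d M \<noteq> {}" using k cardk by auto
    have "(\<Sum>w\<in>signs K. er w x) \<le> (\<Sum>w\<in>signs K. k * B * of_bool (\<tau> \<le> \<bar>?S w x\<bar>))"
    proof (rule sum_mono)
      fix w assume w: "w \<in> signs K"
      have "er w x \<le> \<bar>?S w x\<bar> * of_bool (\<tau> \<le> \<bar>?S w x\<bar>)" unfolding er_def using \<tau> by (intro clip_diff) simp
      also have "\<dots> \<le> k * B * of_bool (\<tau> \<le> \<bar>?S w x\<bar>)" by (intro mult_right_mono Sb w) auto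
      finally show "er w x \<le> k * B * of_bool (\<tau> \<le> \<bar>?S w x\<bar>)" .
    qed
    also have "\<dots> = k * B * real (card {w \<in> signs K. \<tau> \<le> \<bar>?S w x\<bar>})"
      by (simp add: sum_distrib_left[symmetric] sum_of_bool_eq Int_def)
    also have "\<dots> \<le> k * B * (2 * exp (- \<tau>\<^sup>2 / (2 * real (card (freq_box d M)) * B\<^sup>2)) * 2 ^ K)"
      unfolding coin_poly_def using k B \<tau> \<open>freq_box d M \<noteq> {}\<close>
      by (intro mult_left_mono rademacher_tail injv Ev) (auto simp: trig_bound B_def)
    finally show ?thesis by (simp add: q_def cardk B mult.assoc)
  qed
  have er_m [measurable]: "er w \<in> borel_measurable (lebd d)" for w unfolding er_def by measurable
  have er_b: "\<bar>er w x\<bar> \<le> k * B + \<tau>" if "w \<in> signs K" for w x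
    using Sb[OF that, of x] clip_bound[of \<tau> "?S w x"] \<tau> unfolding er_def by linarith
  define err where "err = (\<lambda>w. (\<integral>x. er w x \<partial>dens d fX) + (\<integral>x. er w x \<partial>dens d fY))"
  have int_er: "integrable (dens d f) (er w)" if "is_density d f" "w \<in> signs K" for f w
  proof -
    interpret prob_space "dens d f" by (rule prob_space_dens[OF that(1)])
    show ?thesis by (rule integrable_const_bound[of _ "k * B + \<tau>"]) (use er_b[OF that(2)] in auto)
  qed
  \<comment> \<open>Coin and data are independent, so the sum over coins can be moved inside the
    integral, where the bound at a fixed point applies.\<close>
  have half: "(\<Sum>w\<in>signs K. \<integral>x. er w x \<partial>dens d f) \<le> k * B * q * 2 ^ K" if f: "is_density d f" for f
  proof -
    interpret prob_space "dens d f" by (rule prob_space_dens[OF f])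
    have "(\<Sum>w\<in>signs K. \<integral>x. er w x \<partial>dens d f) = (\<integral>x. (\<Sum>w\<in>signs K. er w x) \<partial>dens d f)"
      by (rule Bochner_Integration.integral_sum[symmetric]) (rule int_er[OF f])
    also have "\<dots> \<le> k * B * q * 2 ^ K"
      by (rule integral_le_const) (use int_er[OF f] er_sum in auto)
    finally show ?thesis .
  qed
  have err_sum: "(\<Sum>w\<in>signs K. err w) \<le> 2 * k * B * q * 2 ^ K"
    using half[OF fX] half[OF fY] by (simp add: err_def sum.distrib)
  have err_nn: "0 \<le> err w" for w
    unfolding err_def by (intro add_nonneg_nonneg integral_nonneg_AE) (auto simp: er_def)
  let ?A = "{w \<in> signs K. \<Delta> / 4 \<le> (\<Sum>l\<in>freq_box d M. \<delta> l * w (E v l))\<^sup>2}"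
  let ?Bd = "{w \<in> signs K. sqrt \<Delta> / 4 < err w}"
  let ?good = "{w \<in> signs K. \<Delta> / (16 * \<tau>\<^sup>2) \<le> (?D v w)\<^sup>2}"
  have sD: "0 < sqrt \<Delta>" using \<Delta> by simp
  have cA: "3/16 * 2 ^ K \<le> real (card ?A)"
    using rademacher_anticoncentration[OF finite_freq_box injv Ev, of \<delta>] \<Delta> by simp
  \<comment> \<open>Markov's inequality. By \<open>small\<close> the average of \<open>err\<close>
    over the coins is at most \<open>sqrt \<Delta> / 64\<close>, which is one sixteenth of the level
    \<open>sqrt \<Delta> / 4\<close>.\<close>
  have cB: "real (card ?Bd) \<le> 1/16 * 2 ^ K"
  proof -
    have "real (card ?Bd) * (sqrt \<Delta> / 4) = (\<Sum>w\<in>?Bd. sqrt \<Delta> / 4)" by simp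
    also have "\<dots> \<le> (\<Sum>w\<in>?Bd. err w)" by (intro sum_mono) auto
    also have "\<dots> \<le> (\<Sum>w\<in>signs K. err w)" by (intro sum_mono2) (auto simp: err_nn)
    also have "\<dots> \<le> 2 * k * B * q * 2 ^ K" by (rule err_sum)
    also have "\<dots> = (256 * k * B * exp (- \<tau>\<^sup>2 / (2 * k * 2 ^ d))) * 2 ^ K / 64" by (simp add: q_def)
    also have "\<dots> \<le> sqrt \<Delta> * 2 ^ K / 64"
      using small by (intro divide_right_mono mult_right_mono) (auto simp: k_def B_def)
    finally have "sqrt \<Delta> * real (card ?Bd) \<le> sqrt \<Delta> * (1/16 * 2 ^ K)" by (simp add: mult_ac)
    thus ?thesis using sD by (simp only: mult_le_cancel_left_pos)
  qed
  \<comment> \<open>The unclipped inner product is at least \<open>sqrt \<Delta> / 2\<close> in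
    absolute value and clipping takes away at most half of it. The share of such coins is at least
    \<open>3/16 - 1/16 = 1/8\<close>, as \<open>signs_votes\<close> asks.\<close>
  have sub: "?A - ?Bd \<subseteq> ?good"
  proof
    fix w assume "w \<in> ?A - ?Bd"
    hence w: "w \<in> signs K" and Aw: "\<Delta> / 4 \<le> (\<Sum>l\<in>freq_box d M. \<delta> l * w (E v l))\<^sup>2" and ew: "err w \<le> sqrt \<Delta> / 4" by auto
    let ?C = "\<lambda>x. clip \<tau> (?S w x)"
    have ti: "integrable (dens d f) (trig d l)" and ci: "integrable (dens d f) ?C"
      if "is_density d f" for f l
    proof -
      interpret prob_space "dens d f" by (rule prob_space_dens[OF that])
      show "integrable (dens d f) (trig d l)"
        by (rule integrable_const_bound[of _ "sqrt 2 ^ d"]) (use trig_bound in auto)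
      show "integrable (dens d f) ?C"
        by (rule integrable_const_bound[of _ \<tau>]) (use clip_bound \<tau> in auto)
    qed
    have si: "integrable (dens d f) (?S w)" and sv: "(\<integral>x. ?S w x \<partial>dens d f) = (\<Sum>l\<in>freq_box d M. (\<integral>x. trig d l x \<partial>dens d f) * w (E v l))"
      if "is_density d f" for f
      unfolding coin_poly_def[abs_def] using ti[OF that] by (auto simp: Bochner_Integration.integral_sum)
    have close: "\<bar>(\<integral>x. ?S w x \<partial>dens d f) - (\<integral>x. ?C x \<partial>dens d f)\<bar> \<le> (\<integral>x. er w x \<partial>dens d f)" if "is_density d f" for f
    proof -
      have "(\<integral>x. ?S w x \<partial>dens d f) - (\<integral>x. ?C x \<partial>dens d f) = (\<integral>x. ?S w x - ?C x \<partial>dens d f)"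
        by (rule Bochner_Integration.integral_diff[symmetric, OF si[OF that] ci[OF that]])
      thus ?thesis unfolding er_def using integral_abs_bound[of "dens d f" "\<lambda>x. ?S w x - ?C x"] by simp
    qed
    have sx: "(\<integral>x. ?S w x \<partial>dens d fX) - (\<integral>x. ?S w x \<partial>dens d fY) = (\<Sum>l\<in>freq_box d M. \<delta> l * w (E v l))"
      unfolding sv[OF fX] sv[OF fY] sum_subtractf[symmetric] left_diff_distrib[symmetric]
      using \<delta> freq_box_subset_MI by (intro sum.cong refl) (auto simp: subset_iff)
    have "sqrt \<Delta> / 2 \<le> \<bar>\<Sum>l\<in>freq_box d M. \<delta> l * w (E v l)\<bar>"
      using real_sqrt_le_mono[OF Aw] by (simp add: real_sqrt_divide)
    hence "sqrt \<Delta> / 4 \<le> \<bar>(\<integral>x. ?C x \<partial>dens d fX) - (\<integral>x. ?C x \<partial>dens d fY)\<bar>"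
      using close[OF fX] close[OF fY] ew sx unfolding err_def by linarith
    hence "(sqrt \<Delta> / 4)\<^sup>2 \<le> ((\<integral>x. ?C x \<partial>dens d fX) - (\<integral>x. ?C x \<partial>dens d fY))\<^sup>2"
      using sD by (metis (no_types, lifting) abs_le_square_iff abs_of_nonneg divide_nonneg_nonneg less_imp_le zero_le_numeral)
    hence "\<Delta> / 16 \<le> ((\<integral>x. ?C x \<partial>dens d fX) - (\<integral>x. ?C x \<partial>dens d fY))\<^sup>2"
      using \<Delta> by (simp add: power_divide)
    moreover have "?D v w = ((\<integral>x. ?C x \<partial>dens d fX) - (\<integral>x. ?C x \<partial>dens d fY)) / \<tau>"
      by (simp add: diff_divide_distrib)
    ultimately have "\<Delta> / (16 * \<tau>\<^sup>2) \<le> (?D v w)\<^sup>2"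
      using \<tau> by (simp add: power_divide field_simps)
    thus "w \<in> ?good" using w by simp
  qed
  have "real (card ?A) - real (card ?Bd) \<le> real (card (?A - ?Bd))"
  proof -
    have "card ?A - card ?Bd \<le> card (?A - ?Bd)" by (rule diff_card_le_card_Diff) simp
    thus ?thesis by linarith
  qed
  also have "\<dots> \<le> real (card ?good)" using sub by (intro of_nat_mono card_mono) auto
  finally show "1/8 * 2 ^ K \<le> real (card ?good)" using cA cB by linarith
qed

section \<open>Scales and rates\<close>

lemma ln_2_ge_half: "1/2 \<le> ln (2 :: real)"
proof -
  have "(exp (1/2 :: real))\<^sup>2 = exp 1" by (simp add: power2_eq_square exp_add[symmetric])
  also have "\<dots> \<le> 2\<^sup>2" using exp_le by simp
  finally have "exp (1/2) \<le> (2 :: real)" by (rule power2_le_imp_le) simp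
  thus ?thesis by (subst ln_ge_iff) auto
qed

text \<open>The real cutoff \<open>Q\<close> solves \<open>Q powr (- 2 * s) = Q powr e * z\<close>.
  Rounding it up to a power of two does not increase the bias and increases the noise by at most
  \<open>2 powr e\<close>. Because \<open>2 * s + e \<ge> 1\<close>, the cutoff is at most
  \<open>1 / z \<le> N\<close>, so the scale is among those tested for every
  \<open>s\<close>.\<close>

lemma dyadic_scale_exists:
  fixes z s e N :: real
  assumes z: "0 < z" "z \<le> 1" "1 / z \<le> N" and s: "0 < s" and e: "1 \<le> e"
  obtains j :: nat where "j < nat \<lceil>log 2 N\<rceil> + 1"
    "real (2 ^ j) powr (- 2 * s) \<le> z powr (2 * s / (2 * s + e))"
    "real (2 ^ j) powr e * z \<le> 2 powr e * z powr (2 * s / (2 * s + e))"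
proof -
  \<comment> \<open>the frequency cutoff at which squared bias and noise balance\<close>
  define Q where "Q = z powr (- 1 / (2 * s + e))"
  have se: "1 \<le> 2 * s + e" using s e by simp
  have Q0: "0 < Q" using z by (simp add: Q_def)
  have Qi: "Q = (1 / z) powr (1 / (2 * s + e))"
    using z by (simp add: Q_def powr_divide powr_minus_divide)
  have Q1: "1 \<le> Q" unfolding Qi using z se by (intro ge_one_powr_ge_zero) auto
  have "Q \<le> (1 / z) powr 1" unfolding Qi using z se by (intro powr_mono) auto
  hence QN: "Q \<le> N" using z by simp
  define j where "j = nat \<lceil>log 2 Q\<rceil>"
  have l0: "0 \<le> log 2 Q" using Q1 by simp
  have j1: "log 2 Q \<le> real j" unfolding j_def using l0 by linarith
  have j2: "real j < log 2 Q + 1" unfolding j_def using l0 by linarith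
  have p: "real (2 ^ j) = 2 powr real j" by (simp add: powr_realpow)
  have "2 powr log 2 Q \<le> 2 powr real j" using j1 by simp
  hence Mlo: "Q \<le> real (2 ^ j)" using Q0 p by simp
  have "2 powr real j \<le> 2 powr (log 2 Q + 1)" using j2 by simp
  hence Mhi: "real (2 ^ j) \<le> 2 * Q" using Q0 p by (simp add: powr_add)
  show ?thesis
  proof (rule that[of j])
    have "log 2 Q \<le> log 2 N" using Q0 QN by simp
    hence "nat \<lceil>log 2 Q\<rceil> \<le> nat \<lceil>log 2 N\<rceil>" by (intro nat_mono ceiling_mono)
    thus "j < nat \<lceil>log 2 N\<rceil> + 1" unfolding j_def by linarith
    have "real (2 ^ j) powr (- 2 * s) \<le> Q powr (- 2 * s)"
      using Mlo Q0 s by (intro powr_mono2') auto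
    also have "\<dots> = z powr (2 * s / (2 * s + e))" by (simp add: Q_def powr_powr)
    finally show "real (2 ^ j) powr (- 2 * s) \<le> z powr (2 * s / (2 * s + e))" .
    have "real (2 ^ j) powr e * z \<le> (2 * Q) powr e * z"
      using Mhi e z by (intro mult_right_mono powr_mono2) auto
    also have "\<dots> = 2 powr e * (z powr (- e / (2 * s + e)) * z powr 1)"
      using Q0 z by (simp add: powr_mult Q_def powr_powr)
    also have "\<dots> = 2 powr e * z powr (- e / (2 * s + e) + 1)" by (simp only: powr_add)
    also have "- e / (2 * s + e) + 1 = 2 * s / (2 * s + e)" using se by (simp add: field_simps)
    finally show "real (2 ^ j) powr e * z \<le> 2 powr e * z powr (2 * s / (2 * s + e))" .
  qed
qed

text \<open>256 is the signal needed in \<open>votes_alt\<close>, 8 * 32772 comes from \<open>users_lower\<close>, and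
  5184 = 36 * 16 * 9 collects the losses from randomised response, anticoncentration and clipping.\<close>

definition sep_const :: real where
  "sep_const = 2048 * 32772 * 5184"

text \<open>The three summands pay, in this order, for enough users at the chosen scale, for the
  bias, and for the signal demanded through \<open>sep_const\<close>. Here
  \<open>131088 = 4 * 32772\<close>, and \<open>e\<close> is the power of the cutoff with which the
  detectable energy grows.\<close>

definition rate_const :: "nat \<Rightarrow> real \<Rightarrow> real \<Rightarrow> real" where
  "rate_const d r e = sqrt (8 * r\<^sup>2 * (131088 * 2 powr e) + 8 * r\<^sup>2 + 2 * (sep_const * 2 ^ d * 2 powr e))"

lemma rate_const_pos: "0 < rate_const d r e"
  unfolding rate_const_def sep_const_def
  by (intro real_sqrt_gt_zero add_nonneg_pos) auto

lemma rate_const_sq: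
  "(rate_const d r e)\<^sup>2 = 8 * r\<^sup>2 * (131088 * 2 powr e) + 8 * r\<^sup>2 + 2 * (sep_const * 2 ^ d * 2 powr e)"
  unfolding rate_const_def by (rule real_sqrt_pow2) (auto simp: sep_const_def intro!: add_nonneg_nonneg)

text \<open>Squared distances in the class never exceed \<open>8 * r^2\<close>. Together with the
  first summand of \<open>rate_const\<close> the separation therefore forces the rate, and with it
  \<open>A / N\<close>, to be small; this supplies the user counts. At the balanced scale the bias
  is then subtracted, and what remains is low-frequency energy.\<close>

lemma separated_scale:
  fixes A N e :: real
  assumes fX: "fX \<in> dens_class d s r" and fY: "fY \<in> dens_class d s r" and s: "0 < s" and r: "0 < r"
    and p: "1 \<le> p" "p \<le> 2" and e: "1 \<le> e" and A: "1 \<le> A" and N: "1 \<le> N"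
    and sep: "rate_const d r e * (A / N) powr (2 * s / (4 * s + 2 * e)) \<le> Lp_dist d p fX fY"
  obtains \<delta> j where
    "\<And>l. l \<in> MI d \<Longrightarrow> (\<integral>x. trig d l x \<partial>dens d fX) - (\<integral>x. trig d l x \<partial>dens d fY) = \<delta> l"
    "j < nat \<lceil>log 2 N\<rceil> + 1" "131088 * A \<le> N"
    "131088 * (real (2 ^ j) powr e * A) \<le> N"
    "sep_const * 2 ^ d * (real (2 ^ j) powr e * A) \<le> N * (\<Sum>l\<in>freq_box d (2 ^ j). (\<delta> l)\<^sup>2)"
proof -
  obtain \<delta> where \<delta>:
    "\<And>l. l \<in> MI d \<Longrightarrow> (\<integral>x. trig d l x \<partial>dens d fX) - (\<integral>x. trig d l x \<partial>dens d fY) = \<delta> l"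
    "\<delta> (MI0 d) = 0"
    "\<And>M p. 0 < M \<Longrightarrow> 1 \<le> p \<Longrightarrow> p \<le> 2 \<Longrightarrow>
       (Lp_dist d p fX fY)\<^sup>2 \<le> 2 * (\<Sum>l\<in>freq_box d M. (\<delta> l)\<^sup>2) + 8 * r\<^sup>2 * real M powr (- 2 * s)"
    by (rule sobolev_pair[OF fX fY s r]) blast
  define z where "z = A / N"
  have z0: "0 < z" using A N by (simp add: z_def)
  define R where "R = z powr (2 * s / (2 * s + e))"
  define T where "T = (Lp_dist d p fX fY)\<^sup>2"
  define c where "c = rate_const d r e"
  have c: "0 < c" by (simp add: c_def rate_const_pos)
  have R0: "0 < R" using z0 by (simp add: R_def)
  have R2: "R = (z powr (2 * s / (4 * s + 2 * e)))\<^sup>2"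
  proof -
    have "4 * s + 2 * e = (2 * s + e) * 2" by simp
    hence "2 * s / (4 * s + 2 * e) = 2 * s / (2 * s + e) / 2" by (simp only: divide_divide_eq_left)
    hence "2 * s / (4 * s + 2 * e) + 2 * s / (4 * s + 2 * e) = 2 * s / (2 * s + e)" by (simp only: field_sum_of_halves)
    thus ?thesis unfolding R_def power2_eq_square powr_add[symmetric] by simp
  qed
  have "(c * z powr (2 * s / (4 * s + 2 * e)))\<^sup>2 \<le> T"
    unfolding T_def using sep c by (intro power_mono) (auto simp: z_def c_def)
  hence cT: "c\<^sup>2 * R \<le> T" by (simp add: R2 power_mult_distrib)
  \<comment> \<open>At cutoff one only the constant frequency is left, where both densities have the
    same coefficient; this is how the bound \<open>8 * r^2\<close> on the squared distance
    arises.\<close>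
  have "freq_box d 1 = PiE {..<d} (\<lambda>i. {MI0 d i})"
    unfolding freq_box_def by (rule PiE_cong) (simp add: MI0_def lessThan_Suc)
  also have "\<dots> = {MI0 d}" by (rule PiE_singleton) (simp add: MI0_def extensional_def)
  finally have box1: "freq_box d 1 = {MI0 d}" .
  have T8: "T \<le> 8 * r\<^sup>2"
    using \<delta>(3)[of 1 p] p unfolding box1 T_def by (simp add: \<delta>(2))
  have e2: "2 \<le> 2 powr e" using powr_mono[of 1 e 2] e by simp
  have "8 * r\<^sup>2 * (131088 * 2 powr e * R) \<le> c\<^sup>2 * R"
    using R0 unfolding c_def rate_const_sq sep_const_def by (simp add: algebra_simps)
  also have "\<dots> \<le> 8 * r\<^sup>2 * 1" using cT T8 by simp
  finally have Rs: "131088 * 2 powr e * R \<le> 1" using r by (simp add: mult_ac)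
  have R1: "R < 1"
  proof (rule ccontr)
    assume "\<not> R < 1"
    hence "131088 * 2 powr e * 1 \<le> 131088 * 2 powr e * R" by (intro mult_left_mono) auto
    thus False using Rs e2 by linarith
  qed
  have z1: "z \<le> 1"
  proof (rule ccontr)
    assume "\<not> z \<le> 1"
    hence "1 \<le> R" unfolding R_def using s e by (intro ge_one_powr_ge_zero) auto
    thus False using R1 by simp
  qed
  \<comment> \<open>The exponent is below one and \<open>z \<le> 1\<close>, so \<open>z\<close>
    inherits the smallness of \<open>R\<close>.\<close>
  have "z powr 1 \<le> z powr (2 * s / (2 * s + e))"
    using z0 z1 s e by (intro powr_mono') auto
  hence zR: "z \<le> R" using z0 by (simp add: R_def)
  have "131088 * z \<le> 131088 * 2 powr e * R"
    using mult_mono[OF _ zR, of 1 "2 powr e"] e2 z0 by simp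
  hence "131088 * z \<le> 1" using Rs by linarith
  hence A1: "131088 * A \<le> N" using N by (simp add: z_def field_simps)
  have "1 / z \<le> N" using A N by (simp add: z_def field_simps)
  then obtain j where j: "j < nat \<lceil>log 2 N\<rceil> + 1" "real (2 ^ j) powr (- 2 * s) \<le> R"
    "real (2 ^ j) powr e * z \<le> 2 powr e * R"
    using dyadic_scale_exists[OF z0 z1 _ s e] unfolding R_def by metis
  have "131088 * (real (2 ^ j) powr e * z) \<le> 1" using j(3) Rs by linarith
  hence A2: "131088 * (real (2 ^ j) powr e * A) \<le> N" using N by (simp add: z_def field_simps)
  have "c\<^sup>2 * R \<le> 2 * (\<Sum>l\<in>freq_box d (2 ^ j). (\<delta> l)\<^sup>2) + 8 * r\<^sup>2 * R"
  proof -
    have "T \<le> 2 * (\<Sum>l\<in>freq_box d (2 ^ j). (\<delta> l)\<^sup>2) + 8 * r\<^sup>2 * real (2 ^ j) powr (- 2 * s)"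
      unfolding T_def using \<delta>(3)[of "2 ^ j" p] p by simp
    also have "\<dots> \<le> 2 * (\<Sum>l\<in>freq_box d (2 ^ j). (\<delta> l)\<^sup>2) + 8 * r\<^sup>2 * R"
      using j(2) by (intro add_left_mono mult_left_mono) auto
    finally show ?thesis using cT by linarith
  qed
  moreover have "8 * r\<^sup>2 * R + 2 * (sep_const * 2 ^ d * 2 powr e * R) \<le> c\<^sup>2 * R"
    using R0 unfolding c_def rate_const_sq by (simp add: algebra_simps)
  ultimately have "sep_const * 2 ^ d * (2 powr e * R) \<le> (\<Sum>l\<in>freq_box d (2 ^ j). (\<delta> l)\<^sup>2)" by simp
  moreover have "sep_const * 2 ^ d * (real (2 ^ j) powr e * z) \<le> sep_const * 2 ^ d * (2 powr e * R)"
    using j(3) by (intro mult_left_mono) (auto simp: sep_const_def)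
  ultimately have "sep_const * 2 ^ d * (real (2 ^ j) powr e * z) \<le> (\<Sum>l\<in>freq_box d (2 ^ j). (\<delta> l)\<^sup>2)" by linarith
  hence A3: "sep_const * 2 ^ d * (real (2 ^ j) powr e * A) \<le> N * (\<Sum>l\<in>freq_box d (2 ^ j). (\<delta> l)\<^sup>2)"
    using N by (simp add: z_def field_simps)
  show ?thesis by (rule that[OF \<delta>(1) j(1) A1 A2 A3])
qed

section \<open>Numbers of scales, groups and users\<close>

locale test_params =
  fixes n1 n2 :: nat and \<epsilon> \<alpha> \<beta> :: real
  assumes n12: "1 \<le> n1" "n1 \<le> n2" and eps: "0 < \<epsilon>" "\<epsilon> \<le> 1"
    and ab: "0 < \<alpha>" "0 < \<beta>" "\<alpha> + \<beta> \<le> 1/2"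
    and big: "2 * ln (1 / (\<alpha> * \<beta>)) \<le> real n1 * \<epsilon>\<^sup>2"
begin

text \<open>The effective sample size: an answer carries a signal of order \<open>\<epsilon>\<close>
  in noise of order one.\<close>

definition N :: real where "N = real n1 * \<epsilon>\<^sup>2"
definition L0 :: real where "L0 = ln (ln N / (\<alpha> * \<beta>))"
text \<open>\<open>8192 = 2 * 4096\<close> brings the voting error below
  \<open>exp (-2 * L0)\<close>, which is \<open>(\<alpha> * \<beta> / ln N)^2\<close>. The square
  leaves room for both the union over the scales and the absolute constants.\<close>

definition mv :: nat where "mv = nat \<lceil>8192 * L0\<rceil>"
text \<open>Cutoffs up to the first power of two above \<open>N\<close> suffice for all
  \<open>s\<close>, because the balanced cutoff never exceeds \<open>N\<close>.\<close>

definition J :: nat where "J = nat \<lceil>log 2 N\<rceil> + 1"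

lemma ab_prod: "0 < \<alpha> * \<beta>" "\<alpha> * \<beta> \<le> 1/16"
proof -
  show "0 < \<alpha> * \<beta>" using ab by simp
  have "4 * (\<alpha> * \<beta>) \<le> (\<alpha> + \<beta>)\<^sup>2"
    using zero_le_power2[of "\<alpha> - \<beta>"] by (simp add: power2_diff power2_sum)
  also have "\<dots> \<le> (1/2)\<^sup>2" using ab by (intro power_mono) auto
  finally show "\<alpha> * \<beta> \<le> 1/16" by (simp add: power2_eq_square)
qed

text \<open>As \<open>\<alpha> * \<beta> \<le> 1/16\<close>, the logarithm is at least
  \<open>4 * ln 2\<close>. With the factor \<open>2\<close> in \<open>big\<close> this gives
  \<open>N \<ge> 4\<close>, hence \<open>ln N \<ge> 1\<close>, and the iterated logarithm in
  \<open>L0\<close> is positive.\<close>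

lemma ln_inv_ab: "2 \<le> ln (1 / (\<alpha> * \<beta>))"
proof -
  have "(2 :: real) \<le> 4 * ln 2" using ln_2_ge_half by simp
  also have "\<dots> = ln (2 ^ 4)" by (simp only: ln_realpow zero_less_numeral of_nat_numeral)
  also have "\<dots> \<le> ln (1 / (\<alpha> * \<beta>))" using ab_prod by (subst ln_le_cancel_iff) (auto simp: field_simps)
  finally show ?thesis .
qed

lemma N_ge: "4 \<le> N"
  using big ln_inv_ab by (simp add: N_def)

lemma N_le: "N \<le> real n1"
  unfolding N_def using eps by (simp add: mult_left_le power_le_one)

lemma ln_N: "1 \<le> ln N"
  using N_ge exp_le by (subst ln_ge_iff) auto

lemma L0_ge: "1 \<le> L0"
proof -
  have "1 / (\<alpha> * \<beta>) \<le> ln N / (\<alpha> * \<beta>)" using ln_N ab_prod by (intro divide_right_mono) auto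
  hence "ln (1 / (\<alpha> * \<beta>)) \<le> L0" unfolding L0_def using ab_prod ln_N by (subst ln_le_cancel_iff) auto
  thus ?thesis using ln_inv_ab by linarith
qed

lemma mv_bounds: "8192 * L0 \<le> real mv" "real mv \<le> 8193 * L0" "0 < mv"
proof -
  have c: "0 \<le> \<lceil>8192 * L0\<rceil>" using L0_ge by simp
  show "8192 * L0 \<le> real mv" unfolding mv_def using c by linarith
  thus "0 < mv" using L0_ge by (cases mv) auto
  show "real mv \<le> 8193 * L0" unfolding mv_def using c L0_ge by linarith
qed

lemma J_pos: "0 < J" by (simp add: J_def)

lemma J_le: "real J \<le> 4 * ln N"
proof -
  have "log 2 N \<le> 2 * ln N"
    using ln_2_ge_half ln_N mult_right_mono[of 1 "2 * ln 2" "ln N"] by (simp add: log_def field_simps)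
  moreover have "0 \<le> log 2 N" using N_ge by simp
  ultimately show ?thesis unfolding J_def using ln_N by linarith
qed

lemma J_mv: "real J * real mv \<le> 32772 * (ln N * L0)"
proof -
  have "real J * real mv \<le> (4 * ln N) * (8193 * L0)"
    using J_le mv_bounds ln_N L0_ge by (intro mult_mono) auto
  thus ?thesis by simp
qed

lemma exp_mv: "exp (- real mv / 4096) \<le> (\<alpha> * \<beta> / ln N)\<^sup>2"
proof -
  have q: "0 < ln N / (\<alpha> * \<beta>)" using ln_N ab_prod by (intro divide_pos_pos) auto
  have "exp (- real mv / 4096) \<le> exp (- L0 + - L0)" using mv_bounds by simp
  also have "\<dots> = (inverse (exp L0))\<^sup>2" by (simp only: exp_add exp_minus power2_eq_square)
  also have "exp L0 = ln N / (\<alpha> * \<beta>)" unfolding L0_def using q by (rule exp_ln)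
  finally show ?thesis by simp
qed

lemma exp_mv': "exp (- real mv / 4096) \<le> (\<alpha> * \<beta>)\<^sup>2"
proof -
  have "\<alpha> * \<beta> / ln N \<le> \<alpha> * \<beta>" using ln_N ab_prod by (simp add: divide_le_eq mult_le_cancel_left1)
  hence "(\<alpha> * \<beta> / ln N)\<^sup>2 \<le> (\<alpha> * \<beta>)\<^sup>2" using ln_N ab_prod by (intro power_mono) auto
  thus ?thesis using exp_mv by linarith
qed

text \<open>A union over at most \<open>4 * ln N\<close> scales: the squared error bound cancels the
  factor \<open>ln N\<close>, and \<open>\<alpha> * \<beta> \<le> 1/16\<close> absorbs the
  \<open>4\<close>.\<close>

lemma null_level: "real J * exp (- real mv / 4096) \<le> \<alpha>"
proof -
  have lN: "0 < ln N" using ln_N by linarith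
  have "real J * exp (- real mv / 4096) \<le> (4 * ln N) * (\<alpha> * \<beta> / ln N)\<^sup>2"
    using J_le exp_mv ln_N by (intro mult_mono) auto
  also have "\<dots> = 4 * (\<alpha> * \<beta>) * (\<alpha> * \<beta>) / ln N" using lN by (simp add: power2_eq_square)
  also have "\<dots> \<le> 4 * (\<alpha> * \<beta>) * (\<alpha> * \<beta>) / 1"
    using ln_N ab_prod by (intro divide_left_mono) auto
  also have "\<dots> = 4 * (\<alpha> * \<beta>) * (\<alpha> * \<beta>)" by simp
  also have "\<dots> \<le> 4 * (1/16) * (\<alpha> * \<beta>)" using ab_prod by (intro mult_right_mono mult_left_mono) auto
  also have "\<dots> \<le> \<alpha> * 1" using ab by simp
  finally show ?thesis by simp
qed

lemma alt_level: "exp (- real mv / 4096) + exp (- real mv / 4096) \<le> \<beta>"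
proof -
  have "2 * (\<alpha> * \<beta>)\<^sup>2 = 2 * (\<alpha> * \<beta>) * \<alpha> * \<beta>" by (simp add: power2_eq_square)
  also have "\<dots> \<le> 2 * (1/16) * 1 * \<beta>" using ab ab_prod by (intro mult_right_mono mult_mono) auto
  also have "\<dots> \<le> \<beta>" using ab by simp
  finally show ?thesis using exp_mv' by linarith
qed

lemma alt_level': "0 + exp (- real mv / 4096) \<le> \<beta>"
proof -
  have "0 \<le> exp (- real mv / 4096)" by simp
  thus ?thesis using alt_level by linarith
qed

text \<open>The size of one half cell. The argument \<open>k\<close> is the number of queries per
  group, \<open>M ^ d\<close> without interaction and \<open>1\<close> with it; this is where
  interaction saves users.\<close>

definition users :: "nat \<Rightarrow> nat" where
  "users k = (n1 - 1) div (2 * J * mv * k)"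

lemma users_budget: "(\<Sum>j<J. mv * (k j * (2 * users (k j)))) \<le> n1 - 1"
proof -
  have "J * (mv * (k j * (2 * users (k j)))) \<le> n1 - 1" for j
  proof -
    have "J * (mv * (k j * (2 * users (k j)))) = (2 * J * mv * k j) * ((n1 - 1) div (2 * J * mv * k j))"
      by (simp add: users_def)
    also have "\<dots> \<le> n1 - 1" by (rule times_div_less_eq_dividend)
    finally show ?thesis .
  qed
  hence "J * (\<Sum>j<J. mv * (k j * (2 * users (k j)))) \<le> (\<Sum>j<J. n1 - 1)"
    unfolding sum_distrib_left by (intro sum_mono)
  hence "J * (\<Sum>j<J. mv * (k j * (2 * users (k j)))) \<le> J * (n1 - 1)" by simp
  thus ?thesis using J_pos by simp
qed

text \<open>The divisor \<open>D\<close> is at most \<open>65544 * (ln N * L0 * k)\<close> with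
  \<open>65544 = 2 * 32772\<close>. The hypothesis makes \<open>n1\<close> at least
  \<open>2 * D\<close>, so the quotient is positive, and passing from \<open>n1\<close> to
  \<open>n1 - 1\<close> and rounding down cost a factor of two each.\<close>

lemma users_lower:
  assumes k: "0 < k" and le: "131088 * (ln N * L0 * real k) \<le> real n1"
  shows "0 < users k" "real n1 \<le> 262176 * (ln N * L0 * real k) * real (users k)"
proof -
  define D where "D = 2 * J * mv * k"
  have D0: "0 < D" using k J_pos mv_bounds by (simp add: D_def)
  have "real D = 2 * (real J * real mv) * real k" by (simp add: D_def)
  also have "\<dots> \<le> 2 * (32772 * (ln N * L0)) * real k"
    using J_mv by (intro mult_right_mono mult_left_mono) auto
  finally have Dle: "real D \<le> 65544 * (ln N * L0 * real k)" by (simp add: mult_ac)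
  hence D2: "2 * real D \<le> real n1" using le by linarith
  have n4: "4 \<le> real n1" using N_ge N_le by linarith
  have x: "real (n1 - 1) = real n1 - 1" using n12 by simp
  have "real D \<le> real (n1 - 1)" using D2 n4 unfolding x by linarith
  hence "D \<le> n1 - 1" by simp
  hence q1: "1 \<le> users k" using D0 unfolding users_def D_def[symmetric]
    by (metis One_nat_def Suc_leI div_greater_zero_iff)
  thus "0 < users k" by simp
  have "n1 - 1 < D * (users k + 1)" using D0 unfolding users_def D_def[symmetric]
    by (metis Suc_eq_plus1 dividend_less_times_div mult_Suc_right)
  hence "real (n1 - 1) < real D * (real (users k) + 1)" by (metis of_nat_less_iff of_nat_mult of_nat_add of_nat_1)
  also have "\<dots> \<le> real D * (2 * real (users k))" using q1 by (intro mult_left_mono) auto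
  finally have "real n1 \<le> 4 * real D * real (users k)" using n4 unfolding x by linarith
  also have "\<dots> \<le> 4 * (65544 * (ln N * L0 * real k)) * real (users k)"
    by (intro mult_right_mono mult_left_mono Dle) auto
  finally show "real n1 \<le> 262176 * (ln N * L0 * real k) * real (users k)" by (simp add: mult_ac)
qed

end

section \<open>The two tests\<close>

context test_params
begin

text \<open>A group measures all \<open>k = M ^ d\<close> coefficients, so a half cell has about
  \<open>n1 / (k * ln N * L0)\<close> users. The vote needs
  \<open>m * \<epsilon>^2 * \<Delta>\<close> of order \<open>sqrt k\<close>, that is
  \<open>N * \<Delta>\<close> of order \<open>k * sqrt k\<close> up to logarithms; this is the
  source of \<open>e = 3 * d / 2\<close>.\<close>

lemma noninteractive_test:
  assumes d: "1 \<le> d" and r: "0 < r" and p: "1 \<le> p" "p \<le> 2"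
  shows "\<exists>MZ QX QY \<phi>. non_interactive QX QY \<and> LDP_mech d MZ n1 n2 \<epsilon> QX QY \<and> test_ok MZ n1 n2 \<phi> \<and>
    (\<forall>f. is_density d f \<longrightarrow> reject_prob d MZ n1 n2 QX QY \<phi> f f \<le> \<alpha>) \<and>
    (\<forall>s>0. \<forall>fX fY. fX \<in> dens_class d s r \<longrightarrow> fY \<in> dens_class d s r \<longrightarrow>
       rate_const d r (3 * real d / 2) * ((ln N * L0\<^sup>2) / N) powr (2 * s / (4 * s + 3 * real d)) \<le> Lp_dist d p fX fY \<longrightarrow>
       accept_prob d MZ n1 n2 QX QY \<phi> fX fY \<le> \<beta>)"
proof -
  define L where "L = (\<lambda>j::nat. freq_box d (2 ^ j))"
  define h where "h = (\<lambda>(j::nat) (v::nat) l (w::out) x. trig d l x / sqrt 2 ^ d)"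
  define m where "m = (\<lambda>j. users (card (L j)))"
  have cL: "card (L j) = (2 ^ j) ^ d" for j by (simp add: L_def card_freq_box)
  show ?thesis
  \<comment> \<open>Length one is the shortest vector that can carry an answer.\<close>
  proof (rule protocol[where K = 1 and L = L and h = h and m = m and J = J and mv = mv and d = d
        and \<epsilon> = \<epsilon> and ?n1.0 = n1 and ?n2.0 = n2])
    show "L j \<noteq> {}" for j using cL[of j] by auto
    show "(\<Sum>j<J. mv * (card (L j) * (2 * m j))) \<le> n1 - 1"
      unfolding m_def by (rule users_budget)
    show "\<bar>h j v l w x\<bar> \<le> 1" for j v l w x using trig_bound[of d l x] by (simp add: h_def)
    show "h j v l w \<in> borel_measurable (lebd d)" for j v l w unfolding h_def by measurable
    show "0 < (1 :: nat)" by simp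
    show "0 < \<epsilon>" "\<epsilon> \<le> 1" "1 \<le> n1" "n1 \<le> n2" "0 < mv" by (fact eps n12 mv_bounds)+
    show "finite (L j)" for j by (simp add: L_def)
  next
    fix Q \<phi> assume Q:
      "(\<And>j v l w w' x. h j v l w x = h j v l w' x) \<Longrightarrow> non_interactive Q Q"
      "LDP_mech d (count_space (signs 1)) n1 n2 \<epsilon> Q Q"
      "test_ok (count_space (signs 1)) n1 n2 \<phi>"
      "\<And>f. is_density d f \<Longrightarrow>
         reject_prob d (count_space (signs 1)) n1 n2 Q Q \<phi> f f \<le> real J * exp (- real mv / 4096)"
      "\<And>fX fY j \<eta>. is_density d fX \<Longrightarrow> is_density d fY \<Longrightarrow> j < J \<Longrightarrow> 0 < m j \<Longrightarrow>
         real (card {w \<in> signs 1. real (card {v. v < mv \<and> 256 * sqrt (real (card (L j))) \<le>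
            real (m j) * (\<Sum>l\<in>L j. (\<epsilon> / 6 * ((\<integral>x. h j v l w x \<partial>dens d fX) - (\<integral>x. h j v l w x \<partial>dens d fY)))\<^sup>2)})
            < real mv / 16}) \<le> \<eta> * 2 ^ 1 \<Longrightarrow>
         accept_prob d (count_space (signs 1)) n1 n2 Q Q \<phi> fX fY \<le> \<eta> + exp (- real mv / 4096)"
    show ?thesis
    proof (intro exI conjI allI impI)
      show "non_interactive Q Q" by (rule Q(1)) (simp add: h_def)
      show "LDP_mech d (count_space (signs 1)) n1 n2 \<epsilon> Q Q" "test_ok (count_space (signs 1)) n1 n2 \<phi>" by (rule Q)+
      show "reject_prob d (count_space (signs 1)) n1 n2 Q Q \<phi> f f \<le> \<alpha>" if "is_density d f" for f
        using Q(4)[OF that] null_level by linarith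
      fix s fX fY
      assume s: "0 < s" and fX: "fX \<in> dens_class d s r" and fY: "fY \<in> dens_class d s r"
        and sep: "rate_const d r (3 * real d / 2) * ((ln N * L0\<^sup>2) / N) powr (2 * s / (4 * s + 3 * real d)) \<le> Lp_dist d p fX fY"
      have dX: "is_density d fX" and dY: "is_density d fY" using fX fY by (auto simp: dens_class_def)
      define A where "A = ln N * L0\<^sup>2"
      define e where "e = 3 * real d / 2"
      have e1: "1 \<le> e" using d by (simp add: e_def)
      have L02: "L0 \<le> L0\<^sup>2" using L0_ge by (simp add: power2_eq_square)
      have lA: "ln N * L0 \<le> A" unfolding A_def using ln_N L02 by (intro mult_left_mono) auto
      have "1 * 1 \<le> ln N * L0" using ln_N L0_ge by (intro mult_mono) auto
      hence lL: "1 \<le> ln N * L0" by simp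
      hence A1: "1 \<le> A" using lA by linarith
      obtain \<delta> j where \<delta>: "\<And>l. l \<in> MI d \<Longrightarrow> (\<integral>x. trig d l x \<partial>dens d fX) - (\<integral>x. trig d l x \<partial>dens d fY) = \<delta> l"
        and j: "j < nat \<lceil>log 2 N\<rceil> + 1" "131088 * A \<le> N"
        "131088 * (real (2 ^ j) powr e * A) \<le> N"
        "sep_const * 2 ^ d * (real (2 ^ j) powr e * A) \<le> N * (\<Sum>l\<in>freq_box d (2 ^ j). (\<delta> l)\<^sup>2)"
        by (rule separated_scale[OF fX fY s r p e1 A1, of N])
           (use N_ge sep in \<open>auto simp: e_def A_def\<close>)
      define k where "k = real (card (L j))"
      define \<Delta> where "\<Delta> = (\<Sum>l\<in>L j. (\<delta> l)\<^sup>2)"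
      have kp: "0 < card (L j)" by (simp add: cL)
      have k1: "1 \<le> k" using kp by (simp add: k_def)
      have ke: "real (2 ^ j) powr e = k * sqrt k"
      proof -
        have "k * sqrt k = k powr 1 * k powr (1/2)" using k1 by (simp add: powr_half_sqrt)
        also have "\<dots> = k powr (1 + 1/2)" by (simp only: powr_add)
        also have "\<dots> = (real (2 ^ j) powr real d) powr (1 + 1/2)"
          by (simp add: k_def cL powr_realpow)
        also have "\<dots> = real (2 ^ j) powr e" unfolding powr_powr e_def by (simp add: field_simps)
        finally show ?thesis by simp
      qed
      have kke: "k \<le> k * sqrt k" using k1 by simp
      have "131088 * (ln N * L0 * k) \<le> 131088 * (A * (k * sqrt k))"
        using lA kke k1 A1 by (intro mult_left_mono mult_mono) auto
      also have "\<dots> \<le> real n1" using j(3) N_le unfolding ke by (simp add: mult_ac)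
      finally have ul: "131088 * (ln N * L0 * real (card (L j))) \<le> real n1" by (simp add: k_def)
      have m0: "0 < m j" and mlow: "real n1 \<le> 262176 * (ln N * L0 * k) * real (m j)"
        using users_lower[OF kp ul] by (simp_all add: m_def k_def)
      have "262176 * (ln N * L0 * k) * real (m j) \<le> 262176 * (A * k) * real (m j)"
        using lA k1 by (intro mult_right_mono mult_left_mono) auto
      hence mA: "real n1 \<le> 262176 * (A * k) * real (m j)" using mlow by linarith
      have n0: "0 < real n1" using n12 by simp
      have main: "256 * sqrt k \<le> real (m j) * (\<epsilon>\<^sup>2 / 36 / 2 ^ d * \<Delta>)"
      proof -
        have "real n1 * (256 * 36 * 2 ^ d * sqrt k) \<le> 262176 * (A * k) * real (m j) * (256 * 36 * 2 ^ d * sqrt k)"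
          using mA k1 by (intro mult_right_mono) auto
        also have "\<dots> = (262176 * 256 * 36) * (real (m j) * (2 ^ d * (k * sqrt k * A)))" by (simp add: mult_ac)
        also have "\<dots> \<le> sep_const * (real (m j) * (2 ^ d * (k * sqrt k * A)))"
          using k1 A1 by (intro mult_right_mono) (auto simp: sep_const_def)
        also have "\<dots> = real (m j) * (sep_const * 2 ^ d * (k * sqrt k * A))" by (simp add: mult_ac)
        also have "\<dots> \<le> real (m j) * (N * \<Delta>)"
          using j(4) unfolding ke by (intro mult_left_mono) (auto simp: \<Delta>_def L_def)
        also have "\<dots> = real n1 * (real (m j) * (\<epsilon>\<^sup>2 * \<Delta>))" by (simp add: N_def mult_ac)
        finally have "256 * 36 * 2 ^ d * sqrt k \<le> real (m j) * (\<epsilon>\<^sup>2 * \<Delta>)"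
          using n0 by (simp only: mult_le_cancel_left_pos)
        thus ?thesis by (simp add: field_simps)
      qed
      have sq2: "(sqrt 2 ^ d)\<^sup>2 = (2 :: real) ^ d"
        by (metis power_commutes power_mult real_sqrt_pow2 zero_le_numeral mult.commute)
      have hint: "(\<integral>x. h j v l w x \<partial>dens d fX) - (\<integral>x. h j v l w x \<partial>dens d fY) = \<delta> l / sqrt 2 ^ d"
        if "l \<in> L j" for v l w
        using \<delta>[of l] that freq_box_subset_MI[of d "2 ^ j"] by (auto simp: h_def L_def diff_divide_distrib[symmetric])
      have sumeq: "(\<Sum>l\<in>L j. (\<epsilon> / 6 * ((\<integral>x. h j v l w x \<partial>dens d fX) - (\<integral>x. h j v l w x \<partial>dens d fY)))\<^sup>2) = \<epsilon>\<^sup>2 / 36 / 2 ^ d * \<Delta>" for v w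
      proof -
        have "(\<Sum>l\<in>L j. (\<epsilon> / 6 * ((\<integral>x. h j v l w x \<partial>dens d fX) - (\<integral>x. h j v l w x \<partial>dens d fY)))\<^sup>2) =
            (\<Sum>l\<in>L j. \<epsilon>\<^sup>2 / 36 / 2 ^ d * (\<delta> l)\<^sup>2)"
          by (intro sum.cong refl) (simp add: hint power_mult_distrib power_divide sq2)
        thus ?thesis by (simp add: \<Delta>_def sum_distrib_left)
      qed
      have jJ: "j < J" using j(1) by (simp add: J_def)
      \<comment> \<open>The queries depend neither on the coin nor on the group, so all groups are
        good for every coin and \<open>\<eta> = 0\<close> is possible.\<close>
      have "accept_prob d (count_space (signs 1)) n1 n2 Q Q \<phi> fX fY \<le> 0 + exp (- real mv / 4096)"
      proof (rule Q(5)[OF dX dY jJ m0])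
        have "{v. v < mv \<and> 256 * sqrt (real (card (L j))) \<le>
            real (m j) * (\<Sum>l\<in>L j. (\<epsilon> / 6 * ((\<integral>x. h j v l w x \<partial>dens d fX) - (\<integral>x. h j v l w x \<partial>dens d fY)))\<^sup>2)} = {..<mv}" for w
          using main unfolding sumeq k_def by auto
        thus "real (card {w \<in> signs 1. real (card {v. v < mv \<and> 256 * sqrt (real (card (L j))) \<le>
            real (m j) * (\<Sum>l\<in>L j. (\<epsilon> / 6 * ((\<integral>x. h j v l w x \<partial>dens d fX) - (\<integral>x. h j v l w x \<partial>dens d fY)))\<^sup>2)})
            < real mv / 16}) \<le> 0 * 2 ^ 1" by simp
      qed
      thus "accept_prob d (count_space (signs 1)) n1 n2 Q Q \<phi> fX fY \<le> \<beta>" using alt_level' by linarith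
    qed
  qed
qed

text \<open>A single query per group spares the factor \<open>k\<close> in the number of users.
  Instead the signal is divided by the square of the clipping bound, which is \<open>k\<close> up to
  logarithms, and no \<open>sqrt k\<close> enters the threshold because there is one cell. The vote
  needs \<open>N * \<Delta>\<close> of order \<open>k\<close>, the source of
  \<open>e = d\<close>.\<close>

lemma interactive_test:
  assumes d: "1 \<le> d" and r: "0 < r" and p: "1 \<le> p" "p \<le> 2"
  shows "\<exists>MZ QX QY \<phi>. LDP_mech d MZ n1 n2 \<epsilon> QX QY \<and> test_ok MZ n1 n2 \<phi> \<and>
    (\<forall>f. is_density d f \<longrightarrow> reject_prob d MZ n1 n2 QX QY \<phi> f f \<le> \<alpha>) \<and>
    (\<forall>s>0. \<forall>fX fY. fX \<in> dens_class d s r \<longrightarrow> fY \<in> dens_class d s r \<longrightarrow>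
       rate_const d r (real d) * ((ln N * (ln (real n2 / \<beta>) * L0)\<^sup>2) / N) powr (2 * s / (4 * s + 2 * real d)) \<le> Lp_dist d p fX fY \<longrightarrow>
       accept_prob d MZ n1 n2 QX QY \<phi> fX fY \<le> \<beta>)"
proof -
  define \<Lambda> where "\<Lambda> = ln (real n2 / \<beta>)"
  have n24: "4 \<le> real n2" using N_ge N_le n12 by linarith
  have "\<beta> \<le> 1" using ab by simp
  hence nb: "real n2 \<le> real n2 / \<beta>" using ab n24 by (simp add: le_divide_eq mult_left_le)
  have \<Lambda>1: "1 \<le> \<Lambda>" unfolding \<Lambda>_def using nb n24 exp_le by (subst ln_ge_iff) auto
  \<comment> \<open>At a point the polynomial is sub-Gaussian with variance proxy
    \<open>2 ^ d * k\<close>. The multiple \<open>3 * \<Lambda>\<close> makes the tail exponent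
    \<open>9/2 * \<Lambda>^2\<close>, which is at least \<open>2 * \<Lambda>\<close>, so the
    exponential factor is at most \<open>(\<beta> / n2)^2\<close>. This is how
    \<open>ln (n2 / \<beta>)\<close> enters the rate.\<close>
  define \<tau> where "\<tau> = (\<lambda>j::nat. 3 * \<Lambda> * (sqrt 2 ^ d * sqrt (real ((2 ^ j) ^ d))))"
  have \<tau>0: "0 < \<tau> j" for j using \<Lambda>1 by (simp add: \<tau>_def)
  \<comment> \<open>One bit of the coin for each scale, group and frequency, so that the groups use
    independent signs; \<open>K\<close> is their number.\<close>
  define C where "C = (SIGMA j:{..<J}. {..<mv} \<times> freq_box d (2 ^ j))"
  have finC: "finite C" unfolding C_def by (intro finite_SigmaI finite_cartesian_product) auto
  define K where "K = card C"
  have "card (freq_box d (2 ^ 0)) \<noteq> 0" by (simp add: card_freq_box)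
  then obtain l0 where "l0 \<in> freq_box d (2 ^ 0)" by fastforce
  hence "(0, 0, l0) \<in> C" using J_pos mv_bounds by (simp add: C_def)
  hence K: "0 < K" using finC by (auto simp: K_def card_gt_0_iff)
  obtain enc where enc: "bij_betw enc C {0..<K}" using ex_bij_betw_finite_nat[OF finC] by (auto simp: K_def)
  define E where "E = (\<lambda>j v l. enc (j, v, l))"
  have EK: "E j v l < K" if "j < J" "v < mv" "l \<in> freq_box d (2 ^ j)" for j v l
    using bij_betwE[OF enc] that by (auto simp: E_def C_def)
  have Einj: "inj_on (\<lambda>(v, l). E j v l) ({..<mv} \<times> freq_box d (2 ^ j))" if "j < J" for j
  proof (rule inj_onI)
    fix a b assume "a \<in> {..<mv} \<times> freq_box d (2 ^ j)" "b \<in> {..<mv} \<times> freq_box d (2 ^ j)"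
      "(case a of (v, l) \<Rightarrow> E j v l) = (case b of (v, l) \<Rightarrow> E j v l)"
    thus "a = b"
      using inj_onD[OF bij_betw_imp_inj_on[OF enc], of "(j, a)" "(j, b)"] that
      by (auto simp: E_def C_def)
  qed
  define h where "h = (\<lambda>j v (l::unit) w x. clip (\<tau> j) (coin_poly d (2 ^ j) (E j v) w x) / \<tau> j)"
  define m where "m = (\<lambda>j::nat. users (card {()}))"
  show ?thesis
  proof (rule protocol[where K = K and L = "\<lambda>_. {()}" and h = h and m = m and J = J and mv = mv and d = d
        and \<epsilon> = \<epsilon> and ?n1.0 = n1 and ?n2.0 = n2])
    show "(\<Sum>j<J. mv * (card {()} * (2 * m j))) \<le> n1 - 1"
      unfolding m_def by (rule users_budget)
    show "\<bar>h j v l w x\<bar> \<le> 1" for j v l w x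
      using clip_bound[of "\<tau> j"] \<tau>0[of j] by (simp add: h_def less_imp_le)
    show "h j v l w \<in> borel_measurable (lebd d)" for j v l w unfolding h_def by measurable
    show "0 < K" "0 < \<epsilon>" "\<epsilon> \<le> 1" "1 \<le> n1" "n1 \<le> n2" "0 < mv" by (fact K eps n12 mv_bounds)+
    show "finite {()}" "{()} \<noteq> {}" by auto
  next
    fix Q \<phi> assume Q:
      "(\<And>j v l w w' x. h j v l w x = h j v l w' x) \<Longrightarrow> non_interactive Q Q"
      "LDP_mech d (count_space (signs K)) n1 n2 \<epsilon> Q Q"
      "test_ok (count_space (signs K)) n1 n2 \<phi>"
      "\<And>f. is_density d f \<Longrightarrow>
         reject_prob d (count_space (signs K)) n1 n2 Q Q \<phi> f f \<le> real J * exp (- real mv / 4096)"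
      "\<And>fX fY j \<eta>. is_density d fX \<Longrightarrow> is_density d fY \<Longrightarrow> j < J \<Longrightarrow> 0 < m j \<Longrightarrow>
         real (card {w \<in> signs K. real (card {v. v < mv \<and> 256 * sqrt (real (card {()})) \<le>
            real (m j) * (\<Sum>l\<in>{()}. (\<epsilon> / 6 * ((\<integral>x. h j v l w x \<partial>dens d fX) - (\<integral>x. h j v l w x \<partial>dens d fY)))\<^sup>2)})
            < real mv / 16}) \<le> \<eta> * 2 ^ K \<Longrightarrow>
         accept_prob d (count_space (signs K)) n1 n2 Q Q \<phi> fX fY \<le> \<eta> + exp (- real mv / 4096)"
    show ?thesis
    proof (intro exI conjI allI impI)
      show "LDP_mech d (count_space (signs K)) n1 n2 \<epsilon> Q Q" "test_ok (count_space (signs K)) n1 n2 \<phi>" by (rule Q)+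
      show "reject_prob d (count_space (signs K)) n1 n2 Q Q \<phi> f f \<le> \<alpha>" if "is_density d f" for f
        using Q(4)[OF that] null_level by linarith
      fix s fX fY
      assume s: "0 < s" and fX: "fX \<in> dens_class d s r" and fY: "fY \<in> dens_class d s r"
        and sep: "rate_const d r (real d) * ((ln N * (ln (real n2 / \<beta>) * L0)\<^sup>2) / N) powr (2 * s / (4 * s + 2 * real d)) \<le> Lp_dist d p fX fY"
      have dX: "is_density d fX" and dY: "is_density d fY" using fX fY by (auto simp: dens_class_def)
      define A where "A = ln N * (\<Lambda> * L0)\<^sup>2"
      have e1: "1 \<le> real d" using d by simp
      have L02: "L0 \<le> L0\<^sup>2" using L0_ge by (simp add: power2_eq_square)
      have \<Lambda>2: "1 \<le> \<Lambda>\<^sup>2" using \<Lambda>1 by simp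
      have "(ln N * L0) * \<Lambda>\<^sup>2 \<le> (ln N * L0\<^sup>2) * \<Lambda>\<^sup>2" using ln_N L02 by (intro mult_right_mono mult_left_mono) auto
      hence lA: "ln N * L0 * \<Lambda>\<^sup>2 \<le> A" unfolding A_def by (simp add: power_mult_distrib mult_ac)
      have "1 * 1 \<le> ln N * L0" using ln_N L0_ge by (intro mult_mono) auto
      hence lL: "1 \<le> ln N * L0" by simp
      have lA': "ln N * L0 \<le> A" using lA mult_left_mono[OF \<Lambda>2, of "ln N * L0"] lL by linarith
      hence A1: "1 \<le> A" using lL by linarith
      obtain \<delta> j where \<delta>: "\<And>l. l \<in> MI d \<Longrightarrow> (\<integral>x. trig d l x \<partial>dens d fX) - (\<integral>x. trig d l x \<partial>dens d fY) = \<delta> l"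
        and j: "j < nat \<lceil>log 2 N\<rceil> + 1" "131088 * A \<le> N"
        "131088 * (real (2 ^ j) powr real d * A) \<le> N"
        "sep_const * 2 ^ d * (real (2 ^ j) powr real d * A) \<le> N * (\<Sum>l\<in>freq_box d (2 ^ j). (\<delta> l)\<^sup>2)"
        by (rule separated_scale[OF fX fY s r p e1 A1, of N])
           (use N_ge sep in \<open>auto simp: \<Lambda>_def A_def\<close>)
      define k where "k = real ((2 ^ j) ^ d)"
      define \<Delta> where "\<Delta> = (\<Sum>l\<in>freq_box d (2 ^ j). (\<delta> l)\<^sup>2)"
      have k1: "1 \<le> k" by (simp add: k_def)
      have ke: "real (2 ^ j) powr real d = k" by (simp add: k_def powr_realpow)
      have N0: "0 < N" using N_ge by linarith
      have D: "sep_const * 2 ^ d * (k * A) \<le> N * \<Delta>" using j(4) unfolding ke \<Delta>_def .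
      have sc: "0 < sep_const" by (simp add: sep_const_def)
      have "0 < N * \<Delta>" using D sc k1 A1 by (intro less_le_trans[OF _ D]) auto
      hence \<Delta>0: "0 < \<Delta>" using N0 by (simp add: zero_less_mult_iff)
      have ul: "131088 * (ln N * L0 * real 1) \<le> real n1" using lA' j(2) N_le by simp
      have m0: "0 < m j" and mlow: "real n1 \<le> 262176 * (ln N * L0) * real (m j)"
        using users_lower[OF zero_less_one ul] by (simp_all add: m_def)
      have n0: "0 < real n1" using n12 by simp
      have sq2: "(sqrt 2 ^ d)\<^sup>2 = (2 :: real) ^ d"
        by (metis power_commutes power_mult real_sqrt_pow2 zero_le_numeral mult.commute)
      have \<tau>2: "(\<tau> j)\<^sup>2 = 9 * \<Lambda>\<^sup>2 * (2 ^ d * k)"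
        using k1 unfolding \<tau>_def k_def[symmetric] by (simp add: power_mult_distrib sq2)
      have main: "256 \<le> real (m j) * ((\<epsilon> / 6)\<^sup>2 * (\<Delta> / (16 * (\<tau> j)\<^sup>2)))"
      proof -
        have "real n1 * (256 * 5184 * (\<Lambda>\<^sup>2 * (2 ^ d * k))) \<le>
            262176 * (ln N * L0) * real (m j) * (256 * 5184 * (\<Lambda>\<^sup>2 * (2 ^ d * k)))"
          using mlow k1 by (intro mult_right_mono) auto
        also have "\<dots> = sep_const * (real (m j) * (2 ^ d * k * (ln N * L0 * \<Lambda>\<^sup>2)))"
          by (simp add: sep_const_def mult_ac)
        also have "\<dots> \<le> sep_const * (real (m j) * (2 ^ d * k * A))"
          using lA sc k1 by (intro mult_left_mono) auto
        also have "\<dots> = real (m j) * (sep_const * 2 ^ d * (k * A))" by (simp add: mult_ac)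
        also have "\<dots> \<le> real (m j) * (N * \<Delta>)" by (intro mult_left_mono D) auto
        also have "\<dots> = real n1 * (real (m j) * (\<epsilon>\<^sup>2 * \<Delta>))" by (simp add: N_def mult_ac)
        finally have "256 * 5184 * (\<Lambda>\<^sup>2 * (2 ^ d * k)) \<le> real (m j) * (\<epsilon>\<^sup>2 * \<Delta>)"
          using n0 by (simp only: mult_le_cancel_left_pos)
        moreover have "0 < \<Lambda>\<^sup>2 * (2 ^ d * k)" using \<Lambda>1 k1 by auto
        ultimately show ?thesis unfolding \<tau>2 by (simp add: field_simps power2_eq_square)
      qed
      have jJ: "j < J" using j(1) by (simp add: J_def)
      \<comment> \<open>The separation keeps \<open>\<Delta>\<close> above order
        \<open>k / N\<close>, and \<open>k\<close> and \<open>N\<close> are at most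
        \<open>n2\<close>. The clipping error is of order \<open>k / n2^2\<close>, whose square is
        of order at most \<open>k / n2\<close>, hence below \<open>\<Delta>\<close>.\<close>
      have small: "256 * real ((2 ^ j) ^ d) * sqrt 2 ^ d * exp (- (\<tau> j)\<^sup>2 / (2 * real ((2 ^ j) ^ d) * 2 ^ d)) \<le> sqrt \<Delta>"
      proof -
        have "- (\<tau> j)\<^sup>2 / (2 * k * 2 ^ d) = - (9 / 2 * \<Lambda>\<^sup>2)"
          unfolding \<tau>2 using k1 by (simp add: field_simps)
        also have "\<dots> \<le> - \<Lambda> + - \<Lambda>"
          using mult_left_mono[OF \<Lambda>1, of \<Lambda>] \<Lambda>1 unfolding power2_eq_square by simp
        finally have "exp (- (\<tau> j)\<^sup>2 / (2 * k * 2 ^ d)) \<le> exp (- \<Lambda> + - \<Lambda>)" by simp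
        also have "\<dots> = (inverse (exp \<Lambda>))\<^sup>2" by (simp only: exp_add exp_minus power2_eq_square)
        also have "exp \<Lambda> = real n2 / \<beta>" unfolding \<Lambda>_def using n24 ab by (intro exp_ln) auto
        also have "(inverse (real n2 / \<beta>))\<^sup>2 \<le> (1 / real n2)\<^sup>2"
          using n24 ab \<open>\<beta> \<le> 1\<close> by (intro power_mono) (auto simp: divide_right_mono)
        finally have ex: "exp (- (\<tau> j)\<^sup>2 / (2 * k * 2 ^ d)) \<le> 1 / (real n2)\<^sup>2" by (simp add: power_divide)
        have "131088 * k \<le> 131088 * (k * A)" using A1 k1 by simp
        hence kn: "k \<le> real n2" using j(3) N_le n12 k1 unfolding ke by linarith
        have "256 * k * sqrt 2 ^ d * exp (- (\<tau> j)\<^sup>2 / (2 * k * 2 ^ d)) \<le> 256 * k * sqrt 2 ^ d * (1 / (real n2)\<^sup>2)"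
          using k1 by (intro mult_left_mono ex) auto
        moreover have "256 * k * sqrt 2 ^ d * (1 / (real n2)\<^sup>2) \<le> sqrt \<Delta>"
        proof (rule real_le_rsqrt)
          have "(256 * k * sqrt 2 ^ d * (1 / (real n2)\<^sup>2))\<^sup>2 = 65536 * 2 ^ d * k * (k / (real n2) ^ 4)"
            unfolding sq2[symmetric] by (simp add: power2_eq_square power4_eq_xxxx mult_ac)
          also have "\<dots> \<le> 65536 * 2 ^ d * k * (1 / real n2)"
          proof -
            have "k / (real n2) ^ 4 \<le> real n2 / (real n2) ^ 4" using kn by (intro divide_right_mono) auto
            also have "\<dots> = 1 / (real n2) ^ 3" using n24 by (simp add: power3_eq_cube power4_eq_xxxx)
            also have "\<dots> \<le> 1 / real n2" using n24 by (intro divide_left_mono self_le_power) auto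
            finally show ?thesis using k1 by (intro mult_left_mono) auto
          qed
          also have "\<dots> \<le> sep_const * 2 ^ d * (k * A) / N"
          proof -
            have "1 / real n2 \<le> A / N" using A1 N0 N_le n12 by (intro frac_le) auto
            hence "65536 * 2 ^ d * k * (1 / real n2) \<le> sep_const * 2 ^ d * k * (A / N)"
              using k1 n24 by (intro mult_mono) (auto simp: sep_const_def)
            thus ?thesis by (simp add: mult_ac)
          qed
          also have "\<dots> \<le> \<Delta>" using D N0 by (simp add: divide_le_eq mult.commute)
          finally show "(256 * k * sqrt 2 ^ d * (1 / (real n2)\<^sup>2))\<^sup>2 \<le> \<Delta>" .
        qed
        ultimately show ?thesis unfolding k_def[symmetric] by linarith
      qed
      let ?D = "\<lambda>v w. (\<integral>x. clip (\<tau> j) (coin_poly d (2 ^ j) (E j v) w x) / \<tau> j \<partial>dens d fX) -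
        (\<integral>x. clip (\<tau> j) (coin_poly d (2 ^ j) (E j v) w x) / \<tau> j \<partial>dens d fY)"
      have core: "real (card {w \<in> signs K. real (card {v. v < mv \<and> \<Delta> / (16 * (\<tau> j)\<^sup>2) \<le> (?D v w)\<^sup>2}) < real mv / 16})
          \<le> exp (- real mv / 4096) * 2 ^ K"
        by (rule coin_core[OF mv_bounds(3) _ \<tau>0 Einj[OF jJ] EK[OF jJ] dX dY \<delta> _ \<Delta>0 small])
           (auto simp: \<Delta>_def)
      \<comment> \<open>The first exponential is the share of coins with which too few groups
        correlate with the difference, the second is the error of the vote given the coin.\<close>
      have "accept_prob d (count_space (signs K)) n1 n2 Q Q \<phi> fX fY \<le> exp (- real mv / 4096) + exp (- real mv / 4096)"
      proof (rule Q(5)[OF dX dY jJ m0], rule order_trans[OF _ core], intro of_nat_mono card_mono)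
        let ?G = "\<lambda>w. {v. v < mv \<and> 256 * sqrt (real (card {()})) \<le>
            real (m j) * (\<Sum>l\<in>{()}. (\<epsilon> / 6 * ((\<integral>x. h j v l w x \<partial>dens d fX) - (\<integral>x. h j v l w x \<partial>dens d fY)))\<^sup>2)}"
        have "{v. v < mv \<and> \<Delta> / (16 * (\<tau> j)\<^sup>2) \<le> (?D v w)\<^sup>2} \<subseteq> ?G w" for w
        proof
          fix v assume v: "v \<in> {v. v < mv \<and> \<Delta> / (16 * (\<tau> j)\<^sup>2) \<le> (?D v w)\<^sup>2}"
          have "real (m j) * ((\<epsilon> / 6)\<^sup>2 * (\<Delta> / (16 * (\<tau> j)\<^sup>2))) \<le> real (m j) * ((\<epsilon> / 6)\<^sup>2 * (?D v w)\<^sup>2)"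
            using v by (intro mult_left_mono) auto
          hence "256 \<le> real (m j) * ((\<epsilon> / 6)\<^sup>2 * (?D v w)\<^sup>2)" using main by linarith
          hence "256 \<le> real (m j) * (\<epsilon> / 6 * ?D v w)\<^sup>2" by (simp only: power_mult_distrib)
          thus "v \<in> ?G w" using v by (simp add: h_def)
        qed
        hence "card {v. v < mv \<and> \<Delta> / (16 * (\<tau> j)\<^sup>2) \<le> (?D v w)\<^sup>2} \<le> card (?G w)" for w
          by (intro card_mono) auto
        hence "real (card {v. v < mv \<and> \<Delta> / (16 * (\<tau> j)\<^sup>2) \<le> (?D v w)\<^sup>2}) \<le> real (card (?G w))" for w
          by (intro of_nat_mono)
        note le = this
        show "{w \<in> signs K. real (card (?G w)) < real mv / 16} \<subseteq>
            {w \<in> signs K. real (card {v. v < mv \<and> \<Delta> / (16 * (\<tau> j)\<^sup>2) \<le> (?D v w)\<^sup>2}) < real mv / 16}"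
        proof (intro Collect_mono impI)
          fix w assume "w \<in> signs K \<and> real (card (?G w)) < real mv / 16"
          thus "w \<in> signs K \<and> real (card {v. v < mv \<and> \<Delta> / (16 * (\<tau> j)\<^sup>2) \<le> (?D v w)\<^sup>2}) < real mv / 16"
            using le_less_trans[OF le[of w]] by blast
        qed
      qed auto
      thus "accept_prob d (count_space (signs K)) n1 n2 Q Q \<phi> fX fY \<le> \<beta>" using alt_level by linarith
    qed
  qed
qed

end

text \<open>Adaptivity is expressed by the order of quantifiers: mechanism and test are chosen
  before \<open>s\<close>. The exponent \<open>2 * s / (4 * s + 2 * e)\<close> of the separation
  becomes the stated one for \<open>e = 3 * d / 2\<close> and \<open>e = d\<close>.\<close>

theorem theorem7:
  shows "\<exists>C>0. \<exists>K1 K2 :: nat \<Rightarrow> real \<Rightarrow> real \<Rightarrow> real.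
    (\<forall>d r s. 0 < r \<longrightarrow> 0 < s \<longrightarrow> 0 < K1 d r s \<and> 0 < K2 d r s) \<and>
    (\<forall>(d::nat) (r::real) (n1::nat) (n2::nat) (\<epsilon>::real) (p::real) (\<alpha>::real) (\<beta>::real).
       1 \<le> d \<longrightarrow> 0 < r \<longrightarrow> 1 \<le> n1 \<longrightarrow> n1 \<le> n2 \<longrightarrow> 0 < \<epsilon> \<longrightarrow> \<epsilon> \<le> 1 \<longrightarrow>
       1 \<le> p \<longrightarrow> p \<le> 2 \<longrightarrow> 0 < \<alpha> \<longrightarrow> \<alpha> < 1 \<longrightarrow> 0 < \<beta> \<longrightarrow> \<beta> < 1 \<longrightarrow>
       \<alpha> + \<beta> \<le> 1/2 \<longrightarrow> real n1 * \<epsilon>\<^sup>2 \<ge> C * ln (1 / (\<alpha> * \<beta>)) \<longrightarrow>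
       (\<exists>MZ QX QY \<phi>. non_interactive QX QY \<and> LDP_mech d MZ n1 n2 \<epsilon> QX QY \<and> test_ok MZ n1 n2 \<phi> \<and>
          (\<forall>f. is_density d f \<longrightarrow> reject_prob d MZ n1 n2 QX QY \<phi> f f \<le> \<alpha>) \<and>
          (\<forall>s>0. \<forall>fX fY. fX \<in> dens_class d s r \<longrightarrow> fY \<in> dens_class d s r \<longrightarrow>
             Lp_dist d p fX fY \<ge> K1 d r s *
               ((ln (real n1 * \<epsilon>\<^sup>2) * (ln (ln (real n1 * \<epsilon>\<^sup>2) / (\<alpha> * \<beta>)))\<^sup>2)
                 / (real n1 * \<epsilon>\<^sup>2)) powr (2 * s / (4 * s + 3 * real d)) \<longrightarrow>
             accept_prob d MZ n1 n2 QX QY \<phi> fX fY \<le> \<beta>)) \<and>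
       (\<exists>MZ QX QY \<phi>. LDP_mech d MZ n1 n2 \<epsilon> QX QY \<and> test_ok MZ n1 n2 \<phi> \<and>
          (\<forall>f. is_density d f \<longrightarrow> reject_prob d MZ n1 n2 QX QY \<phi> f f \<le> \<alpha>) \<and>
          (\<forall>s>0. \<forall>fX fY. fX \<in> dens_class d s r \<longrightarrow> fY \<in> dens_class d s r \<longrightarrow>
             Lp_dist d p fX fY \<ge> K2 d r s *
               ((ln (real n1 * \<epsilon>\<^sup>2) * (ln (real n2 / \<beta>) * ln (ln (real n1 * \<epsilon>\<^sup>2) / (\<alpha> * \<beta>)))\<^sup>2)
                 / (real n1 * \<epsilon>\<^sup>2)) powr (2 * s / (4 * s + 2 * real d)) \<longrightarrow>
             accept_prob d MZ n1 n2 QX QY \<phi> fX fY \<le> \<beta>)))"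
proof (rule exI[of _ 2], rule conjI, simp, rule exI[of _ "\<lambda>d r s. rate_const d r (3 * real d / 2)"],
    rule exI[of _ "\<lambda>d r s. rate_const d r (real d)"], intro conjI allI impI)
  fix d n1 n2 :: nat and r \<epsilon> p \<alpha> \<beta> :: real
  assume d: "1 \<le> d" and r: "0 < r" and "1 \<le> n1" "n1 \<le> n2" "0 < \<epsilon>" "\<epsilon> \<le> 1" and p: "1 \<le> p" "p \<le> 2"
    and "0 < \<alpha>" "\<alpha> < 1" "0 < \<beta>" "\<beta> < 1" "\<alpha> + \<beta> \<le> 1/2" "real n1 * \<epsilon>\<^sup>2 \<ge> 2 * ln (1 / (\<alpha> * \<beta>))"
  then interpret test_params n1 n2 \<epsilon> \<alpha> \<beta> by unfold_locales auto
  show "\<exists>MZ QX QY \<phi>. non_interactive QX QY \<and> LDP_mech d MZ n1 n2 \<epsilon> QX QY \<and> test_ok MZ n1 n2 \<phi> \<and>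
          (\<forall>f. is_density d f \<longrightarrow> reject_prob d MZ n1 n2 QX QY \<phi> f f \<le> \<alpha>) \<and>
          (\<forall>s>0. \<forall>fX fY. fX \<in> dens_class d s r \<longrightarrow> fY \<in> dens_class d s r \<longrightarrow>
             Lp_dist d p fX fY \<ge> rate_const d r (3 * real d / 2) *
               ((ln (real n1 * \<epsilon>\<^sup>2) * (ln (ln (real n1 * \<epsilon>\<^sup>2) / (\<alpha> * \<beta>)))\<^sup>2)
                 / (real n1 * \<epsilon>\<^sup>2)) powr (2 * s / (4 * s + 3 * real d)) \<longrightarrow>
             accept_prob d MZ n1 n2 QX QY \<phi> fX fY \<le> \<beta>)"
    by (rule noninteractive_test[OF d r p, unfolded L0_def N_def])
  show "\<exists>MZ QX QY \<phi>. LDP_mech d MZ n1 n2 \<epsilon> QX QY \<and> test_ok MZ n1 n2 \<phi> \<and>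
          (\<forall>f. is_density d f \<longrightarrow> reject_prob d MZ n1 n2 QX QY \<phi> f f \<le> \<alpha>) \<and>
          (\<forall>s>0. \<forall>fX fY. fX \<in> dens_class d s r \<longrightarrow> fY \<in> dens_class d s r \<longrightarrow>
             Lp_dist d p fX fY \<ge> rate_const d r (real d) *
               ((ln (real n1 * \<epsilon>\<^sup>2) * (ln (real n2 / \<beta>) * ln (ln (real n1 * \<epsilon>\<^sup>2) / (\<alpha> * \<beta>)))\<^sup>2)
                 / (real n1 * \<epsilon>\<^sup>2)) powr (2 * s / (4 * s + 2 * real d)) \<longrightarrow>
             accept_prob d MZ n1 n2 QX QY \<phi> fX fY \<le> \<beta>)"
    by (rule interactive_test[OF d r p, unfolded L0_def N_def])
qed (auto simp: rate_const_pos)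

end
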